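(* Let $n\ge 4$. As $B$ ranges over all rings and $A$ ranges over all rings that are locally free of rank $n$ over $B$, there cannot exist corresponding rings $G'(A/B)$ that are locally free of rank $n!$ over $B$ and $B$-algebra maps $i_1,\dots,i_n:A\to G'(A/B)$ such that all of the following hold: (a) for every $A$ and $B$, the images of $i_1,\dots,i_n$ generate $G'(A/B)$ as a $B$-algebra; (b) $G'(A/B)$ and $i_1,\dots,i_n$ are functorial in $A$; (c) $G'(A/B)$ and $i_1,\dots,i_n$ respect base change, i.e., for all $B$-algebras $C$, there is a functorial choice of isomorphism $G'(A/B)\otimes_B C\xrightarrow{\ \sim\ }G'((A\otimes_B C)/C)$ which commutes with the $i_j$; and (d) if $A/B$ is an $S_n$-extension of fields of degree $n$, then $G'(A/B)$ is isomorphic to the usual Galois closure of $A$ over $B$, and the $i_j$ correspond to the $n$ distinct embeddings of $A$ into this Galois closure.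
   Context: All rings are commutative with unity. A $B$-module $M$ is locally free of rank $n$ if there exist $b_1,\dots,b_m\in B$ with $\sum_i Bb_i=B$ such that $B_{b_i}\otimes_B M$ is free of rank $n$ over the localization $B_{b_i}$ for each $i$; a ring that is locally free of rank $n$ over $B$ means a $B$-algebra that is locally free of rank $n$ as a $B$-module. An $S_n$-extension of fields of degree $n$ is a separable field extension $A/B$ of degree $n$ whose Galois closure has Galois group $S_n$ over $B$. Functoriality in $A$ is with respect to $B$-algebra morphisms $A\to A'$ between $B$-algebras that are locally free of rank $n$, compatibly with the maps $i_1,\dots,i_n$. *)

theory Defs
  imports "HOL-Algebra.Algebra" "HOL-Algebra.Free_Abelian_Groups"
begin

text \<open>
  A (commutative) \<open>B\<close>-algebra is an extended record \<open>A :: ('b, 'a) module\<close> with \<open>algebra B A\<close>, and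
  \<open>G'(A/B)\<close> is written \<open>G B A\<close>.  A ring \<open>C\<close> along which one changes the base is given
  together with its structure map \<open>\<phi> \<in> ring_hom B C\<close>.  All properties of maps are required on the
  carriers only.
\<close>

section \<open>Algebra morphisms\<close>

definition alg_hom ::
    "('b, 'r) ring_scheme \<Rightarrow> ('b, 'a, 's) module_scheme \<Rightarrow> ('b, 'c, 't) module_scheme \<Rightarrow> ('a \<Rightarrow> 'c) set"
  where "alg_hom B A A' = {f \<in> ring_hom A A'.
     \<forall>b\<in>carrier B. \<forall>x\<in>carrier A. f (b \<odot>\<^bsub>A\<^esub> x) = b \<odot>\<^bsub>A'\<^esub> f x}"

definition alg_iso ::
    "('b, 'r) ring_scheme \<Rightarrow> ('b, 'a, 's) module_scheme \<Rightarrow> ('b, 'c, 't) module_scheme \<Rightarrow> ('a \<Rightarrow> 'c) set"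
  where "alg_iso B A A' = {f \<in> alg_hom B A A'. bij_betw f (carrier A) (carrier A')}"

definition base_image :: "('b, 'r) ring_scheme \<Rightarrow> ('b, 'a, 's) module_scheme \<Rightarrow> 'a set"
  where "base_image B A = (\<lambda>b. b \<odot>\<^bsub>A\<^esub> \<one>\<^bsub>A\<^esub>) ` carrier B"

definition generated_subalgebra ::
    "('b, 'r) ring_scheme \<Rightarrow> ('b, 'a, 's) module_scheme \<Rightarrow> 'a set \<Rightarrow> 'a set"
  where "generated_subalgebra B A S = generate_ring A (base_image B A \<union> S)"


section \<open>Tensor products\<close>

text \<open>
  \<open>M \<otimes>\<^sub>B C\<close> is the free abelian group on \<open>M \<times> C\<close> modulo the subgroup generated by the bilinearity
  relations; its elements are cosets.
\<close>

abbreviation tensor_free ::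
    "('b, 'm, 's) module_scheme \<Rightarrow> ('c, 'q) ring_scheme \<Rightarrow> ('m \<times> 'c \<Rightarrow>\<^sub>0 int) monoid"
  where "tensor_free M C \<equiv> free_Abelian_group (carrier M \<times> carrier C)"

definition tensor_relations ::
    "('b, 'r) ring_scheme \<Rightarrow> ('b \<Rightarrow> 'c) \<Rightarrow> ('c, 'q) ring_scheme \<Rightarrow> ('b, 'm, 's) module_scheme
      \<Rightarrow> ('m \<times> 'c \<Rightarrow>\<^sub>0 int) set"
  where "tensor_relations B \<phi> C M =
      {frag_of (x \<oplus>\<^bsub>M\<^esub> y, c) - frag_of (x, c) - frag_of (y, c) | x y c.
         x \<in> carrier M \<and> y \<in> carrier M \<and> c \<in> carrier C}
    \<union> {frag_of (x, c \<oplus>\<^bsub>C\<^esub> d) - frag_of (x, c) - frag_of (x, d) | x c d.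
         x \<in> carrier M \<and> c \<in> carrier C \<and> d \<in> carrier C}
    \<union> {frag_of (b \<odot>\<^bsub>M\<^esub> x, c) - frag_of (x, \<phi> b \<otimes>\<^bsub>C\<^esub> c) | b x c.
         b \<in> carrier B \<and> x \<in> carrier M \<and> c \<in> carrier C}"

definition tensor_kernel ::
    "('b, 'r) ring_scheme \<Rightarrow> ('b \<Rightarrow> 'c) \<Rightarrow> ('c, 'q) ring_scheme \<Rightarrow> ('b, 'm, 's) module_scheme
      \<Rightarrow> ('m \<times> 'c \<Rightarrow>\<^sub>0 int) set"
  where "tensor_kernel B \<phi> C M = generate (tensor_free M C) (tensor_relations B \<phi> C M)"

definition tensor_class ::
    "('b, 'r) ring_scheme \<Rightarrow> ('b \<Rightarrow> 'c) \<Rightarrow> ('c, 'q) ring_scheme \<Rightarrow> ('b, 'm, 's) module_scheme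
      \<Rightarrow> ('m \<times> 'c \<Rightarrow>\<^sub>0 int) \<Rightarrow> ('m \<times> 'c \<Rightarrow>\<^sub>0 int) set"
  where "tensor_class B \<phi> C M z = tensor_kernel B \<phi> C M #>\<^bsub>tensor_free M C\<^esub> z"

text \<open>
  The operations are given on representatives, so that
  \<open>(x \<otimes> c) (y \<otimes> d) = x y \<otimes> c d\<close> and \<open>d (x \<otimes> c) = x \<otimes> d c\<close>.  If \<open>M\<close> is only a module, the
  fields \<open>mult\<close> and \<open>one\<close> carry no meaning, as for any record used with the locale \<open>module\<close>.
\<close>

definition base_change ::
    "('b, 'r) ring_scheme \<Rightarrow> ('b \<Rightarrow> 'c) \<Rightarrow> ('c, 'q) ring_scheme \<Rightarrow> ('b, 'm, 's) module_scheme
      \<Rightarrow> ('c, ('m \<times> 'c \<Rightarrow>\<^sub>0 int) set) module"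
  where "base_change B \<phi> C M =
    (let Q = tensor_free M C Mod tensor_kernel B \<phi> C M in
     \<lparr>carrier = carrier Q,
      monoid.mult = (\<lambda>U V. \<Union>u\<in>U. \<Union>v\<in>V. tensor_class B \<phi> C M
               (frag_extend (\<lambda>(x, c).
                  frag_extend (\<lambda>(y, d). frag_of (x \<otimes>\<^bsub>M\<^esub> y, c \<otimes>\<^bsub>C\<^esub> d)) v) u)),
      one = tensor_class B \<phi> C M (frag_of (\<one>\<^bsub>M\<^esub>, \<one>\<^bsub>C\<^esub>)),
      ring.zero = \<one>\<^bsub>Q\<^esub>,
      add = monoid.mult Q,
      smult = (\<lambda>d U. \<Union>u\<in>U. tensor_class B \<phi> C M
               (frag_extend (\<lambda>(x, c). frag_of (x, d \<otimes>\<^bsub>C\<^esub> c)) u))\<rparr>)"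

text \<open>\<open>f \<otimes> id : M \<otimes>\<^sub>B C \<rightarrow> N \<otimes>\<^sub>B C\<close>, where \<open>N\<close> is the codomain of \<open>f\<close>.\<close>

definition tensor_map ::
    "('b, 'r) ring_scheme \<Rightarrow> ('b \<Rightarrow> 'c) \<Rightarrow> ('c, 'q) ring_scheme \<Rightarrow> ('b, 'n, 's) module_scheme
      \<Rightarrow> ('m \<Rightarrow> 'n) \<Rightarrow> ('m \<times> 'c \<Rightarrow>\<^sub>0 int) set \<Rightarrow> ('n \<times> 'c \<Rightarrow>\<^sub>0 int) set"
  where "tensor_map B \<phi> C N f U =
    (\<Union>u\<in>U. tensor_class B \<phi> C N (frag_extend (\<lambda>(x, c). frag_of (f x, c)) u))"


section \<open>Localization and local freeness\<close>

definition frac :: "('b, 'r) ring_scheme \<Rightarrow> 'b set \<Rightarrow> 'b \<Rightarrow> 'b \<Rightarrow> ('b \<times> 'b) set"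
  where "frac R S a s = {(b, t). b \<in> carrier R \<and> t \<in> S \<and>
     (\<exists>u\<in>S. u \<otimes>\<^bsub>R\<^esub> (t \<otimes>\<^bsub>R\<^esub> a) = u \<otimes>\<^bsub>R\<^esub> (s \<otimes>\<^bsub>R\<^esub> b))}"

definition localization :: "('b, 'r) ring_scheme \<Rightarrow> 'b set \<Rightarrow> ('b \<times> 'b) set ring"
  where "localization R S =
    \<lparr>carrier = {frac R S a s | a s. a \<in> carrier R \<and> s \<in> S},
     monoid.mult = (\<lambda>U V. \<Union>(a, s)\<in>U. \<Union>(b, t)\<in>V. frac R S (a \<otimes>\<^bsub>R\<^esub> b) (s \<otimes>\<^bsub>R\<^esub> t)),
     one = frac R S \<one>\<^bsub>R\<^esub> \<one>\<^bsub>R\<^esub>,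
     ring.zero = frac R S \<zero>\<^bsub>R\<^esub> \<one>\<^bsub>R\<^esub>,
     add = (\<lambda>U V. \<Union>(a, s)\<in>U. \<Union>(b, t)\<in>V.
              frac R S ((t \<otimes>\<^bsub>R\<^esub> a) \<oplus>\<^bsub>R\<^esub> (s \<otimes>\<^bsub>R\<^esub> b)) (s \<otimes>\<^bsub>R\<^esub> t))\<rparr>"

abbreviation powers :: "('b, 'r) ring_scheme \<Rightarrow> 'b \<Rightarrow> 'b set"
  where "powers R b \<equiv> range (\<lambda>k::nat. b [^]\<^bsub>R\<^esub> k)"

definition free_of_rank :: "('b, 'r) ring_scheme \<Rightarrow> ('b, 'm, 's) module_scheme \<Rightarrow> nat \<Rightarrow> bool"
  where "free_of_rank R M n \<longleftrightarrow>
    (\<exists>e \<in> {..<n} \<rightarrow> carrier M.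
       bij_betw (\<lambda>c. \<Oplus>\<^bsub>M\<^esub>i\<in>{..<n}. c i \<odot>\<^bsub>M\<^esub> e i) ({..<n} \<rightarrow>\<^sub>E carrier R) (carrier M))"

definition locally_free :: "('b, 'r) ring_scheme \<Rightarrow> ('b, 'm, 's) module_scheme \<Rightarrow> nat \<Rightarrow> bool"
  where "locally_free B M n \<longleftrightarrow>
    (\<exists>S. finite S \<and> S \<subseteq> carrier B \<and> Idl\<^bsub>B\<^esub> S = carrier B \<and>
      (\<forall>b\<in>S. free_of_rank (localization B (powers B b))
        (base_change B (\<lambda>a. frac B (powers B b) a \<one>\<^bsub>B\<^esub>) (localization B (powers B b)) M) n))"

definition rank_algebra :: "nat \<Rightarrow> ('b, 'r) ring_scheme \<Rightarrow> ('b, 'a, 's) module_scheme \<Rightarrow> bool"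
  where "rank_algebra n B A \<longleftrightarrow> algebra B A \<and> locally_free B A n"


section \<open>Galois closures of fields\<close>

definition field_ext :: "('b, 'r) ring_scheme \<Rightarrow> ('b, 'a, 's) module_scheme \<Rightarrow> bool"
  where "field_ext B A \<longleftrightarrow> field B \<and> field A \<and> algebra B A"

definition algebraic_ext :: "('b, 'r) ring_scheme \<Rightarrow> ('b, 'a, 's) module_scheme \<Rightarrow> bool"
  where "algebraic_ext B A \<longleftrightarrow>
    field_ext B A \<and> (\<forall>x\<in>carrier A. (ring.algebraic A over base_image B A) x)"

text \<open>
  A polynomial is separable if it splits into distinct linear factors over some extension field.
  As splitting fields have finite degree, it is enough to look for the extension field \<open>E\<close> among
  the fields on the same type as soon as this type is infinite.
\<close>

definition separable_poly :: "('a, 's) ring_scheme \<Rightarrow> 'a list \<Rightarrow> bool"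
  where "separable_poly A p \<longleftrightarrow>
    (\<exists>(E :: 'a ring) h. field E \<and> h \<in> ring_hom A E \<and>
       card {x \<in> carrier E. ring.eval E (map h p) x = \<zero>\<^bsub>E\<^esub>} = degree p)"

definition separable_ext :: "('b, 'r) ring_scheme \<Rightarrow> ('b, 'a, 's) module_scheme \<Rightarrow> bool"
  where "separable_ext B A \<longleftrightarrow> algebraic_ext B A \<and>
    (\<forall>x\<in>carrier A. separable_poly A (ring.Irr A (base_image B A) x))"

definition normal_ext :: "('b, 'r) ring_scheme \<Rightarrow> ('b, 'a, 's) module_scheme \<Rightarrow> bool"
  where "normal_ext B A \<longleftrightarrow> algebraic_ext B A \<and>
    (\<forall>x\<in>carrier A. ring.splitted A (ring.Irr A (base_image B A) x))"

definition galois_ext :: "('b, 'r) ring_scheme \<Rightarrow> ('b, 'a, 's) module_scheme \<Rightarrow> bool"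
  where "galois_ext B A \<longleftrightarrow> separable_ext B A \<and> normal_ext B A"

text \<open>\<open>L\<close>, with the embedding \<open>\<iota>\<close> of \<open>A\<close>, is a minimal Galois extension of \<open>B\<close> containing \<open>A\<close>.\<close>

definition galois_closure ::
    "('b, 'r) ring_scheme \<Rightarrow> ('b, 'a, 's) module_scheme \<Rightarrow> ('b, 'l, 't) module_scheme
      \<Rightarrow> ('a \<Rightarrow> 'l) \<Rightarrow> bool"
  where "galois_closure B A L \<iota> \<longleftrightarrow>
    galois_ext B L \<and> \<iota> \<in> alg_hom B A L \<and>
    (\<forall>E. subfield E L \<and> \<iota> ` carrier A \<subseteq> E \<and> galois_ext B (L\<lparr>carrier := E\<rparr>) \<longrightarrow> E = carrier L)"

definition galois_group ::
    "('b, 'r) ring_scheme \<Rightarrow> ('b, 'a, 's) module_scheme \<Rightarrow> ('a \<Rightarrow> 'a) monoid"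
  where "galois_group B L = (BijGroup (carrier L))\<lparr>carrier := Bij (carrier L) \<inter> alg_hom B L L\<rparr>"

text \<open>
  For infinite \<open>'a\<close>, the Galois closure of a finite separable extension \<open>A / B\<close> of fields on \<open>'a\<close>
  exists on \<open>'a\<close>.
\<close>

definition Sn_extension :: "nat \<Rightarrow> ('b, 'r) ring_scheme \<Rightarrow> ('b, 'a, 's) module_scheme \<Rightarrow> bool"
  where "Sn_extension n B A \<longleftrightarrow>
    separable_ext B A \<and> ring.dimension A n (base_image B A) (carrier A) \<and>
    (\<exists>(L :: ('b, 'a) module) \<iota>. galois_closure B A L \<iota> \<and> galois_group B L \<cong> sym_group n)"


section \<open>Galois closures of rings\<close>

text \<open>
  \<open>i B A j\<close>, for \<open>1 \<le> j \<le> n\<close>, is the map \<open>i\<^sub>j : A \<rightarrow> G'(A/B)\<close>, and \<open>F B A A' f\<close> is the map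
  \<open>G'(A/B) \<rightarrow> G'(A'/B)\<close> induced by \<open>f : A \<rightarrow> A'\<close>.
\<close>

type_synonym ('u, 'g) closure_obj = "'u ring \<Rightarrow> ('u, 'u) module \<Rightarrow> ('u, 'g) module"
type_synonym ('u, 'g) closure_emb = "'u ring \<Rightarrow> ('u, 'u) module \<Rightarrow> nat \<Rightarrow> 'u \<Rightarrow> 'g"
type_synonym ('u, 'g) closure_mor =
  "'u ring \<Rightarrow> ('u, 'u) module \<Rightarrow> ('u, 'u) module \<Rightarrow> ('u \<Rightarrow> 'u) \<Rightarrow> 'g \<Rightarrow> 'g"

definition closure_assignment ::
    "nat \<Rightarrow> ('u, 'g) closure_obj \<Rightarrow> ('u, 'g) closure_emb \<Rightarrow> bool"
  where "closure_assignment n G i \<longleftrightarrow>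
    (\<forall>B A. rank_algebra n B A \<longrightarrow>
       rank_algebra (fact n) B (G B A) \<and> (\<forall>j\<in>{1..n}. i B A j \<in> alg_hom B A (G B A)))"

definition generated_by_images ::
    "nat \<Rightarrow> ('u, 'g) closure_obj \<Rightarrow> ('u, 'g) closure_emb \<Rightarrow> bool"
  where "generated_by_images n G i \<longleftrightarrow>
    (\<forall>B A. rank_algebra n B A \<longrightarrow>
       generated_subalgebra B (G B A) (\<Union>j\<in>{1..n}. i B A j ` carrier A) = carrier (G B A))"

definition functorial ::
    "nat \<Rightarrow> ('u, 'g) closure_obj \<Rightarrow> ('u, 'g) closure_emb \<Rightarrow> ('u, 'g) closure_mor \<Rightarrow> bool"
  where "functorial n G i F \<longleftrightarrow>
    (\<forall>B A A' f. rank_algebra n B A \<and> rank_algebra n B A' \<and> f \<in> alg_hom B A A' \<longrightarrow>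
       F B A A' f \<in> alg_hom B (G B A) (G B A') \<and>
       (\<forall>j\<in>{1..n}. \<forall>x\<in>carrier A. F B A A' f (i B A j x) = i B A' j (f x))) \<and>
    (\<forall>B A. rank_algebra n B A \<longrightarrow> (\<forall>z\<in>carrier (G B A). F B A A (\<lambda>x. x) z = z)) \<and>
    (\<forall>B A A' A'' f g. rank_algebra n B A \<and> rank_algebra n B A' \<and> rank_algebra n B A'' \<and>
       f \<in> alg_hom B A A' \<and> g \<in> alg_hom B A' A'' \<longrightarrow>
       (\<forall>z\<in>carrier (G B A). F B A A'' (g \<circ> f) z = F B A' A'' g (F B A A' f z)))"

text \<open>
  The tensor product \<open>A \<otimes>\<^sub>B C\<close> lives on another type than \<open>A\<close>; it is therefore replaced by an
  arbitrary isomorphic copy \<open>e : A \<otimes>\<^sub>B C \<cong> D\<close> on the type of \<open>A\<close>, where \<open>G C D\<close> makes sense.  The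
  chosen isomorphisms \<open>\<theta> A D e : G'(A/B) \<otimes>\<^sub>B C \<rightarrow> G'(D/C)\<close> commute with the \<open>i\<^sub>j\<close> and are natural in
  \<open>A\<close>; in the naturality clause \<open>f'\<close> is the copy of \<open>f \<otimes> id\<close>.
\<close>

definition respects_base_change ::
    "nat \<Rightarrow> ('u, 'g) closure_obj \<Rightarrow> ('u, 'g) closure_emb \<Rightarrow> ('u, 'g) closure_mor \<Rightarrow> bool"
  where "respects_base_change n G i F \<longleftrightarrow>
    (\<forall>B C \<phi>. cring B \<and> cring C \<and> \<phi> \<in> ring_hom B C \<longrightarrow>
      (\<exists>\<theta>.
        (\<forall>A D e. rank_algebra n B A \<and> rank_algebra n C D \<and> e \<in> alg_iso C (base_change B \<phi> C A) D \<longrightarrow>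
           \<theta> A D e \<in> alg_iso C (base_change B \<phi> C (G B A)) (G C D) \<and>
           (\<forall>j\<in>{1..n}. \<forall>z\<in>carrier (base_change B \<phi> C A).
              \<theta> A D e (tensor_map B \<phi> C (G B A) (i B A j) z) = i C D j (e z))) \<and>
        (\<forall>A D e A' D' e' f f'.
           rank_algebra n B A \<and> rank_algebra n C D \<and> e \<in> alg_iso C (base_change B \<phi> C A) D \<and>
           rank_algebra n B A' \<and> rank_algebra n C D' \<and> e' \<in> alg_iso C (base_change B \<phi> C A') D' \<and>
           f \<in> alg_hom B A A' \<and> f' \<in> alg_hom C D D' \<and>
           (\<forall>z\<in>carrier (base_change B \<phi> C A). f' (e z) = e' (tensor_map B \<phi> C A' f z)) \<longrightarrow>
           (\<forall>w\<in>carrier (base_change B \<phi> C (G B A)).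
              \<theta> A' D' e' (tensor_map B \<phi> C (G B A') (F B A A' f) w) = F C D D' f' (\<theta> A D e w)))))"

definition extends_galois_closure ::
    "nat \<Rightarrow> ('u, 'g) closure_obj \<Rightarrow> ('u, 'g) closure_emb \<Rightarrow> bool"
  where "extends_galois_closure n G i \<longleftrightarrow>
    (\<forall>B A (L :: ('u, 'u) module) \<iota>. Sn_extension n B A \<and> galois_closure B A L \<iota> \<longrightarrow>
       (\<exists>\<theta> \<in> alg_iso B (G B A) L.
          bij_betw (\<lambda>j. restrict (\<theta> \<circ> i B A j) (carrier A)) {1..n}
            (alg_hom B A L \<inter> extensional (carrier A))))"

end

theory Submission
  imports
    Defs
    "HOL-Computational_Algebra.Polynomial"
    "HOL-Computational_Algebra.Fraction_Field"
    "HOL-Combinatorics.Permutations"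
    "HOL-Library.Poly_Mapping"
    "HOL-Library.Countable_Set"
begin

text \<open>
  The idea is to let an \<open>S\<^sub>n\<close>-extension degenerate to an algebra with so many endomorphisms that
  functoriality kills products which generically are not zero.

  Let \<open>L = \<rat>(x\<^sub>0, x\<^sub>1, \<dots>)\<close>, let \<open>S\<^sub>n\<close> permute \<open>x\<^sub>1, \<dots>, x\<^sub>n\<close>, let \<open>K\<close> be the fixed field, and
  put \<open>x = x\<^sub>1\<close> and \<open>t = x\<^sub>0\<close>, which is invariant.  Over the ring \<open>B\<close> of invariant
  integral polynomials consider the order \<open>A = B + t B[x]\<close>, which is free with basis \<open>1, t x, \<dots>, t x\<^bsup>n-1\<^esup>\<close>.  Generically it is the field
  \<open>K(x)\<close>, an \<open>S\<^sub>n\<close>-extension of \<open>K\<close> with Galois closure \<open>L\<close>.  Modulo \<open>t\<close>, the products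
  \<open>(t x\<^sup>a) (t x\<^sup>b)\<close> vanish, so that \<open>A\<^sub>0 = A / t A\<close> is \<open>k \<oplus> V\<close> with \<open>V\<^sup>2 = 0\<close>, where \<open>k = B / t B\<close>; every
  linear endomorphism of \<open>V\<close> extends to an algebra endomorphism of \<open>A\<^sub>0\<close>.

  Suppose that there is a closure, and let \<open>M = G'(A/B)\<close>.  Being locally free over a domain, \<open>M\<close> embeds
  in \<open>M \<otimes>\<^sub>B K = G'(K(x)/K) = L\<close> (\<open>locally_free_embeds\<close>, \<open>generic_fibre\<close>); here \<open>i\<^sub>j\<close> becomes
  \<open>x \<mapsto> x\<^bsub>\<pi> j\<^esub>\<close> for some permutation \<open>\<pi>\<close>.  On the other side \<open>M / t M = G'(A\<^sub>0/k)\<close> (\<open>special_fibre\<close>).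

  Two distinct roots \<open>u\<close>, \<open>v\<close> of the minimal polynomial \<open>f = \<Sum> f\<^sub>a X\<^sup>a\<close> of \<open>x\<close> satisfy
  \<open>(f(u) - f(v)) / (u - v) = \<Sum> f\<^bsub>a+b+1\<^esub> u\<^sup>a v\<^sup>b = 0\<close>.  Multiplied by \<open>t\<^sup>2\<close>, this says that
  \<open>\<Sum>\<^bsub>a,b\<ge>1\<^esub> f\<^bsub>a+b+1\<^esub> i\<^sub>1(t x\<^sup>a) i\<^sub>2(t x\<^sup>b)\<close> equals \<open>t\<close> times a linear expression in \<open>M\<close>, because the remaining
  terms involve only one of the two roots (\<open>quadratic_relation\<close>).  So in \<open>G'(A\<^sub>0/k)\<close> the quadratic
  expression vanishes.  Applying the endomorphism of \<open>A\<^sub>0\<close> that fixes the basis vector \<open>x\<close>, sends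
  \<open>x\<^bsup>n-2\<^esup>\<close> to \<open>\<beta> x\<close> and kills the other \<open>x\<^sup>a\<close> leaves \<open>(f\<^sub>3 + 2 \<beta>) i\<^sub>1(x) i\<^sub>2(x) = 0\<close>
  (\<open>endo_hom\<close>, \<open>quadratic_form_value\<close>).  This is where \<open>n \<ge> 4\<close> enters, as \<open>1\<close> and \<open>n - 2\<close> have to be
  different.  With \<open>\<beta> = 0\<close> and \<open>\<beta> = 1\<close> this gives \<open>2 i\<^sub>1(x) i\<^sub>2(x) = 0\<close> in \<open>G'(A\<^sub>0/k)\<close>.

  Hence \<open>2 i\<^sub>1(t x) i\<^sub>2(t x) = t r\<close> for some \<open>r\<close> in \<open>M\<close>, and \<open>r\<close> takes the value \<open>2 t x\<^sub>\<alpha> x\<^sub>\<beta>\<close> in \<open>L\<close>,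
  with \<open>\<alpha> = \<pi> 1\<close> and \<open>\<beta> = \<pi> 2\<close>.  But \<open>M\<close> is generated by the images of the \<open>i\<^sub>j\<close>, so that all values
  have the form \<open>b + t y + t\<^sup>2 z\<close>, where \<open>b\<close> is in \<open>B\<close> and \<open>y\<close> is a sum of functions of a single root
  with coefficients in \<open>B\<close>.  The operator \<open>(1 - (\<alpha> \<gamma>)) (1 - (\<beta> \<delta>))\<close>, for four different indices, kills \<open>b\<close> and
  \<open>y\<close> but not \<open>2 x\<^sub>\<alpha> x\<^sub>\<beta>\<close> modulo \<open>t\<close> (\<open>first_order_ring_obstruction\<close>), which is a contradiction.

  The closure is only given for rings whose elements have a prescribed infinite type.  As \<open>L\<close> is
  countable, everything is carried out in \<open>L\<close> and transported to that type along an injection \<open>\<iota>\<close>.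
\<close>

section \<open>Tensor products\<close>

lemma keys_diffI: "Poly_Mapping.keys (a::'x \<Rightarrow>\<^sub>0 int) \<subseteq> S \<Longrightarrow> Poly_Mapping.keys b \<subseteq> S \<Longrightarrow> Poly_Mapping.keys (a - b) \<subseteq> S"
  using keys_diff[of a b] by blast

lemma keys_addI: "Poly_Mapping.keys (a::'x \<Rightarrow>\<^sub>0 int) \<subseteq> S \<Longrightarrow> Poly_Mapping.keys b \<subseteq> S \<Longrightarrow> Poly_Mapping.keys (a + b) \<subseteq> S"
  using keys_add[of a b] by blast

text \<open>\<open>M\<close> is extended along \<open>\<phi> : B \<rightarrow> C\<close>.  The tensor product \<open>T\<close> is the quotient of the free abelian group on
  the pairs \<open>P\<close> by the subgroup \<open>N\<close>; it turns out to be a \<open>C\<close>-module in \<open>module_T\<close>.\<close>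

locale scalar_extension = C: cring C + M: module B M
  for B :: "('b, 'r) ring_scheme" and \<phi> :: "'b \<Rightarrow> 'c"
    and C :: "('c, 'q) ring_scheme" and M :: "('b, 'm, 's) module_scheme" +
  assumes base_hom: "\<phi> \<in> ring_hom B C"
begin

abbreviation "P \<equiv> carrier M \<times> carrier C"
abbreviation "N \<equiv> tensor_kernel B \<phi> C M"
abbreviation "cls \<equiv> tensor_class B \<phi> C M"
abbreviation "T \<equiv> base_change B \<phi> C M"

definition tens :: "'m \<Rightarrow> 'c \<Rightarrow> ('m \<times> 'c \<Rightarrow>\<^sub>0 int) set"
  where "tens x c = cls (frag_of (x, c))"

lemma base_closed [simp]: "b \<in> carrier B \<Longrightarrow> \<phi> b \<in> carrier C"
  using base_hom by (rule ring_hom_closed)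

lemma relations_carrier: "tensor_relations B \<phi> C M \<subseteq> carrier (free_Abelian_group P)"
proof
  fix r assume "r \<in> tensor_relations B \<phi> C M"
  then have "Poly_Mapping.keys r \<subseteq> P"
    unfolding tensor_relations_def
    by (elim UnE CollectE exE conjE) (simp_all add: keys_diffI)
  then show "r \<in> carrier (free_Abelian_group P)" by simp
qed

sublocale F: comm_group "free_Abelian_group P"
  by (rule abelian_free_Abelian_group)

lemma kernel_subgroup: "subgroup N (free_Abelian_group P)"
  unfolding tensor_kernel_def by (rule F.generate_is_subgroup[OF relations_carrier])

lemma kernel_keys: "z \<in> N \<Longrightarrow> Poly_Mapping.keys z \<subseteq> P"
  using subsetD[OF subgroup.subset[OF kernel_subgroup], of z] by simp

lemma kernel_zero [simp]: "0 \<in> N"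
  using subgroup.one_closed[OF kernel_subgroup] by simp

lemma kernel_add: "y \<in> N \<Longrightarrow> z \<in> N \<Longrightarrow> y + z \<in> N"
  using subgroup.m_closed[OF kernel_subgroup, of y z] by simp

lemma kernel_uminus: "z \<in> N \<Longrightarrow> - z \<in> N"
  using subgroup.m_inv_closed[OF kernel_subgroup, of z] kernel_keys[of z] by simp

lemma kernel_diff: "y \<in> N \<Longrightarrow> z \<in> N \<Longrightarrow> y - z \<in> N"
  using kernel_add[OF _ kernel_uminus, of y z] by simp

lemma relation_in_kernel: "z \<in> tensor_relations B \<phi> C M \<Longrightarrow> z \<in> N"
  unfolding tensor_kernel_def by (rule generate.incl)

text \<open>Subtraction alone generates a subgroup from its generators, so that one closure condition is enough.\<close>

lemma kernel_induct [consumes 1, case_names rel zero diff]: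
  assumes "z \<in> N" and rel: "\<And>r. r \<in> tensor_relations B \<phi> C M \<Longrightarrow> Q r"
    and zero: "Q 0" and diff: "\<And>y z. y \<in> N \<Longrightarrow> z \<in> N \<Longrightarrow> Q y \<Longrightarrow> Q z \<Longrightarrow> Q (y - z)"
  shows "Q z"
proof -
  have "z \<in> N \<and> Q z"
    using assms(1) unfolding tensor_kernel_def
  proof (induction rule: generate.induct)
    case (inv h)
    have "inv\<^bsub>free_Abelian_group P\<^esub> h = 0 - h"
      using subsetD[OF relations_carrier inv] by (subst inv_free_Abelian_group) simp_all
    moreover have "h \<in> N" using inv by (rule relation_in_kernel)
    ultimately show ?case
      using diff[OF kernel_zero _ zero rel[OF inv], of ] kernel_diff[OF kernel_zero, of h]
      unfolding tensor_kernel_def by auto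
  next
    case (eng h1 h2)
    have h: "h1 \<in> N" "h2 \<in> N" using eng by (auto simp: tensor_kernel_def)
    have "Q (0 - h2)" using diff[OF kernel_zero h(2) zero] eng by blast
    then have "Q (h1 - (0 - h2))" using diff[OF h(1) kernel_diff[OF kernel_zero h(2)]] eng by blast
    with kernel_add[OF h] show ?case by (simp add: tensor_kernel_def)
  qed (auto simp: zero rel relation_in_kernel kernel_zero[unfolded tensor_kernel_def] intro: generate.incl)
  then show ?thesis ..
qed

lemma cls_eq:
  assumes "Poly_Mapping.keys y \<subseteq> P" "Poly_Mapping.keys z \<subseteq> P"
  shows "cls y = cls z \<longleftrightarrow> y - z \<in> N"
proof -
  have mem: "w \<in> cls z' \<longleftrightarrow> w - z' \<in> N" for w z'
    unfolding tensor_class_def r_coset_def by (auto intro!: bexI[of _ "w - z'"])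
  show ?thesis
  proof
    assume "cls y = cls z"
    then show "y - z \<in> N" using mem[of y z] mem[of y y] by simp
  next
    assume a: "y - z \<in> N"
    show "cls y = cls z"
    proof (rule Set.set_eqI)
      fix w
      have "w - z = (w - y) + (y - z)" "w - y = (w - z) - (y - z)" by simp_all
      then show "w \<in> cls y \<longleftrightarrow> w \<in> cls z"
        unfolding mem by (metis a kernel_add kernel_diff)
    qed
  qed
qed

lemma cls_mem: "y \<in> cls z \<longleftrightarrow> y - z \<in> N"
  unfolding tensor_class_def r_coset_def by (auto intro!: bexI[of _ "y - z"])

lemma cls_self: "z \<in> cls z" by (simp add: cls_mem)

lemma cls_keys: "Poly_Mapping.keys z \<subseteq> P \<Longrightarrow> y \<in> cls z \<Longrightarrow> Poly_Mapping.keys y \<subseteq> P"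
  using keys_addI[of "y - z" P z] kernel_keys[of "y - z"] by (simp add: cls_mem)

lemma carrier_T: "carrier T = cls ` {z. Poly_Mapping.keys z \<subseteq> P}"
  by (simp add: base_change_def Let_def carrier_FactGroup tensor_class_def[abs_def] free_Abelian_group_def)

lemma zero_T: "\<zero>\<^bsub>T\<^esub> = cls 0"
  by (simp add: base_change_def Let_def tensor_class_def F.coset_mult_one[simplified] subgroup.subset[OF kernel_subgroup, simplified])

lemma one_T: "\<one>\<^bsub>T\<^esub> = tens \<one>\<^bsub>M\<^esub> \<one>\<^bsub>C\<^esub>"
  by (simp add: base_change_def Let_def tens_def)

lemma add_T:
  assumes "Poly_Mapping.keys y \<subseteq> P" "Poly_Mapping.keys z \<subseteq> P"
  shows "cls y \<oplus>\<^bsub>T\<^esub> cls z = cls (y + z)"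
proof -
  have "N \<lhd> free_Abelian_group P"
    by (rule F.subgroup_imp_normal[OF kernel_subgroup])
  from normal.rcos_sum[OF this, of y z] assms show ?thesis
    by (simp add: base_change_def Let_def tensor_class_def)
qed

lemma abelian_T: "abelian_group T"
proof -
  interpret Q: comm_group "free_Abelian_group P Mod N"
    by (rule F.abelian_FactGroup[OF kernel_subgroup])
  have Q: "carrier T = carrier (free_Abelian_group P Mod N)"
    "x \<oplus>\<^bsub>T\<^esub> y = x \<otimes>\<^bsub>free_Abelian_group P Mod N\<^esub> y" "\<zero>\<^bsub>T\<^esub> = \<one>\<^bsub>free_Abelian_group P Mod N\<^esub>" for x y
    by (simp_all add: base_change_def Let_def)
  show ?thesis
  proof (rule abelian_groupI, unfold Q)
    show "\<exists>y\<in>carrier (free_Abelian_group P Mod N). y \<otimes>\<^bsub>free_Abelian_group P Mod N\<^esub> x = \<one>\<^bsub>free_Abelian_group P Mod N\<^esub>"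
      if "x \<in> carrier (free_Abelian_group P Mod N)" for x
      using Q.l_inv[OF that] Q.inv_closed[OF that] by blast
  qed (fact Q.m_closed Q.one_closed Q.m_assoc Q.m_comm Q.l_one)+
qed

sublocale T: abelian_group T by (rule abelian_T)

lemma cls_closed [intro]: "Poly_Mapping.keys z \<subseteq> P \<Longrightarrow> cls z \<in> carrier T"
  by (auto simp: carrier_T)

lemma tens_closed [simp]: "x \<in> carrier M \<Longrightarrow> c \<in> carrier C \<Longrightarrow> tens x c \<in> carrier T"
  unfolding tens_def by (rule cls_closed) simp

lemma diff_T:
  assumes "Poly_Mapping.keys y \<subseteq> P" "Poly_Mapping.keys z \<subseteq> P"
  shows "cls (y - z) = cls y \<ominus>\<^bsub>T\<^esub> cls z"
proof -
  have "cls (y - z) \<oplus>\<^bsub>T\<^esub> cls z = cls y"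
    using add_T[OF keys_diffI[OF assms] assms(2)] by simp
  then show ?thesis
    using T.minus_equality assms cls_closed keys_diffI[OF assms]
    by (metis a_minus_def T.add.inv_solve_right)
qed

lemma T_induct [consumes 1, case_names zero tens diff]:
  assumes "U \<in> carrier T" and "Q \<zero>\<^bsub>T\<^esub>"
    and "\<And>x c. x \<in> carrier M \<Longrightarrow> c \<in> carrier C \<Longrightarrow> Q (tens x c)"
    and diff: "\<And>U V. U \<in> carrier T \<Longrightarrow> V \<in> carrier T \<Longrightarrow> Q U \<Longrightarrow> Q V \<Longrightarrow> Q (U \<ominus>\<^bsub>T\<^esub> V)"
  shows "Q U"
proof -
  obtain z where z: "Poly_Mapping.keys z \<subseteq> P" "U = cls z" using assms(1) by (auto simp: carrier_T)
  have "Q (cls z)" using z(1)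
  proof (rule free_Abelian_group_induct)
    show "Q (cls 0)" using assms(2) by (simp add: zero_T)
    show "Q (cls (x - y))" if "Poly_Mapping.keys x \<subseteq> P" "Poly_Mapping.keys y \<subseteq> P" "Q (cls x)" "Q (cls y)" for x y
      using diff[OF cls_closed cls_closed, of x y] that by (simp add: diff_T)
    show "Q (cls (frag_of a))" if "a \<in> P" for a
      using assms(3)[of "fst a" "snd a"] that by (auto simp: tens_def)
  qed
  with z(2) show ?thesis by simp
qed

lemma kernel_rels:
  shows "x \<in> carrier M \<Longrightarrow> y \<in> carrier M \<Longrightarrow> c \<in> carrier C \<Longrightarrow>
       frag_of (x \<oplus>\<^bsub>M\<^esub> y, c) - frag_of (x, c) - frag_of (y, c) \<in> N"
    and "x \<in> carrier M \<Longrightarrow> c \<in> carrier C \<Longrightarrow> d \<in> carrier C \<Longrightarrow>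
       frag_of (x, c \<oplus>\<^bsub>C\<^esub> d) - frag_of (x, c) - frag_of (x, d) \<in> N"
    and "b \<in> carrier B \<Longrightarrow> x \<in> carrier M \<Longrightarrow> c \<in> carrier C \<Longrightarrow>
       frag_of (b \<odot>\<^bsub>M\<^esub> x, c) - frag_of (x, \<phi> b \<otimes>\<^bsub>C\<^esub> c) \<in> N"
  by (rule relation_in_kernel, unfold tensor_relations_def, blast)+

lemma tens_add_left:
  assumes "x \<in> carrier M" "y \<in> carrier M" "c \<in> carrier C"
  shows "tens (x \<oplus>\<^bsub>M\<^esub> y) c = tens x c \<oplus>\<^bsub>T\<^esub> tens y c"
  using assms kernel_rels(1)[OF assms]
  by (simp add: tens_def add_T cls_eq keys_addI algebra_simps)

lemma tens_add_right:
  assumes "x \<in> carrier M" "c \<in> carrier C" "d \<in> carrier C"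
  shows "tens x (c \<oplus>\<^bsub>C\<^esub> d) = tens x c \<oplus>\<^bsub>T\<^esub> tens x d"
  using assms kernel_rels(2)[OF assms]
  by (simp add: tens_def add_T cls_eq keys_addI algebra_simps)

lemma tens_smult:
  assumes "b \<in> carrier B" "x \<in> carrier M" "c \<in> carrier C"
  shows "tens (b \<odot>\<^bsub>M\<^esub> x) c = tens x (\<phi> b \<otimes>\<^bsub>C\<^esub> c)"
  using assms kernel_rels(3)[OF assms]
  by (simp add: tens_def cls_eq)

text \<open>This gives the well-definedness of maps that are prescribed on representatives: a map on pairs
  descends to the tensor product as soon as it respects the defining relations modulo \<open>J\<close>.\<close>

lemma frag_extend_kernel:
  fixes g :: "'m \<times> 'c \<Rightarrow> 'y \<Rightarrow>\<^sub>0 int"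
  assumes "z \<in> N" and "0 \<in> J" and "\<And>y z. y \<in> J \<Longrightarrow> z \<in> J \<Longrightarrow> y - z \<in> J"
    and "\<And>x y c. x \<in> carrier M \<Longrightarrow> y \<in> carrier M \<Longrightarrow> c \<in> carrier C \<Longrightarrow>
       g (x \<oplus>\<^bsub>M\<^esub> y, c) - g (x, c) - g (y, c) \<in> J"
    and "\<And>x c d. x \<in> carrier M \<Longrightarrow> c \<in> carrier C \<Longrightarrow> d \<in> carrier C \<Longrightarrow>
       g (x, c \<oplus>\<^bsub>C\<^esub> d) - g (x, c) - g (x, d) \<in> J"
    and "\<And>b x c. b \<in> carrier B \<Longrightarrow> x \<in> carrier M \<Longrightarrow> c \<in> carrier C \<Longrightarrow>
       g (b \<odot>\<^bsub>M\<^esub> x, c) - g (x, \<phi> b \<otimes>\<^bsub>C\<^esub> c) \<in> J"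
  shows "frag_extend g z \<in> J"
  using assms(1)
proof (induction rule: kernel_induct)
  case (rel r)
  then show ?case
    unfolding tensor_relations_def using assms(4-6) by (auto simp: frag_extend_diff)
qed (auto simp: frag_extend_diff assms)

lemma smult_T:
  assumes "d \<in> carrier C" "Poly_Mapping.keys z \<subseteq> P"
  shows "d \<odot>\<^bsub>T\<^esub> cls z = cls (frag_extend (\<lambda>(x, c). frag_of (x, d \<otimes>\<^bsub>C\<^esub> c)) z)"
proof -
  let ?g = "\<lambda>(x, c). frag_of (x, d \<otimes>\<^bsub>C\<^esub> c)"
  have keys: "Poly_Mapping.keys (frag_extend ?g y) \<subseteq> P" if "Poly_Mapping.keys y \<subseteq> P" for y
    using keys_frag_extend[of ?g y] that assms(1) by fastforce
  have ker: "frag_extend ?g y \<in> N" if "y \<in> N" for y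
  proof (rule frag_extend_kernel[OF that])
    fix b x c assume b: "b \<in> carrier B" "x \<in> carrier M" "c \<in> carrier C"
    have "d \<otimes>\<^bsub>C\<^esub> (\<phi> b \<otimes>\<^bsub>C\<^esub> c) = \<phi> b \<otimes>\<^bsub>C\<^esub> (d \<otimes>\<^bsub>C\<^esub> c)"
      using b assms(1) by (intro C.m_lcomm) simp_all
    then show "?g (b \<odot>\<^bsub>M\<^esub> x, c) - ?g (x, \<phi> b \<otimes>\<^bsub>C\<^esub> c) \<in> N"
      using b assms(1) by (simp add: kernel_rels)
  qed (use assms(1) in \<open>simp_all add: kernel_diff kernel_rels C.r_distr\<close>)
  have "cls (frag_extend ?g y) = cls (frag_extend ?g z)" if "y \<in> cls z" for y
    using that keys cls_keys[OF assms(2)] assms(2) ker[of "y - z"]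
    by (simp add: cls_eq cls_mem frag_extend_diff)
  then have "(\<Union>y\<in>cls z. cls (frag_extend ?g y)) = cls (frag_extend ?g z)"
    using cls_self[of z] by blast
  then show ?thesis by (simp add: base_change_def Let_def)
qed

lemma smult_tens:
  assumes "d \<in> carrier C" "x \<in> carrier M" "c \<in> carrier C"
  shows "d \<odot>\<^bsub>T\<^esub> tens x c = tens x (d \<otimes>\<^bsub>C\<^esub> c)"
  using smult_T[OF assms(1), of "frag_of (x, c)"] assms by (simp add: tens_def)

lemma smult_keys:
  assumes "d \<in> carrier C" "Poly_Mapping.keys z \<subseteq> P"
  shows "Poly_Mapping.keys (frag_extend (\<lambda>(x, c). frag_of (x, d \<otimes>\<^bsub>C\<^esub> c)) z) \<subseteq> P"
  using keys_frag_extend[of "\<lambda>(x, c). frag_of (x, d \<otimes>\<^bsub>C\<^esub> c)" z] assms by fastforce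

lemma smult_T_closed: "d \<in> carrier C \<Longrightarrow> U \<in> carrier T \<Longrightarrow> d \<odot>\<^bsub>T\<^esub> U \<in> carrier T"
  by (auto simp: carrier_T smult_T smult_keys)

lemma smult_T_add:
  assumes "d \<in> carrier C" "U \<in> carrier T" "V \<in> carrier T"
  shows "d \<odot>\<^bsub>T\<^esub> (U \<oplus>\<^bsub>T\<^esub> V) = d \<odot>\<^bsub>T\<^esub> U \<oplus>\<^bsub>T\<^esub> d \<odot>\<^bsub>T\<^esub> V"
  using assms by (auto simp: carrier_T add_T smult_T smult_keys keys_addI frag_extend_add)

lemma smult_T_zero: "d \<in> carrier C \<Longrightarrow> d \<odot>\<^bsub>T\<^esub> \<zero>\<^bsub>T\<^esub> = \<zero>\<^bsub>T\<^esub>"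
  by (simp add: zero_T smult_T)

lemma smult_T_diff:
  assumes "d \<in> carrier C" "U \<in> carrier T" "V \<in> carrier T"
  shows "d \<odot>\<^bsub>T\<^esub> (U \<ominus>\<^bsub>T\<^esub> V) = d \<odot>\<^bsub>T\<^esub> U \<ominus>\<^bsub>T\<^esub> d \<odot>\<^bsub>T\<^esub> V"
proof -
  have "d \<odot>\<^bsub>T\<^esub> (U \<ominus>\<^bsub>T\<^esub> V) \<oplus>\<^bsub>T\<^esub> d \<odot>\<^bsub>T\<^esub> V = d \<odot>\<^bsub>T\<^esub> U"
    using smult_T_add[OF assms(1), of "U \<ominus>\<^bsub>T\<^esub> V" V] assms
    by (simp add: a_minus_def T.a_assoc T.l_neg)
  then show ?thesis using assms
    by (metis a_minus_def T.add.inv_solve_right T.minus_closed smult_T_closed)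
qed

lemma module_T: "module C T"
proof (rule moduleI)
  fix a b U assume a: "a \<in> carrier C" and b: "b \<in> carrier C" and U: "U \<in> carrier T"
  note ab = a b
  show "(a \<oplus>\<^bsub>C\<^esub> b) \<odot>\<^bsub>T\<^esub> U = a \<odot>\<^bsub>T\<^esub> U \<oplus>\<^bsub>T\<^esub> b \<odot>\<^bsub>T\<^esub> U"
    using U
  proof (induction rule: T_induct)
    case (diff U V)
    let ?s = "\<lambda>d U. d \<odot>\<^bsub>T\<^esub> U"
    have "(?s a U \<oplus>\<^bsub>T\<^esub> ?s b U) \<ominus>\<^bsub>T\<^esub> (?s a V \<oplus>\<^bsub>T\<^esub> ?s b V) = (?s a U \<ominus>\<^bsub>T\<^esub> ?s a V) \<oplus>\<^bsub>T\<^esub> (?s b U \<ominus>\<^bsub>T\<^esub> ?s b V)"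
      using diff ab smult_T_closed by (simp add: a_minus_def T.minus_add T.a_ac)
    then show ?case using diff ab by (simp add: smult_T_diff)
  qed (use ab in \<open>auto simp: smult_tens C.l_distr tens_add_right smult_T_zero\<close>)
  show "(a \<otimes>\<^bsub>C\<^esub> b) \<odot>\<^bsub>T\<^esub> U = a \<odot>\<^bsub>T\<^esub> (b \<odot>\<^bsub>T\<^esub> U)"
    using U
    by (induction rule: T_induct)
       (use ab in \<open>auto simp: smult_tens C.m_assoc smult_T_zero smult_T_diff smult_T_closed\<close>)
next
  fix U assume U: "U \<in> carrier T"
  show "\<one>\<^bsub>C\<^esub> \<odot>\<^bsub>T\<^esub> U = U"
    using U
    by (induction rule: T_induct)
       (auto simp: smult_tens smult_T_zero smult_T_diff smult_T_closed)
qed (auto simp: C.is_cring abelian_T smult_T_closed smult_T_add)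

text \<open>The universal property is needed with the relations holding only modulo a subgroup \<open>J\<close> of \<open>H\<close>.
  This describes the kernel of \<open>m \<mapsto> m \<otimes> 1\<close> without forming quotients: with \<open>H = M\<close> and \<open>J = t M\<close> one sees
  that \<open>m \<otimes> 1 = 0\<close> modulo \<open>t\<close> only if \<open>m\<close> is in \<open>t M\<close>, and with sequences modulo those that are
  eventually zero one treats localizations.\<close>

lemma kernel_eval:
  assumes H: "comm_group H" and f: "\<And>x c. x \<in> carrier M \<Longrightarrow> c \<in> carrier C \<Longrightarrow> f x c \<in> carrier H"
    and J: "subgroup J H"
    and "\<And>x y c. x \<in> carrier M \<Longrightarrow> y \<in> carrier M \<Longrightarrow> c \<in> carrier C \<Longrightarrow>
       f (x \<oplus>\<^bsub>M\<^esub> y) c \<otimes>\<^bsub>H\<^esub> inv\<^bsub>H\<^esub> (f x c) \<otimes>\<^bsub>H\<^esub> inv\<^bsub>H\<^esub> (f y c) \<in> J"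
    and "\<And>x c d. x \<in> carrier M \<Longrightarrow> c \<in> carrier C \<Longrightarrow> d \<in> carrier C \<Longrightarrow>
       f x (c \<oplus>\<^bsub>C\<^esub> d) \<otimes>\<^bsub>H\<^esub> inv\<^bsub>H\<^esub> (f x c) \<otimes>\<^bsub>H\<^esub> inv\<^bsub>H\<^esub> (f x d) \<in> J"
    and "\<And>b x c. b \<in> carrier B \<Longrightarrow> x \<in> carrier M \<Longrightarrow> c \<in> carrier C \<Longrightarrow>
       f (b \<odot>\<^bsub>M\<^esub> x) c \<otimes>\<^bsub>H\<^esub> inv\<^bsub>H\<^esub> (f x (\<phi> b \<otimes>\<^bsub>C\<^esub> c)) \<in> J"
  obtains \<Phi> where "\<Phi> \<in> hom (free_Abelian_group P) H"
    "\<And>x c. x \<in> carrier M \<Longrightarrow> c \<in> carrier C \<Longrightarrow> \<Phi> (frag_of (x, c)) = f x c"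
    "\<And>z. z \<in> N \<Longrightarrow> \<Phi> z \<in> J"
proof -
  interpret H: comm_group H by fact
  have "(\<lambda>(x, c). f x c) ` P \<subseteq> carrier H" using f by auto
  from H.free_Abelian_group_universal[OF this]
  obtain \<Phi> where \<Phi>: "\<Phi> \<in> hom (free_Abelian_group P) H"
    and \<Phi>_of: "\<And>p. p \<in> P \<Longrightarrow> \<Phi> (frag_of p) = (\<lambda>(x, c). f x c) p" by blast
  interpret \<Phi>: group_hom "free_Abelian_group P" H \<Phi>
    by (simp add: group_hom_def group_hom_axioms_def \<Phi>)
  have \<Phi>_diff: "\<Phi> (y - z) = \<Phi> y \<otimes>\<^bsub>H\<^esub> inv\<^bsub>H\<^esub> \<Phi> z"
    if "Poly_Mapping.keys y \<subseteq> P" "Poly_Mapping.keys z \<subseteq> P" for y z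
    using \<Phi>.hom_mult[of y "- z"] \<Phi>.hom_inv[of z] that by simp
  have "\<Phi> z \<in> J" if "z \<in> N" for z
    using that
  proof (induction rule: kernel_induct)
    case (rel r)
    have k: "Poly_Mapping.keys (frag_of p) \<subseteq> P" if "p \<in> P" for p using that by simp
    from rel show ?case
      unfolding tensor_relations_def
      by (elim UnE CollectE exE conjE) (simp_all add: \<Phi>_diff \<Phi>_of assms keys_diffI)
  next
    case zero
    then show ?case using \<Phi>.hom_one subgroup.one_closed[OF J] by simp
  next
    case (diff y z)
    then show ?case
      using subgroup.m_closed[OF J] subgroup.m_inv_closed[OF J] by (simp add: \<Phi>_diff kernel_keys)
  qed
  then show ?thesis using that[of \<Phi>] \<Phi> \<Phi>_of by auto
qed

lemma lift_exists:
  assumes H: "abelian_group H" and f: "\<And>x c. x \<in> carrier M \<Longrightarrow> c \<in> carrier C \<Longrightarrow> f x c \<in> carrier H"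
    and f1: "\<And>x y c. x \<in> carrier M \<Longrightarrow> y \<in> carrier M \<Longrightarrow> c \<in> carrier C \<Longrightarrow>
       f (x \<oplus>\<^bsub>M\<^esub> y) c = f x c \<oplus>\<^bsub>H\<^esub> f y c"
    and f2: "\<And>x c d. x \<in> carrier M \<Longrightarrow> c \<in> carrier C \<Longrightarrow> d \<in> carrier C \<Longrightarrow>
       f x (c \<oplus>\<^bsub>C\<^esub> d) = f x c \<oplus>\<^bsub>H\<^esub> f x d"
    and f3: "\<And>b x c. b \<in> carrier B \<Longrightarrow> x \<in> carrier M \<Longrightarrow> c \<in> carrier C \<Longrightarrow>
       f (b \<odot>\<^bsub>M\<^esub> x) c = f x (\<phi> b \<otimes>\<^bsub>C\<^esub> c)"
  obtains h where "\<And>U. U \<in> carrier T \<Longrightarrow> h U \<in> carrier H"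
    "\<And>U V. U \<in> carrier T \<Longrightarrow> V \<in> carrier T \<Longrightarrow> h (U \<oplus>\<^bsub>T\<^esub> V) = h U \<oplus>\<^bsub>H\<^esub> h V"
    "\<And>x c. x \<in> carrier M \<Longrightarrow> c \<in> carrier C \<Longrightarrow> h (tens x c) = f x c"
proof -
  interpret H: abelian_group H by fact
  let ?A = "add_monoid H"
  have sub: "subgroup {\<zero>\<^bsub>H\<^esub>} ?A" using H.add.triv_subgroup by simp
  have inv: "inv\<^bsub>?A\<^esub> x = \<ominus>\<^bsub>H\<^esub> x" for x by (simp add: a_inv_def)
  have cancel: "(x \<oplus>\<^bsub>H\<^esub> y) \<oplus>\<^bsub>H\<^esub> \<ominus>\<^bsub>H\<^esub> x \<oplus>\<^bsub>H\<^esub> \<ominus>\<^bsub>H\<^esub> y = \<zero>\<^bsub>H\<^esub>"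
    if "x \<in> carrier H" "y \<in> carrier H" for x y
    using that by (metis H.a_assoc H.a_comm H.a_closed H.a_inv_closed H.r_neg H.minus_add)
  obtain \<Phi> where \<Phi>: "\<Phi> \<in> hom (free_Abelian_group P) ?A"
    and of: "\<And>x c. x \<in> carrier M \<Longrightarrow> c \<in> carrier C \<Longrightarrow> \<Phi> (frag_of (x, c)) = f x c"
    and ker: "\<And>z. z \<in> N \<Longrightarrow> \<Phi> z \<in> {\<zero>\<^bsub>H\<^esub>}"
  proof (rule kernel_eval[OF H.a_comm_group _ sub, of f])
  qed (auto simp: f f1 f2 f3 inv cancel H.r_neg)
  interpret \<Phi>: group_hom "free_Abelian_group P" ?A \<Phi>
    by (simp add: group_hom_def group_hom_axioms_def \<Phi>)
  have add: "\<Phi> (y + z) = \<Phi> y \<oplus>\<^bsub>H\<^esub> \<Phi> z" if "Poly_Mapping.keys y \<subseteq> P" "Poly_Mapping.keys z \<subseteq> P" for y z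
    using \<Phi>.hom_mult[of y z] that by simp
  have cl: "\<Phi> z \<in> carrier H" if "Poly_Mapping.keys z \<subseteq> P" for z
    using \<Phi>.hom_closed[of z] that by simp
  define h where "h U = \<Phi> (SOME z. z \<in> U)" for U
  have h: "h (cls z) = \<Phi> z" if z: "Poly_Mapping.keys z \<subseteq> P" for z
  proof -
    let ?y = "SOME y. y \<in> cls z"
    have y: "?y \<in> cls z" using cls_self by (rule someI)
    have "?y - z \<in> N" using y by (simp add: cls_mem)
    then have "\<Phi> (?y - z) = \<zero>\<^bsub>H\<^esub>" "Poly_Mapping.keys (?y - z) \<subseteq> P" using ker kernel_keys by auto
    then have "\<Phi> ?y = \<Phi> z" using add[of "?y - z" z] z cl[OF z] by simp
    then show ?thesis by (simp add: h_def)
  qed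
  show ?thesis
    by (rule that[of h]) (auto simp: carrier_T h add add_T keys_addI cl tens_def of)
qed

end

section \<open>Bases\<close>

definition is_basis :: "('b, 'r) ring_scheme \<Rightarrow> ('b, 'm, 's) module_scheme \<Rightarrow> nat \<Rightarrow> (nat \<Rightarrow> 'm) \<Rightarrow> bool"
  where "is_basis R M n e \<longleftrightarrow> e \<in> {..<n} \<rightarrow> carrier M \<and>
     bij_betw (\<lambda>c. \<Oplus>\<^bsub>M\<^esub>i\<in>{..<n}. c i \<odot>\<^bsub>M\<^esub> e i) ({..<n} \<rightarrow>\<^sub>E carrier R) (carrier M)"

lemma free_of_rank_iff_basis: "free_of_rank R M n \<longleftrightarrow> (\<exists>e. is_basis R M n e)"
  by (auto simp: free_of_rank_def is_basis_def)

lemma finsum_additive: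
  assumes "abelian_group G" "abelian_group H" "finite I" "f \<in> I \<rightarrow> carrier G"
    and cl: "\<And>x. x \<in> carrier G \<Longrightarrow> h x \<in> carrier H"
    and add: "\<And>x y. x \<in> carrier G \<Longrightarrow> y \<in> carrier G \<Longrightarrow> h (x \<oplus>\<^bsub>G\<^esub> y) = h x \<oplus>\<^bsub>H\<^esub> h y"
  shows "h (\<Oplus>\<^bsub>G\<^esub>i\<in>I. f i) = (\<Oplus>\<^bsub>H\<^esub>i\<in>I. h (f i))"
proof -
  interpret G: abelian_group G by fact
  interpret H: abelian_group H by fact
  have zero: "h \<zero>\<^bsub>G\<^esub> = \<zero>\<^bsub>H\<^esub>"
    using add[of "\<zero>\<^bsub>G\<^esub>" "\<zero>\<^bsub>G\<^esub>"] cl[of "\<zero>\<^bsub>G\<^esub>"] by (simp add: H.add.r_cancel_one')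
  show ?thesis using assms(3,4)
  proof (induction I)
    case empty then show ?case by (simp add: zero)
  next
    case (insert i I)
    have "f \<in> I \<rightarrow> carrier G" "f i \<in> carrier G" using insert by auto
    then show ?case using insert cl add by (subst G.finsum_insert, simp_all, subst H.finsum_insert) auto
  qed
qed

context module begin

definition lincomb :: "nat \<Rightarrow> (nat \<Rightarrow> 'c) \<Rightarrow> (nat \<Rightarrow> 'a) \<Rightarrow> 'c"
  where "lincomb n e c = (\<Oplus>\<^bsub>M\<^esub>i\<in>{..<n}. c i \<odot>\<^bsub>M\<^esub> e i)"

lemma lincomb_closed: "e \<in> {..<n} \<rightarrow> carrier M \<Longrightarrow> c \<in> {..<n} \<rightarrow> carrier R \<Longrightarrow> lincomb n e c \<in> carrier M"
  unfolding lincomb_def by (rule M.finsum_closed) auto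

lemma lincomb_cong:
  assumes "e \<in> {..<n} \<rightarrow> carrier M" "c \<in> {..<n} \<rightarrow> carrier R" "\<And>i. i < n \<Longrightarrow> c i = d i"
  shows "lincomb n e c = lincomb n e d"
  unfolding lincomb_def using assms by (intro M.finsum_cong') (auto simp: Pi_iff)

lemma lincomb_add:
  assumes "e \<in> {..<n} \<rightarrow> carrier M" "c \<in> {..<n} \<rightarrow> carrier R" "d \<in> {..<n} \<rightarrow> carrier R"
  shows "lincomb n e (\<lambda>i. c i \<oplus>\<^bsub>R\<^esub> d i) = lincomb n e c \<oplus>\<^bsub>M\<^esub> lincomb n e d"
proof -
  have "(\<Oplus>\<^bsub>M\<^esub>i\<in>{..<n}. (c i \<oplus>\<^bsub>R\<^esub> d i) \<odot>\<^bsub>M\<^esub> e i) = (\<Oplus>\<^bsub>M\<^esub>i\<in>{..<n}. c i \<odot>\<^bsub>M\<^esub> e i \<oplus>\<^bsub>M\<^esub> d i \<odot>\<^bsub>M\<^esub> e i)"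
    using assms by (intro M.finsum_cong') (auto simp: smult_l_distr Pi_iff)
  also have "\<dots> = (\<Oplus>\<^bsub>M\<^esub>i\<in>{..<n}. c i \<odot>\<^bsub>M\<^esub> e i) \<oplus>\<^bsub>M\<^esub> (\<Oplus>\<^bsub>M\<^esub>i\<in>{..<n}. d i \<odot>\<^bsub>M\<^esub> e i)"
    using assms by (intro M.finsum_addf) (auto simp: Pi_iff)
  finally show ?thesis by (simp add: lincomb_def)
qed

lemma lincomb_smult:
  assumes "e \<in> {..<n} \<rightarrow> carrier M" "c \<in> {..<n} \<rightarrow> carrier R" "a \<in> carrier R"
  shows "lincomb n e (\<lambda>i. a \<otimes>\<^bsub>R\<^esub> c i) = a \<odot>\<^bsub>M\<^esub> lincomb n e c"
proof -
  have "a \<odot>\<^bsub>M\<^esub> lincomb n e c = (\<Oplus>\<^bsub>M\<^esub>i\<in>{..<n}. a \<odot>\<^bsub>M\<^esub> (c i \<odot>\<^bsub>M\<^esub> e i))"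
    unfolding lincomb_def using assms
    by (intro finsum_additive[of M M]) (auto simp: smult_r_distr Pi_iff M.abelian_group_axioms)
  also have "\<dots> = lincomb n e (\<lambda>i. a \<otimes>\<^bsub>R\<^esub> c i)"
    unfolding lincomb_def using assms by (intro M.finsum_cong') (auto simp: smult_assoc1 Pi_iff)
  finally show ?thesis by simp
qed

lemma lincomb_zero: "e \<in> {..<n} \<rightarrow> carrier M \<Longrightarrow> lincomb n e (\<lambda>_. \<zero>\<^bsub>R\<^esub>) = \<zero>\<^bsub>M\<^esub>"
  unfolding lincomb_def by (rule M.add.finprod_one_eqI) (auto simp: Pi_iff)

lemma lincomb_unit:
  assumes "e \<in> {..<n} \<rightarrow> carrier M" "j < n" "a \<in> carrier R"
  shows "lincomb n e (\<lambda>i. if i = j then a else \<zero>\<^bsub>R\<^esub>) = a \<odot>\<^bsub>M\<^esub> e j"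
proof -
  have "lincomb n e (\<lambda>i. if i = j then a else \<zero>\<^bsub>R\<^esub>) = (\<Oplus>\<^bsub>M\<^esub>i\<in>{..<n}. if j = i then a \<odot>\<^bsub>M\<^esub> e i else \<zero>\<^bsub>M\<^esub>)"
    unfolding lincomb_def using assms by (intro M.finsum_cong') (auto simp: Pi_iff)
  also have "\<dots> = a \<odot>\<^bsub>M\<^esub> e j"
    using assms by (intro M.finsum_singleton) (auto simp: Pi_iff)
  finally show ?thesis .
qed

lemma is_basisI:
  assumes e: "e \<in> {..<n} \<rightarrow> carrier M"
    and span: "\<And>x. x \<in> carrier M \<Longrightarrow> \<exists>c \<in> {..<n} \<rightarrow> carrier R. x = lincomb n e c"
    and indep: "\<And>c. c \<in> {..<n} \<rightarrow> carrier R \<Longrightarrow> lincomb n e c = \<zero>\<^bsub>M\<^esub> \<Longrightarrow> \<forall>i<n. c i = \<zero>\<^bsub>R\<^esub>"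
  shows "is_basis R M n e"
  unfolding is_basis_def lincomb_def[symmetric]
proof (intro conjI bij_betw_imageI)
  show "inj_on (lincomb n e) ({..<n} \<rightarrow>\<^sub>E carrier R)"
  proof (rule inj_onI)
    fix c d assume c: "c \<in> {..<n} \<rightarrow>\<^sub>E carrier R" and d: "d \<in> {..<n} \<rightarrow>\<^sub>E carrier R"
      and eq: "lincomb n e c = lincomb n e d"
    have cd: "c \<in> {..<n} \<rightarrow> carrier R" "d \<in> {..<n} \<rightarrow> carrier R" using c d by auto
    let ?d = "\<lambda>i. (\<ominus>\<^bsub>R\<^esub> \<one>\<^bsub>R\<^esub>) \<otimes>\<^bsub>R\<^esub> d i"
    have d': "?d \<in> {..<n} \<rightarrow> carrier R" using cd by auto
    have "(\<ominus>\<^bsub>R\<^esub> \<one>\<^bsub>R\<^esub>) \<odot>\<^bsub>M\<^esub> x \<oplus>\<^bsub>M\<^esub> x = \<zero>\<^bsub>M\<^esub>" if x: "x \<in> carrier M" for x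
      using smult_l_distr[of "\<ominus>\<^bsub>R\<^esub> \<one>\<^bsub>R\<^esub>" "\<one>\<^bsub>R\<^esub>" x] x by (simp add: R.l_neg)
    then have "lincomb n e ?d \<oplus>\<^bsub>M\<^esub> lincomb n e c = \<zero>\<^bsub>M\<^esub>"
      using lincomb_smult[OF e cd(2), of "\<ominus>\<^bsub>R\<^esub> \<one>\<^bsub>R\<^esub>"] lincomb_closed[OF e cd(1)] eq by simp
    then have "lincomb n e (\<lambda>i. ?d i \<oplus>\<^bsub>R\<^esub> c i) = \<zero>\<^bsub>M\<^esub>"
      by (simp add: lincomb_add[OF e d' cd(1)])
    from indep[OF _ this] have z: "\<forall>i<n. ?d i \<oplus>\<^bsub>R\<^esub> c i = \<zero>\<^bsub>R\<^esub>"
      using cd d' by (simp add: Pi_iff)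
    have "\<forall>i<n. c i = d i"
    proof (intro allI impI)
      fix i assume i: "i < n"
      have ci: "c i \<in> carrier R" "d i \<in> carrier R" using cd i by (auto simp: Pi_iff)
      have "\<ominus>\<^bsub>R\<^esub> d i \<oplus>\<^bsub>R\<^esub> c i = \<zero>\<^bsub>R\<^esub>"
        using z[rule_format, OF i] ci by (simp add: R.l_minus)
      then have "\<ominus>\<^bsub>R\<^esub> (\<ominus>\<^bsub>R\<^esub> d i) = c i"
        using ci by (intro R.minus_equality) (simp_all add: R.a_comm)
      then show "c i = d i" using ci by simp
    qed
    then show "c = d" using c d by (intro PiE_ext) auto
  qed
  show "lincomb n e ` ({..<n} \<rightarrow>\<^sub>E carrier R) = carrier M"
  proof
    show "carrier M \<subseteq> lincomb n e ` ({..<n} \<rightarrow>\<^sub>E carrier R)"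
    proof
      fix x assume "x \<in> carrier M"
      then obtain c where c: "c \<in> {..<n} \<rightarrow> carrier R" "x = lincomb n e c" using span by blast
      then have "x = lincomb n e (restrict c {..<n})"
        using lincomb_cong[OF e c(1), of "restrict c {..<n}"] by simp
      then show "x \<in> lincomb n e ` ({..<n} \<rightarrow>\<^sub>E carrier R)" using c by (auto intro!: image_eqI)
    qed
  qed (use lincomb_closed[OF e] in auto)
qed (rule e)

lemma is_basis_cong:
  assumes "is_basis R M n e" and "\<And>i. i < n \<Longrightarrow> e' i = e i"
  shows "is_basis R M n e'"
proof -
  have e: "e \<in> {..<n} \<rightarrow> carrier M" using assms(1) by (simp add: is_basis_def)
  have "(\<Oplus>\<^bsub>M\<^esub>i\<in>{..<n}. c i \<odot>\<^bsub>M\<^esub> e' i) = (\<Oplus>\<^bsub>M\<^esub>i\<in>{..<n}. c i \<odot>\<^bsub>M\<^esub> e i)"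
    if "c \<in> {..<n} \<rightarrow>\<^sub>E carrier R" for c
    using that e assms(2) by (intro M.finsum_cong') (auto simp: Pi_iff)
  then show ?thesis
    using assms(1) assms(2) unfolding is_basis_def by (auto simp: Pi_iff cong: bij_betw_cong)
qed

definition coords :: "nat \<Rightarrow> (nat \<Rightarrow> 'c) \<Rightarrow> (nat \<Rightarrow> 'c \<Rightarrow> 'a) \<Rightarrow> bool"
  where "coords n e co \<longleftrightarrow>
    (\<forall>i<n. \<forall>x\<in>carrier M. co i x \<in> carrier R) \<and>
    (\<forall>x\<in>carrier M. x = lincomb n e (\<lambda>i. co i x)) \<and>
    (\<forall>i<n. \<forall>x\<in>carrier M. \<forall>y\<in>carrier M. co i (x \<oplus>\<^bsub>M\<^esub> y) = co i x \<oplus>\<^bsub>R\<^esub> co i y) \<and>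
    (\<forall>i<n. \<forall>a\<in>carrier R. \<forall>x\<in>carrier M. co i (a \<odot>\<^bsub>M\<^esub> x) = a \<otimes>\<^bsub>R\<^esub> co i x) \<and>
    (\<forall>i<n. \<forall>j<n. co i (e j) = (if j = i then \<one>\<^bsub>R\<^esub> else \<zero>\<^bsub>R\<^esub>))"

lemma coordsD:
  assumes "coords n e co"
  shows "\<And>i x. i < n \<Longrightarrow> x \<in> carrier M \<Longrightarrow> co i x \<in> carrier R"
    "\<And>x. x \<in> carrier M \<Longrightarrow> x = lincomb n e (\<lambda>i. co i x)"
    "\<And>i x y. i < n \<Longrightarrow> x \<in> carrier M \<Longrightarrow> y \<in> carrier M \<Longrightarrow> co i (x \<oplus>\<^bsub>M\<^esub> y) = co i x \<oplus>\<^bsub>R\<^esub> co i y"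
    "\<And>i a x. i < n \<Longrightarrow> a \<in> carrier R \<Longrightarrow> x \<in> carrier M \<Longrightarrow> co i (a \<odot>\<^bsub>M\<^esub> x) = a \<otimes>\<^bsub>R\<^esub> co i x"
    "\<And>i j. i < n \<Longrightarrow> j < n \<Longrightarrow> co i (e j) = (if j = i then \<one>\<^bsub>R\<^esub> else \<zero>\<^bsub>R\<^esub>)"
  using assms unfolding coords_def by blast+

lemma is_basis_coords:
  assumes "is_basis R M n e"
  shows "\<exists>co. coords n e co"
proof -
  have e: "e \<in> {..<n} \<rightarrow> carrier M"
    and bij: "bij_betw (lincomb n e) ({..<n} \<rightarrow>\<^sub>E carrier R) (carrier M)"
    using assms by (auto simp: is_basis_def lincomb_def[abs_def])
  define co where "co i x = inv_into ({..<n} \<rightarrow>\<^sub>E carrier R) (lincomb n e) x i" for i x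
  have ext: "(\<lambda>i. co i x) \<in> {..<n} \<rightarrow>\<^sub>E carrier R" if "x \<in> carrier M" for x
    using bij that unfolding co_def by (metis bij_betw_imp_surj_on inv_into_into eta_contract_eq)
  have cl: "(\<lambda>i. co i x) \<in> {..<n} \<rightarrow> carrier R" if "x \<in> carrier M" for x
    using ext[OF that] by auto
  have ex: "x = lincomb n e (\<lambda>i. co i x)" if "x \<in> carrier M" for x
    using bij that unfolding co_def by (metis bij_betw_inv_into_right eta_contract_eq)
  have uniq: "co i (lincomb n e c) = c i" if c: "c \<in> {..<n} \<rightarrow> carrier R" and i: "i < n" for c i
  proof -
    have "lincomb n e c = lincomb n e (restrict c {..<n})"
      by (rule lincomb_cong[OF e c]) simp
    moreover have "restrict c {..<n} \<in> {..<n} \<rightarrow>\<^sub>E carrier R" using c by auto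
    ultimately have "inv_into ({..<n} \<rightarrow>\<^sub>E carrier R) (lincomb n e) (lincomb n e c) = restrict c {..<n}"
      using bij_betw_inv_into_left[OF bij] by metis
    then show ?thesis using i by (simp only: co_def restrict_apply lessThan_iff if_True)
  qed
  have add: "co i (x \<oplus>\<^bsub>M\<^esub> y) = co i x \<oplus>\<^bsub>R\<^esub> co i y" if "i < n" "x \<in> carrier M" "y \<in> carrier M" for i x y
  proof -
    have "x \<oplus>\<^bsub>M\<^esub> y = lincomb n e (\<lambda>i. co i x \<oplus>\<^bsub>R\<^esub> co i y)"
      using lincomb_add[OF e cl[OF that(2)] cl[OF that(3)]] ex that by simp
    then show ?thesis using uniq[of "\<lambda>i. co i x \<oplus>\<^bsub>R\<^esub> co i y" i] cl that by (auto simp: Pi_iff)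
  qed
  have smult: "co i (a \<odot>\<^bsub>M\<^esub> x) = a \<otimes>\<^bsub>R\<^esub> co i x" if "i < n" "a \<in> carrier R" "x \<in> carrier M" for i a x
  proof -
    have "a \<odot>\<^bsub>M\<^esub> x = lincomb n e (\<lambda>i. a \<otimes>\<^bsub>R\<^esub> co i x)"
      using lincomb_smult[OF e cl[OF that(3)] that(2)] ex that by simp
    then show ?thesis using uniq[of "\<lambda>i. a \<otimes>\<^bsub>R\<^esub> co i x" i] cl that by (auto simp: Pi_iff)
  qed
  have unit: "co i (e j) = (if j = i then \<one>\<^bsub>R\<^esub> else \<zero>\<^bsub>R\<^esub>)" if "i < n" "j < n" for i j
  proof -
    have "lincomb n e (\<lambda>i. if i = j then \<one>\<^bsub>R\<^esub> else \<zero>\<^bsub>R\<^esub>) = e j"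
      using lincomb_unit[OF e that(2), of "\<one>\<^bsub>R\<^esub>"] e that by (auto simp: Pi_iff)
    then show ?thesis using uniq[of "\<lambda>i. if i = j then \<one>\<^bsub>R\<^esub> else \<zero>\<^bsub>R\<^esub>" i] that by auto
  qed
  have "coords n e co"
    unfolding coords_def using cl ex add smult unit by (auto simp: Pi_iff)
  then show ?thesis by blast
qed

end

lemma linear_lincomb:
  fixes n :: nat
  assumes "module R M" "module R M'" and e: "e \<in> {..<n} \<rightarrow> carrier M" and c: "c \<in> {..<n} \<rightarrow> carrier R"
    and cl: "\<And>x. x \<in> carrier M \<Longrightarrow> h x \<in> carrier M'"
    and add: "\<And>x y. x \<in> carrier M \<Longrightarrow> y \<in> carrier M \<Longrightarrow> h (x \<oplus>\<^bsub>M\<^esub> y) = h x \<oplus>\<^bsub>M'\<^esub> h y"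
    and smult: "\<And>a x. a \<in> carrier R \<Longrightarrow> x \<in> carrier M \<Longrightarrow> h (a \<odot>\<^bsub>M\<^esub> x) = a \<odot>\<^bsub>M'\<^esub> h x"
  shows "h (\<Oplus>\<^bsub>M\<^esub>i\<in>{..<n}. c i \<odot>\<^bsub>M\<^esub> e i) = (\<Oplus>\<^bsub>M'\<^esub>i\<in>{..<n}. c i \<odot>\<^bsub>M'\<^esub> h (e i))"
proof -
  interpret M: module R M by fact
  interpret M': module R M' by fact
  have "h (\<Oplus>\<^bsub>M\<^esub>i\<in>{..<n}. c i \<odot>\<^bsub>M\<^esub> e i) = (\<Oplus>\<^bsub>M'\<^esub>i\<in>{..<n}. h (c i \<odot>\<^bsub>M\<^esub> e i))"
    by (rule finsum_additive) (use e c cl add in \<open>auto simp: Pi_iff M.abelian_group_axioms M'.abelian_group_axioms\<close>)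
  also have "\<dots> = (\<Oplus>\<^bsub>M'\<^esub>i\<in>{..<n}. c i \<odot>\<^bsub>M'\<^esub> h (e i))"
    by (rule M'.finsum_cong') (use e c cl smult in \<open>auto simp: Pi_iff\<close>)
  finally show ?thesis .
qed

lemma bij_betw_of_bases:
  assumes "module R M" "module R M'"
    and b: "is_basis R M n e" and b': "is_basis R M' n (\<lambda>i. h (e i))"
    and "\<And>x. x \<in> carrier M \<Longrightarrow> h x \<in> carrier M'"
    and "\<And>x y. x \<in> carrier M \<Longrightarrow> y \<in> carrier M \<Longrightarrow> h (x \<oplus>\<^bsub>M\<^esub> y) = h x \<oplus>\<^bsub>M'\<^esub> h y"
    and "\<And>a x. a \<in> carrier R \<Longrightarrow> x \<in> carrier M \<Longrightarrow> h (a \<odot>\<^bsub>M\<^esub> x) = a \<odot>\<^bsub>M'\<^esub> h x"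
  shows "bij_betw h (carrier M) (carrier M')"
proof -
  let ?f = "\<lambda>c. \<Oplus>\<^bsub>M\<^esub>i\<in>{..<n}. c i \<odot>\<^bsub>M\<^esub> e i"
  have "(h \<circ> ?f) c = (\<Oplus>\<^bsub>M'\<^esub>i\<in>{..<n}. c i \<odot>\<^bsub>M'\<^esub> h (e i))" if "c \<in> {..<n} \<rightarrow>\<^sub>E carrier R" for c
    unfolding comp_def
    by (rule linear_lincomb) (use assms that in \<open>auto simp: is_basis_def\<close>)
  then have "bij_betw (h \<circ> ?f) ({..<n} \<rightarrow>\<^sub>E carrier R) (carrier M')"
    using b' unfolding is_basis_def by (auto cong: bij_betw_cong)
  moreover have "bij_betw ?f ({..<n} \<rightarrow>\<^sub>E carrier R) (carrier M)"
    using b by (simp add: is_basis_def)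
  ultimately show ?thesis using bij_betw_comp_iff by blast
qed

context scalar_extension begin

sublocale TM: module C T by (rule module_T)

text \<open>Each coordinate function \<open>M \<rightarrow> B\<close> induces \<open>T \<rightarrow> C\<close> by the universal property, and these functions
  show that the vectors \<open>e i \<otimes> 1\<close> are independent.\<close>

lemma base_change_basis:
  assumes b: "is_basis B M n e"
  shows "is_basis C T n (\<lambda>i. tens (e i) \<one>\<^bsub>C\<^esub>)"
proof (rule TM.is_basisI)
  have e: "e \<in> {..<n} \<rightarrow> carrier M" using b by (simp add: is_basis_def)
  have e': "e i \<in> carrier M" if "i < n" for i using e that by auto
  let ?e = "\<lambda>i. tens (e i) \<one>\<^bsub>C\<^esub>"
  show e1: "?e \<in> {..<n} \<rightarrow> carrier T" using e' by simp
  obtain co where "M.coords n e co" using M.is_basis_coords[OF b] by blast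
  note co = M.coordsD[OF this]
  show "\<exists>c\<in>{..<n} \<rightarrow> carrier C. U = TM.lincomb n ?e c" if "U \<in> carrier T" for U
    using that
  proof (induction rule: T_induct)
    case zero
    then show ?case using TM.lincomb_zero[OF e1] by (intro bexI[of _ "\<lambda>_. \<zero>\<^bsub>C\<^esub>"]) auto
  next
    case (tens x c)
    let ?c = "\<lambda>i. \<phi> (co i x) \<otimes>\<^bsub>C\<^esub> c"
    have "tens x c = tens (\<Oplus>\<^bsub>M\<^esub>i\<in>{..<n}. co i x \<odot>\<^bsub>M\<^esub> e i) c"
      using co(2)[OF tens(1)] by (simp add: M.lincomb_def)
    also have "\<dots> = (\<Oplus>\<^bsub>T\<^esub>i\<in>{..<n}. tens (co i x \<odot>\<^bsub>M\<^esub> e i) c)"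
      by (rule finsum_additive[of M T _ _ "\<lambda>y. tens y c"])
        (use tens co e' in \<open>auto simp: tens_add_left M.abelian_group_axioms T.abelian_group_axioms\<close>)
    also have "\<dots> = TM.lincomb n ?e ?c"
      unfolding TM.lincomb_def
      by (rule T.finsum_cong') (use tens co e' in \<open>auto simp: tens_smult smult_tens\<close>)
    finally show ?case using tens co by (intro bexI[of _ ?c]) auto
  next
    case (diff U V)
    then obtain c d where cd: "c \<in> {..<n} \<rightarrow> carrier C" "d \<in> {..<n} \<rightarrow> carrier C"
      "U = TM.lincomb n ?e c" "V = TM.lincomb n ?e d" by auto
    have "(\<ominus>\<^bsub>C\<^esub> \<one>\<^bsub>C\<^esub>) \<odot>\<^bsub>T\<^esub> V \<oplus>\<^bsub>T\<^esub> V = \<zero>\<^bsub>T\<^esub>"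
      using TM.smult_l_distr[of "\<ominus>\<^bsub>C\<^esub> \<one>\<^bsub>C\<^esub>" "\<one>\<^bsub>C\<^esub>" V] diff by (simp add: C.l_neg)
    then have "\<ominus>\<^bsub>T\<^esub> V = (\<ominus>\<^bsub>C\<^esub> \<one>\<^bsub>C\<^esub>) \<odot>\<^bsub>T\<^esub> V"
      using diff by (intro T.minus_equality) simp_all
    then have "U \<ominus>\<^bsub>T\<^esub> V = TM.lincomb n ?e (\<lambda>i. c i \<oplus>\<^bsub>C\<^esub> (\<ominus>\<^bsub>C\<^esub> \<one>\<^bsub>C\<^esub>) \<otimes>\<^bsub>C\<^esub> d i)"
      using cd by (subst TM.lincomb_add[OF e1]) (auto simp: TM.lincomb_smult[OF e1] a_minus_def)
    then show ?case using cd by (intro bexI[of _ "\<lambda>i. c i \<oplus>\<^bsub>C\<^esub> (\<ominus>\<^bsub>C\<^esub> \<one>\<^bsub>C\<^esub>) \<otimes>\<^bsub>C\<^esub> d i"]) (auto simp: Pi_iff)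
  qed
  fix c assume c: "c \<in> {..<n} \<rightarrow> carrier C" and z: "TM.lincomb n ?e c = \<zero>\<^bsub>T\<^esub>"
  show "\<forall>i<n. c i = \<zero>\<^bsub>C\<^esub>"
  proof (intro allI impI)
    fix i assume i: "i < n"
    have hom: "\<phi> (a \<oplus>\<^bsub>B\<^esub> b) = \<phi> a \<oplus>\<^bsub>C\<^esub> \<phi> b" "\<phi> (a \<otimes>\<^bsub>B\<^esub> b) = \<phi> a \<otimes>\<^bsub>C\<^esub> \<phi> b" if "a \<in> carrier B" "b \<in> carrier B" for a b
      using base_hom that by (auto simp: ring_hom_def)
    have phi1: "\<phi> \<one>\<^bsub>B\<^esub> = \<one>\<^bsub>C\<^esub>" using base_hom by (simp add: ring_hom_def)
    have phi0: "\<phi> \<zero>\<^bsub>B\<^esub> = \<zero>\<^bsub>C\<^esub>"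
      using hom(1)[of "\<zero>\<^bsub>B\<^esub>" "\<zero>\<^bsub>B\<^esub>"] base_closed[of "\<zero>\<^bsub>B\<^esub>"] by (simp add: C.add.r_cancel_one')
    obtain h where h: "\<And>U. U \<in> carrier T \<Longrightarrow> h U \<in> carrier C"
      "\<And>U V. U \<in> carrier T \<Longrightarrow> V \<in> carrier T \<Longrightarrow> h (U \<oplus>\<^bsub>T\<^esub> V) = h U \<oplus>\<^bsub>C\<^esub> h V"
      "\<And>x c. x \<in> carrier M \<Longrightarrow> c \<in> carrier C \<Longrightarrow> h (tens x c) = \<phi> (co i x) \<otimes>\<^bsub>C\<^esub> c"
    proof (rule lift_exists[OF C.is_abelian_group, of "\<lambda>x c. \<phi> (co i x) \<otimes>\<^bsub>C\<^esub> c"])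
      fix b x c assume "b \<in> carrier B" "x \<in> carrier M" "c \<in> carrier C"
      then show "\<phi> (co i (b \<odot>\<^bsub>M\<^esub> x)) \<otimes>\<^bsub>C\<^esub> c = \<phi> (co i x) \<otimes>\<^bsub>C\<^esub> (\<phi> b \<otimes>\<^bsub>C\<^esub> c)"
        using co i by (simp add: hom C.m_ac)
    qed (use i co in \<open>auto simp: hom C.l_distr C.r_distr\<close>)
    have h0: "h \<zero>\<^bsub>T\<^esub> = \<zero>\<^bsub>C\<^esub>"
      using h(2)[of "\<zero>\<^bsub>T\<^esub>" "\<zero>\<^bsub>T\<^esub>"] h(1)[of "\<zero>\<^bsub>T\<^esub>"] by (simp add: C.add.r_cancel_one')
    have "h (TM.lincomb n ?e c) = (\<Oplus>\<^bsub>C\<^esub>j\<in>{..<n}. h (c j \<odot>\<^bsub>T\<^esub> ?e j))"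
      unfolding TM.lincomb_def
      by (rule finsum_additive) (use h c e' in \<open>auto simp: Pi_iff T.abelian_group_axioms C.is_abelian_group\<close>)
    also have "\<dots> = (\<Oplus>\<^bsub>C\<^esub>j\<in>{..<n}. if i = j then c j else \<zero>\<^bsub>C\<^esub>)"
      by (rule C.finsum_cong') (use h c e' i co in \<open>auto simp: Pi_iff smult_tens phi0 phi1\<close>)
    also have "\<dots> = c i" using i c by (intro C.finsum_singleton) (auto simp: Pi_iff)
    finally show "c i = \<zero>\<^bsub>C\<^esub>" by (simp add: z h0)
  qed
qed

end


locale algebra_extension = scalar_extension B \<phi> C M + MA: algebra B M
  for B :: "('b, 'r) ring_scheme" and \<phi> :: "'b \<Rightarrow> 'c"
    and C :: "('c, 'q) ring_scheme" and M :: "('b, 'm, 's) module_scheme"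
begin

text \<open>The multiplication of the tensor product before passing to classes.\<close>

definition bil :: "('m \<times> 'c \<Rightarrow>\<^sub>0 int) \<Rightarrow> ('m \<times> 'c \<Rightarrow>\<^sub>0 int) \<Rightarrow> ('m \<times> 'c \<Rightarrow>\<^sub>0 int)"
  where "bil u v = frag_extend (\<lambda>(x, c).
    frag_extend (\<lambda>(y, d). frag_of (x \<otimes>\<^bsub>M\<^esub> y, c \<otimes>\<^bsub>C\<^esub> d)) v) u"

lemma bil_diff_left: "bil (u - u') v = bil u v - bil u' v"
  by (simp add: bil_def frag_extend_diff)

lemma bil_diff_right: "bil u (v - v') = bil u v - bil u v'"
proof -
  have "bil u (v - v') = bil u v - bil u v'"
    using subset_UNIV[of "Poly_Mapping.keys u"]
  proof (rule free_Abelian_group_induct)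
    show "bil (frag_of a) (v - v') = bil (frag_of a) v - bil (frag_of a) v'" for a
      by (cases a) (simp add: bil_def frag_extend_diff)
  qed (simp_all add: bil_def frag_extend_diff)
  then show ?thesis .
qed

lemma bil_frag_of: "bil (frag_of (x, c)) (frag_of (y, d)) = frag_of (x \<otimes>\<^bsub>M\<^esub> y, c \<otimes>\<^bsub>C\<^esub> d)"
  by (simp add: bil_def)

lemma bil_zero [simp]: "bil 0 v = 0" "bil u 0 = 0"
  using bil_diff_left[of 0 0 v] bil_diff_right[of u 0 0] by simp_all

lemma bil_keys:
  assumes "Poly_Mapping.keys u \<subseteq> P" "Poly_Mapping.keys v \<subseteq> P"
  shows "Poly_Mapping.keys (bil u v) \<subseteq> P"
  using assms(1)
proof (rule free_Abelian_group_induct)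
  fix a assume a: "a \<in> P"
  show "Poly_Mapping.keys (bil (frag_of a) v) \<subseteq> P"
    using assms(2)
  proof (rule free_Abelian_group_induct)
    fix b assume "b \<in> P"
    with a show "Poly_Mapping.keys (bil (frag_of a) (frag_of b)) \<subseteq> P"
      by (cases a; cases b) (simp add: bil_frag_of)
  qed (simp_all add: bil_diff_right keys_diffI)
qed (simp_all add: bil_diff_left keys_diffI)

text \<open>The relations form an ideal; by commutativity it suffices to multiply on one side.\<close>

lemma bil_kernel_right:
  assumes "Poly_Mapping.keys u \<subseteq> P" "z \<in> N"
  shows "bil u z \<in> N"
  using assms(1)
proof (rule free_Abelian_group_induct)
  fix a assume a: "a \<in> P"
  obtain x c where xc: "a = (x, c)" "x \<in> carrier M" "c \<in> carrier C" using a by (cases a) auto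
  let ?g = "\<lambda>(y, d). frag_of (x \<otimes>\<^bsub>M\<^esub> y, c \<otimes>\<^bsub>C\<^esub> d)"
  have "frag_extend ?g z \<in> N"
  proof (rule frag_extend_kernel[OF assms(2)])
    fix b y d assume b: "b \<in> carrier B" "y \<in> carrier M" "d \<in> carrier C"
    have "c \<otimes>\<^bsub>C\<^esub> (\<phi> b \<otimes>\<^bsub>C\<^esub> d) = \<phi> b \<otimes>\<^bsub>C\<^esub> (c \<otimes>\<^bsub>C\<^esub> d)"
      using b xc by (intro C.m_lcomm) simp_all
    moreover have "x \<otimes>\<^bsub>M\<^esub> (b \<odot>\<^bsub>M\<^esub> y) = b \<odot>\<^bsub>M\<^esub> (x \<otimes>\<^bsub>M\<^esub> y)"
      using b xc MA.smult_assoc2[of b y x] by (simp add: MA.m_comm)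
    ultimately show "?g (b \<odot>\<^bsub>M\<^esub> y, d) - ?g (y, \<phi> b \<otimes>\<^bsub>C\<^esub> d) \<in> N"
      using b xc by (simp add: kernel_rels)
  qed (use xc in \<open>simp_all add: kernel_diff kernel_rels C.r_distr MA.r_distr\<close>)
  then show "bil (frag_of a) z \<in> N" by (simp add: bil_def xc)
qed (simp_all add: bil_diff_left kernel_diff)

lemma bil_commute:
  assumes "Poly_Mapping.keys u \<subseteq> P" "Poly_Mapping.keys v \<subseteq> P"
  shows "bil u v = bil v u"
  using assms(1)
proof (rule free_Abelian_group_induct)
  fix a assume a: "a \<in> P"
  show "bil (frag_of a) v = bil v (frag_of a)"
    using assms(2)
  proof (rule free_Abelian_group_induct)
    fix b assume "b \<in> P"
    with a show "bil (frag_of a) (frag_of b) = bil (frag_of b) (frag_of a)"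
      by (cases a; cases b) (simp add: bil_frag_of MA.m_comm C.m_comm)
  qed (simp_all add: bil_diff_left bil_diff_right)
qed (simp_all add: bil_diff_left bil_diff_right)

lemma mult_T:
  assumes u: "Poly_Mapping.keys u \<subseteq> P" and v: "Poly_Mapping.keys v \<subseteq> P"
  shows "cls u \<otimes>\<^bsub>T\<^esub> cls v = cls (bil u v)"
proof -
  have eq: "cls (bil u' v') = cls (bil u v)" if "u' \<in> cls u" "v' \<in> cls v" for u' v'
  proof -
    have k: "Poly_Mapping.keys u' \<subseteq> P" "Poly_Mapping.keys v' \<subseteq> P" using that u v cls_keys by blast+
    have n: "u' - u \<in> N" "v' - v \<in> N" using that by (simp_all add: cls_mem)
    have "bil (u' - u) v' \<in> N" "bil u (v' - v) \<in> N"
      using bil_kernel_right[OF k(2) n(1)] bil_commute[OF k(2) kernel_keys[OF n(1)]] bil_kernel_right[OF u n(2)] by simp_all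
    then have "bil (u' - u) v' + bil u (v' - v) \<in> N" by (rule kernel_add)
    then have "bil u' v' - bil u v \<in> N" by (simp add: bil_diff_left bil_diff_right)
    then show ?thesis using k u v by (simp add: cls_eq bil_keys)
  qed
  have "(\<Union>u'\<in>cls u. \<Union>v'\<in>cls v. cls (bil u' v')) = cls (bil u v)"
    using eq cls_self[of u] cls_self[of v] by blast
  then show ?thesis by (simp add: base_change_def Let_def bil_def)
qed

lemma tens_mult:
  assumes "x \<in> carrier M" "y \<in> carrier M" "c \<in> carrier C" "d \<in> carrier C"
  shows "tens x c \<otimes>\<^bsub>T\<^esub> tens y d = tens (x \<otimes>\<^bsub>M\<^esub> y) (c \<otimes>\<^bsub>C\<^esub> d)"
  using mult_T[of "frag_of (x, c)" "frag_of (y, d)"] assms by (simp add: tens_def bil_frag_of)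

lemma mult_T_closed: "U \<in> carrier T \<Longrightarrow> V \<in> carrier T \<Longrightarrow> U \<otimes>\<^bsub>T\<^esub> V \<in> carrier T"
  by (auto simp: carrier_T mult_T bil_keys)

lemma mult_T_diff:
  assumes "U \<in> carrier T" "V \<in> carrier T" "W \<in> carrier T"
  shows "(U \<ominus>\<^bsub>T\<^esub> V) \<otimes>\<^bsub>T\<^esub> W = U \<otimes>\<^bsub>T\<^esub> W \<ominus>\<^bsub>T\<^esub> V \<otimes>\<^bsub>T\<^esub> W"
    and "W \<otimes>\<^bsub>T\<^esub> (U \<ominus>\<^bsub>T\<^esub> V) = W \<otimes>\<^bsub>T\<^esub> U \<ominus>\<^bsub>T\<^esub> W \<otimes>\<^bsub>T\<^esub> V"
proof -
  obtain u v w where "Poly_Mapping.keys u \<subseteq> P" "Poly_Mapping.keys v \<subseteq> P" "Poly_Mapping.keys w \<subseteq> P"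
    "U = cls u" "V = cls v" "W = cls w" using assms by (auto simp: carrier_T)
  then show "(U \<ominus>\<^bsub>T\<^esub> V) \<otimes>\<^bsub>T\<^esub> W = U \<otimes>\<^bsub>T\<^esub> W \<ominus>\<^bsub>T\<^esub> V \<otimes>\<^bsub>T\<^esub> W"
    and "W \<otimes>\<^bsub>T\<^esub> (U \<ominus>\<^bsub>T\<^esub> V) = W \<otimes>\<^bsub>T\<^esub> U \<ominus>\<^bsub>T\<^esub> W \<otimes>\<^bsub>T\<^esub> V"
    by (simp_all add: diff_T[symmetric] mult_T bil_keys keys_diffI bil_diff_left bil_diff_right)
qed

lemma mult_T_zero:
  assumes "U \<in> carrier T" shows "U \<otimes>\<^bsub>T\<^esub> \<zero>\<^bsub>T\<^esub> = \<zero>\<^bsub>T\<^esub>" "\<zero>\<^bsub>T\<^esub> \<otimes>\<^bsub>T\<^esub> U = \<zero>\<^bsub>T\<^esub>"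
  using assms by (auto simp: carrier_T zero_T mult_T)

text \<open>To identify \<open>M \<otimes>\<^sub>B C\<close> with a given \<open>C\<close>-algebra \<open>D\<close> it suffices that a ring homomorphism over \<open>\<phi>\<close> takes
  a basis to a basis; the inverse need not be constructed.\<close>

lemma base_change_iso:
  assumes D: "algebra C D"
    and \<psi>: "\<psi> \<in> ring_hom M D"
    and \<psi>_smult: "\<And>b x. b \<in> carrier B \<Longrightarrow> x \<in> carrier M \<Longrightarrow> \<psi> (b \<odot>\<^bsub>M\<^esub> x) = \<phi> b \<odot>\<^bsub>D\<^esub> \<psi> x"
    and b: "is_basis B M n e" and b': "is_basis C D n (\<lambda>i. \<psi> (e i))"
  obtains h where "h \<in> alg_iso C T D"
    "\<And>x c. x \<in> carrier M \<Longrightarrow> c \<in> carrier C \<Longrightarrow> h (tens x c) = c \<odot>\<^bsub>D\<^esub> \<psi> x"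
proof -
  interpret D: algebra C D by fact
  note ps = ring_hom_closed[OF \<psi>] ring_hom_add[OF \<psi>] ring_hom_mult[OF \<psi>] ring_hom_one[OF \<psi>]
  obtain h where h: "\<And>U. U \<in> carrier T \<Longrightarrow> h U \<in> carrier D"
    "\<And>U V. U \<in> carrier T \<Longrightarrow> V \<in> carrier T \<Longrightarrow> h (U \<oplus>\<^bsub>T\<^esub> V) = h U \<oplus>\<^bsub>D\<^esub> h V"
    "\<And>x c. x \<in> carrier M \<Longrightarrow> c \<in> carrier C \<Longrightarrow> h (tens x c) = c \<odot>\<^bsub>D\<^esub> \<psi> x"
  proof (rule lift_exists[OF D.abelian_group_axioms, of "\<lambda>x c. c \<odot>\<^bsub>D\<^esub> \<psi> x"])
    fix b x c assume "b \<in> carrier B" "x \<in> carrier M" "c \<in> carrier C"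
    then show "c \<odot>\<^bsub>D\<^esub> \<psi> (b \<odot>\<^bsub>M\<^esub> x) = (\<phi> b \<otimes>\<^bsub>C\<^esub> c) \<odot>\<^bsub>D\<^esub> \<psi> x"
      by (simp add: \<psi>_smult ps D.smult_assoc1[symmetric] C.m_comm)
  qed (auto simp: ps D.smult_l_distr D.smult_r_distr)
  have h0: "h \<zero>\<^bsub>T\<^esub> = \<zero>\<^bsub>D\<^esub>"
    using h(2)[of "\<zero>\<^bsub>T\<^esub>" "\<zero>\<^bsub>T\<^esub>"] h(1)[of "\<zero>\<^bsub>T\<^esub>"] by (simp add: D.M.add.r_cancel_one')
  have hdiff: "h (U \<ominus>\<^bsub>T\<^esub> V) = h U \<ominus>\<^bsub>D\<^esub> h V" if "U \<in> carrier T" "V \<in> carrier T" for U V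
  proof -
    have "h (\<ominus>\<^bsub>T\<^esub> V) \<oplus>\<^bsub>D\<^esub> h V = \<zero>\<^bsub>D\<^esub>"
      using h(2)[of "\<ominus>\<^bsub>T\<^esub> V" V] that by (simp add: T.l_neg h0)
    then have "\<ominus>\<^bsub>D\<^esub> h V = h (\<ominus>\<^bsub>T\<^esub> V)" using that h(1) by (intro D.M.minus_equality) simp_all
    then show ?thesis using that by (simp add: a_minus_def h)
  qed
  have hsm: "h (d \<odot>\<^bsub>T\<^esub> U) = d \<odot>\<^bsub>D\<^esub> h U" if "d \<in> carrier C" "U \<in> carrier T" for d U
    using that(2)
  proof (induction rule: T_induct)
    case (diff U V)
    have r: "d \<odot>\<^bsub>D\<^esub> (a \<ominus>\<^bsub>D\<^esub> b) = d \<odot>\<^bsub>D\<^esub> a \<ominus>\<^bsub>D\<^esub> d \<odot>\<^bsub>D\<^esub> b" if "a \<in> carrier D" "b \<in> carrier D" for a b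
      using that \<open>d \<in> carrier C\<close> by (simp add: a_minus_def D.smult_r_distr D.smult_r_minus)
    show ?case using that(1) diff
      by (simp add: smult_T_diff hdiff smult_T_closed r h(1))
  qed (use that(1) in \<open>auto simp: smult_tens h ps D.smult_assoc1 smult_T_zero h0\<close>)
  have hm: "h (U \<otimes>\<^bsub>T\<^esub> V) = h U \<otimes>\<^bsub>D\<^esub> h V" if U: "U \<in> carrier T" and V: "V \<in> carrier T" for U V
    using U
  proof (induction rule: T_induct)
    case zero then show ?case using V h(1) by (simp add: mult_T_zero h0)
  next
    case (diff U U')
    have "(a \<ominus>\<^bsub>D\<^esub> b) \<otimes>\<^bsub>D\<^esub> c = a \<otimes>\<^bsub>D\<^esub> c \<ominus>\<^bsub>D\<^esub> b \<otimes>\<^bsub>D\<^esub> c"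
      if "a \<in> carrier D" "b \<in> carrier D" "c \<in> carrier D" for a b c
      using that by (simp add: a_minus_def D.l_distr D.l_minus)
    then show ?case using V diff
      by (simp add: mult_T_diff hdiff mult_T_closed h(1))
  next
    case (tens x c)
    show ?case using V
    proof (induction rule: T_induct)
      case zero then show ?case using tens h(1) by (simp add: mult_T_zero h0)
    next
      case (diff U U')
      have "c \<otimes>\<^bsub>D\<^esub> (a \<ominus>\<^bsub>D\<^esub> b) = c \<otimes>\<^bsub>D\<^esub> a \<ominus>\<^bsub>D\<^esub> c \<otimes>\<^bsub>D\<^esub> b"
        if "a \<in> carrier D" "b \<in> carrier D" "c \<in> carrier D" for a b c
        using that by (simp add: a_minus_def D.r_distr D.r_minus)
      then show ?case using tens diff
        by (simp add: mult_T_diff hdiff mult_T_closed h(1))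
    next
      case (tens y d)
      have "(c \<odot>\<^bsub>D\<^esub> \<psi> x) \<otimes>\<^bsub>D\<^esub> (d \<odot>\<^bsub>D\<^esub> \<psi> y) = c \<odot>\<^bsub>D\<^esub> (\<psi> x \<otimes>\<^bsub>D\<^esub> (d \<odot>\<^bsub>D\<^esub> \<psi> y))"
        using tens \<open>x \<in> carrier M\<close> \<open>c \<in> carrier C\<close> by (simp add: D.smult_assoc2 ps)
      also have "\<psi> x \<otimes>\<^bsub>D\<^esub> (d \<odot>\<^bsub>D\<^esub> \<psi> y) = d \<odot>\<^bsub>D\<^esub> (\<psi> x \<otimes>\<^bsub>D\<^esub> \<psi> y)"
        using tens \<open>x \<in> carrier M\<close> D.smult_assoc2[of d "\<psi> y" "\<psi> x"] by (simp add: D.m_comm ps)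
      finally show ?case
        using tens \<open>x \<in> carrier M\<close> \<open>c \<in> carrier C\<close> by (simp add: tens_mult h ps D.smult_assoc1)
    qed
  qed
  have h1: "h \<one>\<^bsub>T\<^esub> = \<one>\<^bsub>D\<^esub>" by (simp add: one_T h ps)
  have "bij_betw h (carrier T) (carrier D)"
  proof (rule bij_betw_of_bases[OF module_T D.module base_change_basis[OF b]])
    have "h (tens (e i) \<one>\<^bsub>C\<^esub>) = \<psi> (e i)" if "i < n" for i
      using b that h(3)[of "e i" "\<one>\<^bsub>C\<^esub>"] ps by (auto simp: is_basis_def Pi_iff)
    then show "is_basis C D n (\<lambda>i. h (tens (e i) \<one>\<^bsub>C\<^esub>))"
      by (intro D.is_basis_cong[OF b']) simp
  qed (auto simp: h hsm)
  then have "h \<in> alg_iso C T D"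
    unfolding alg_iso_def alg_hom_def ring_hom_def using h hm h1 hsm by auto
  then show ?thesis using that h(3) by blast
qed

end

section \<open>Subrings of a field and their copies\<close>

text \<open>Subrings of one field as plain sets: all rings of the proof lie in \<open>L\<close>, where they can be compared.\<close>

definition is_subring :: "'l::field set \<Rightarrow> bool"
  where "is_subring S \<longleftrightarrow> 1 \<in> S \<and> (\<forall>a\<in>S. \<forall>b\<in>S. a + b \<in> S \<and> a * b \<in> S) \<and> (\<forall>a\<in>S. - a \<in> S)"

lemma is_subringD:
  assumes "is_subring S"
  shows "1 \<in> S" "0 \<in> S" "a \<in> S \<Longrightarrow> b \<in> S \<Longrightarrow> a + b \<in> S" "a \<in> S \<Longrightarrow> b \<in> S \<Longrightarrow> a * b \<in> S"
    "a \<in> S \<Longrightarrow> - a \<in> S" "a \<in> S \<Longrightarrow> b \<in> S \<Longrightarrow> a - b \<in> S" "a \<in> S \<Longrightarrow> a ^ k \<in> S"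
proof -
  show *: "1 \<in> S" "a \<in> S \<Longrightarrow> b \<in> S \<Longrightarrow> a + b \<in> S" "a \<in> S \<Longrightarrow> b \<in> S \<Longrightarrow> a * b \<in> S" "a \<in> S \<Longrightarrow> - a \<in> S"
    for a b using assms by (auto simp: is_subring_def)
  show "0 \<in> S" using *(2)[OF *(1) *(4)[OF *(1)]] by simp
  show "a \<in> S \<Longrightarrow> b \<in> S \<Longrightarrow> a - b \<in> S" using *(2)[of a "- b"] *(4) by simp
  show "a \<in> S \<Longrightarrow> a ^ k \<in> S" by (induction k) (auto intro: *)
qed

lemma is_subring_sum: "is_subring S \<Longrightarrow> (\<And>i. i \<in> I \<Longrightarrow> f i \<in> S) \<Longrightarrow> sum f I \<in> S"
  by (induction I rule: infinite_finite_induct) (auto intro: is_subringD)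

text \<open>Copies of subrings and their localizations (whose elements are classes of pairs) are both images of a
  subring, so that this lemma yields the ring axioms for both.\<close>

lemma cring_of_image:
  fixes Q :: "('x, 'q) ring_scheme" and f :: "'l::field \<Rightarrow> 'x"
  assumes S: "is_subring S" and car: "carrier Q = f ` S"
    and mult: "\<And>a b. a \<in> S \<Longrightarrow> b \<in> S \<Longrightarrow> f a \<otimes>\<^bsub>Q\<^esub> f b = f (a * b)"
    and add: "\<And>a b. a \<in> S \<Longrightarrow> b \<in> S \<Longrightarrow> f a \<oplus>\<^bsub>Q\<^esub> f b = f (a + b)"
    and one: "\<one>\<^bsub>Q\<^esub> = f 1" and zero: "\<zero>\<^bsub>Q\<^esub> = f 0"
  shows "cring Q"
proof (rule cringI)
  show "abelian_group Q"
  proof (rule abelian_groupI)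
    fix x assume "x \<in> carrier Q"
    then obtain a where "a \<in> S" "x = f a" by (auto simp: car)
    then show "\<exists>y\<in>carrier Q. y \<oplus>\<^bsub>Q\<^esub> x = \<zero>\<^bsub>Q\<^esub>"
      using is_subringD[OF S] by (intro bexI[of _ "f (- a)"]) (auto simp: add zero car)
  qed (auto simp: car add zero is_subringD[OF S] algebra_simps intro!: imageI)
  show "comm_monoid Q"
    by (rule comm_monoidI) (auto simp: car mult one is_subringD[OF S] algebra_simps intro!: imageI)
qed (auto simp: car add mult is_subringD[OF S] algebra_simps)

text \<open>The assumptions on closures only speak of rings on the type \<open>'u\<close>; the rings of the proof are transported
  there along \<open>\<iota>\<close>.\<close>

locale carrier_copy =
  fixes \<iota> :: "'l::field \<Rightarrow> 'u"
  assumes inj: "inj \<iota>"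
begin

definition \<kappa> :: "'u \<Rightarrow> 'l" where "\<kappa> = inv_into UNIV \<iota>"

lemma kappa [simp]: "\<kappa> (\<iota> a) = a"
  unfolding \<kappa>_def using inj by (simp add: inv_f_f)

lemma iota_eq [simp]: "\<iota> a = \<iota> b \<longleftrightarrow> a = b"
  using inj by (auto simp: inj_eq)

lemma iota_in [simp]: "\<iota> a \<in> \<iota> ` S \<longleftrightarrow> a \<in> S"
  by auto

definition ring_copy :: "'l set \<Rightarrow> 'u ring"
  where "ring_copy S = \<lparr>carrier = \<iota> ` S, monoid.mult = (\<lambda>x y. \<iota> (\<kappa> x * \<kappa> y)), one = \<iota> 1,
    ring.zero = \<iota> 0, add = (\<lambda>x y. \<iota> (\<kappa> x + \<kappa> y))\<rparr>"

text \<open>The product \<open>m\<close> is a parameter, since the special fibre is a subset of \<open>L\<close> with the addition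
  of \<open>L\<close> but with another product.\<close>

definition module_copy :: "('l \<Rightarrow> 'l \<Rightarrow> 'l) \<Rightarrow> 'l set \<Rightarrow> ('u, 'u) module"
  where "module_copy m S = \<lparr>carrier = \<iota> ` S, monoid.mult = (\<lambda>x y. \<iota> (m (\<kappa> x) (\<kappa> y))), one = \<iota> 1,
    ring.zero = \<iota> 0, add = (\<lambda>x y. \<iota> (\<kappa> x + \<kappa> y)), module.smult = (\<lambda>x y. \<iota> (\<kappa> x * \<kappa> y))\<rparr>"

lemma ring_copy_simps [simp]:
  "carrier (ring_copy S) = \<iota> ` S" "x \<otimes>\<^bsub>ring_copy S\<^esub> y = \<iota> (\<kappa> x * \<kappa> y)"
  "x \<oplus>\<^bsub>ring_copy S\<^esub> y = \<iota> (\<kappa> x + \<kappa> y)" "\<one>\<^bsub>ring_copy S\<^esub> = \<iota> 1" "\<zero>\<^bsub>ring_copy S\<^esub> = \<iota> 0"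
  by (simp_all add: ring_copy_def)

lemma module_copy_simps [simp]:
  "carrier (module_copy m S) = \<iota> ` S" "x \<otimes>\<^bsub>module_copy m S\<^esub> y = \<iota> (m (\<kappa> x) (\<kappa> y))"
  "x \<oplus>\<^bsub>module_copy m S\<^esub> y = \<iota> (\<kappa> x + \<kappa> y)" "\<one>\<^bsub>module_copy m S\<^esub> = \<iota> 1" "\<zero>\<^bsub>module_copy m S\<^esub> = \<iota> 0"
  "x \<odot>\<^bsub>module_copy m S\<^esub> y = \<iota> (\<kappa> x * \<kappa> y)"
  by (simp_all add: module_copy_def)

lemma cring_ring_copy: "is_subring S \<Longrightarrow> cring (ring_copy S)"
  by (rule cring_of_image) simp_all

lemma pow_ring_copy: "\<iota> a [^]\<^bsub>ring_copy S\<^esub> (k::nat) = \<iota> (a ^ k)"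
  by (induction k) (simp_all add: mult.commute)

lemma algebra_module_copy:
  assumes "is_subring S" "is_subring C" "S \<subseteq> C"
  shows "algebra (ring_copy S) (module_copy (*) C)"
proof (rule algebraI)
  show "cring (module_copy (*) C)"
    by (rule cring_of_image[OF assms(2)]) simp_all
qed (use assms(3) in \<open>auto simp: cring_ring_copy assms algebra_simps intro!: is_subringD(4)[OF assms(2)] intro: subsetD[OF assms(3)]\<close>)


section \<open>Localization\<close>

text \<open>The localization at \<open>\<beta>\<close>, realized as the subring \<open>S[1/\<beta>]\<close> of the field.\<close>

definition fractions :: "'l set \<Rightarrow> 'l \<Rightarrow> 'l set"
  where "fractions S \<beta> = {a / \<beta> ^ k | a k. a \<in> S}"

text \<open>The class in the localization of the copied ring that has the value \<open>v\<close> in the field.\<close>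

definition fraction :: "'l set \<Rightarrow> 'l \<Rightarrow> 'l \<Rightarrow> ('u \<times> 'u) set"
  where "fraction S \<beta> v = {(\<iota> a, \<iota> (\<beta> ^ k)) | a k. a \<in> S \<and> v = a / \<beta> ^ k}"

lemma powers_ring_copy: "powers (ring_copy S) (\<iota> \<beta>) = range (\<lambda>k. \<iota> (\<beta> ^ k))"
  by (simp add: pow_ring_copy)

abbreviation "Loc S b \<equiv> localization (ring_copy S) (powers (ring_copy S) b)"
abbreviation "to_loc S b \<equiv> \<lambda>a. frac (ring_copy S) (powers (ring_copy S) b) a \<one>\<^bsub>ring_copy S\<^esub>"

context
  fixes S :: "'l set" and \<beta> :: 'l
  assumes S: "is_subring S" and \<beta>: "\<beta> \<in> S" "\<beta> \<noteq> 0"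
begin

abbreviation "LocB \<equiv> Loc S (\<iota> \<beta>)"
abbreviation "fracB \<equiv> frac (ring_copy S) (powers (ring_copy S) (\<iota> \<beta>))"

text \<open>In a domain two fractions are equivalent only if they have the same value.\<close>

lemma frac_eq_fraction:
  assumes "a \<in> S"
  shows "fracB (\<iota> a) (\<iota> (\<beta> ^ k)) = fraction S \<beta> (a / \<beta> ^ k)"
proof -
  have "(\<exists>u\<in>range (\<lambda>k. \<iota> (\<beta> ^ k)). \<kappa> u * (\<beta> ^ l * a) = \<kappa> u * (\<beta> ^ k * c)) \<longleftrightarrow> a / \<beta> ^ k = c / \<beta> ^ l" for c l
    using \<beta>(2) by (auto simp: field_simps)
  then show ?thesis
    unfolding frac_def fraction_def powers_ring_copy by (auto simp: image_iff) blast+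
qed

lemma frac_one: "a \<in> S \<Longrightarrow> fracB (\<iota> a) (\<iota> 1) = fraction S \<beta> a"
  using frac_eq_fraction[of a 0] by simp

lemma carrier_Loc: "carrier LocB = fraction S \<beta> ` fractions S \<beta>"
proof -
  have "carrier LocB = {fracB (\<iota> a) (\<iota> (\<beta> ^ k)) | a k. a \<in> S}"
    unfolding localization_def powers_ring_copy by auto
  also have "\<dots> = {fraction S \<beta> (a / \<beta> ^ k) | a k. a \<in> S}"
    using frac_eq_fraction by metis
  finally show ?thesis unfolding fractions_def by auto
qed

lemma is_subring_fractions: "is_subring (fractions S \<beta>)"
  unfolding is_subring_def
proof (intro conjI ballI)
  show "1 \<in> fractions S \<beta>"
    unfolding fractions_def using is_subringD(1)[OF S] by (auto intro!: exI[of _ 1] exI[of _ "0::nat"])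
  fix v w assume "v \<in> fractions S \<beta>" "w \<in> fractions S \<beta>"
  then obtain a k c l where v: "a \<in> S" "v = a / \<beta> ^ k" and w: "c \<in> S" "w = c / \<beta> ^ l"
    by (auto simp: fractions_def)
  have "v + w = (a * \<beta> ^ l + c * \<beta> ^ k) / \<beta> ^ (k + l)"
    using \<beta>(2) by (simp add: v w field_simps power_add)
  moreover have "a * \<beta> ^ l + c * \<beta> ^ k \<in> S" using S v w \<beta> by (intro is_subringD)
  ultimately show "v + w \<in> fractions S \<beta>" by (auto simp: fractions_def)
  have "v * w = (a * c) / \<beta> ^ (k + l)" by (simp add: v w power_add)
  moreover have "a * c \<in> S" using S v w by (intro is_subringD)
  ultimately show "v * w \<in> fractions S \<beta>" by (auto simp: fractions_def)
next
  fix v assume "v \<in> fractions S \<beta>"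
  then obtain a k where v: "a \<in> S" "v = a / \<beta> ^ k" by (auto simp: fractions_def)
  then have "- v = (- a) / \<beta> ^ k" "- a \<in> S" using is_subringD(5)[OF S] by simp_all
  then show "- v \<in> fractions S \<beta>" unfolding fractions_def by blast
qed

lemma fraction_mem: "v \<in> fractions S \<beta> \<Longrightarrow> \<exists>a k. a \<in> S \<and> v = a / \<beta> ^ k \<and> (\<iota> a, \<iota> (\<beta> ^ k)) \<in> fraction S \<beta> v"
  by (auto simp: fractions_def fraction_def)

lemma fraction_inj: "v \<in> fractions S \<beta> \<Longrightarrow> fraction S \<beta> v = fraction S \<beta> w \<Longrightarrow> v = w"
  using fraction_mem[of v] by (auto simp: fraction_def)

lemma mult_Loc:
  assumes v: "v \<in> fractions S \<beta>" and w: "w \<in> fractions S \<beta>"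
  shows "fraction S \<beta> v \<otimes>\<^bsub>LocB\<^esub> fraction S \<beta> w = fraction S \<beta> (v * w)"
proof -
  have eq: "fracB (a \<otimes>\<^bsub>ring_copy S\<^esub> c) (s \<otimes>\<^bsub>ring_copy S\<^esub> t) = fraction S \<beta> (v * w)"
    if "(a, s) \<in> fraction S \<beta> v" "(c, t) \<in> fraction S \<beta> w" for a s c t
  proof -
    from that obtain a' k c' l where *: "a = \<iota> a'" "s = \<iota> (\<beta> ^ k)" "a' \<in> S" "v = a' / \<beta> ^ k"
      "c = \<iota> c'" "t = \<iota> (\<beta> ^ l)" "c' \<in> S" "w = c' / \<beta> ^ l" by (auto simp: fraction_def)
    then show ?thesis
      using frac_eq_fraction[of "a' * c'" "k + l"] is_subringD(4)[OF S] by (simp add: power_add)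
  qed
  obtain a s c t where m: "(a, s) \<in> fraction S \<beta> v" "(c, t) \<in> fraction S \<beta> w"
    using fraction_mem[OF v] fraction_mem[OF w] by blast
  have "(\<Union>(a, s)\<in>fraction S \<beta> v. \<Union>(c, t)\<in>fraction S \<beta> w.
     fracB (a \<otimes>\<^bsub>ring_copy S\<^esub> c) (s \<otimes>\<^bsub>ring_copy S\<^esub> t)) = fraction S \<beta> (v * w)" (is "?U = _")
  proof
    show "?U \<subseteq> fraction S \<beta> (v * w)" using eq by blast
    show "fraction S \<beta> (v * w) \<subseteq> ?U" using eq[OF m] m by blast
  qed
  then show ?thesis by (simp add: localization_def)
qed

lemma add_Loc:
  assumes v: "v \<in> fractions S \<beta>" and w: "w \<in> fractions S \<beta>"
  shows "fraction S \<beta> v \<oplus>\<^bsub>LocB\<^esub> fraction S \<beta> w = fraction S \<beta> (v + w)"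
proof -
  have eq: "fracB ((t \<otimes>\<^bsub>ring_copy S\<^esub> a) \<oplus>\<^bsub>ring_copy S\<^esub> (s \<otimes>\<^bsub>ring_copy S\<^esub> c)) (s \<otimes>\<^bsub>ring_copy S\<^esub> t) = fraction S \<beta> (v + w)"
    if "(a, s) \<in> fraction S \<beta> v" "(c, t) \<in> fraction S \<beta> w" for a s c t
  proof -
    from that obtain a' k c' l where *: "a = \<iota> a'" "s = \<iota> (\<beta> ^ k)" "a' \<in> S" "v = a' / \<beta> ^ k"
      "c = \<iota> c'" "t = \<iota> (\<beta> ^ l)" "c' \<in> S" "w = c' / \<beta> ^ l" by (auto simp: fraction_def)
    have "\<beta> ^ l * a' + \<beta> ^ k * c' \<in> S" using * \<beta> S by (intro is_subringD)
    then have "fracB (\<iota> (\<beta> ^ l * a' + \<beta> ^ k * c')) (\<iota> (\<beta> ^ (k + l))) = fraction S \<beta> ((\<beta> ^ l * a' + \<beta> ^ k * c') / \<beta> ^ (k + l))"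
      by (rule frac_eq_fraction)
    moreover have "(\<beta> ^ l * a' + \<beta> ^ k * c') / \<beta> ^ (k + l) = v + w"
      using \<beta>(2) by (simp add: * field_simps power_add)
    ultimately show ?thesis by (simp add: * power_add)
  qed
  obtain a s c t where m: "(a, s) \<in> fraction S \<beta> v" "(c, t) \<in> fraction S \<beta> w"
    using fraction_mem[OF v] fraction_mem[OF w] by blast
  have "(\<Union>(a, s)\<in>fraction S \<beta> v. \<Union>(c, t)\<in>fraction S \<beta> w.
     fracB ((t \<otimes>\<^bsub>ring_copy S\<^esub> a) \<oplus>\<^bsub>ring_copy S\<^esub> (s \<otimes>\<^bsub>ring_copy S\<^esub> c)) (s \<otimes>\<^bsub>ring_copy S\<^esub> t)) = fraction S \<beta> (v + w)" (is "?U = _")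
  proof
    show "?U \<subseteq> fraction S \<beta> (v + w)" using eq by blast
    show "fraction S \<beta> (v + w) \<subseteq> ?U" using eq[OF m] m by blast
  qed
  then show ?thesis by (simp add: localization_def)
qed

lemma one_zero_Loc: "\<one>\<^bsub>LocB\<^esub> = fraction S \<beta> 1" "\<zero>\<^bsub>LocB\<^esub> = fraction S \<beta> 0"
  using frac_one[OF is_subringD(1)[OF S]] frac_one[OF is_subringD(2)[OF S]] by (simp_all add: localization_def)

lemma cring_Loc: "cring LocB"
  by (rule cring_of_image[OF is_subring_fractions carrier_Loc mult_Loc add_Loc one_zero_Loc])

lemma mem_fractions: "a \<in> S \<Longrightarrow> a \<in> fractions S \<beta>"
  unfolding fractions_def by (auto intro!: exI[of _ a] exI[of _ "0::nat"])

lemma scalar_extension_Loc: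
  assumes "module (ring_copy S) M"
  shows "scalar_extension (ring_copy S) (to_loc S (\<iota> \<beta>)) LocB M"
proof (intro scalar_extension.intro scalar_extension_axioms.intro cring_Loc assms)
  show "(to_loc S (\<iota> \<beta>)) \<in> ring_hom (ring_copy S) LocB"
    by (rule ring_hom_memI)
       (auto simp: frac_one carrier_Loc mult_Loc add_Loc one_zero_Loc is_subringD[OF S] mem_fractions)
qed

lemma fraction_value:
  obtains j where "\<And>v. v \<in> fractions S \<beta> \<Longrightarrow> j (fraction S \<beta> v) = v"
proof -
  have "inj_on (fraction S \<beta>) (fractions S \<beta>)" using fraction_inj by (auto intro!: inj_onI)
  then show ?thesis using that[of "inv_into (fractions S \<beta>) (fraction S \<beta>)"] inv_into_f_f by metis
qed

end

text \<open>The unit ideal is generated by \<open>1\<close>, and localizing at \<open>1\<close> takes a basis to a basis.\<close>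

lemma locally_free_of_basis:
  assumes S: "is_subring S" and M: "module (ring_copy S) M" and b: "is_basis (ring_copy S) M n e"
  shows "locally_free (ring_copy S) M n"
proof -
  interpret B: cring "ring_copy S" by (rule cring_ring_copy[OF S])
  have one: "1 \<in> S" by (rule is_subringD[OF S])
  interpret scalar_extension "ring_copy S" "to_loc S (\<iota> 1)"
    "Loc S (\<iota> 1)" M
    by (rule scalar_extension_Loc[OF S one _ M]) simp
  have "Idl\<^bsub>ring_copy S\<^esub> {\<iota> 1} = carrier (ring_copy S)"
    using ideal.one_imp_carrier[OF B.genideal_ideal[of "{\<iota> 1}"]] B.genideal_self'[of "\<iota> 1"] one by simp
  then show ?thesis
    unfolding locally_free_def free_of_rank_iff_basis
    using base_change_basis[OF b] one by (intro exI[of _ "{\<iota> 1}"]) auto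
qed

end

section \<open>Locally free modules over a domain\<close>

text \<open>If the elements of \<open>E\<close> generate the unit ideal, so do their powers.  Instead of expanding a power
  of a sum, one lowers the exponents one at a time: by induction on the sum of the exponents,
  every \<open>b\<close> in \<open>E\<close> already kills \<open>m\<close>, and then \<open>1\<close> does.\<close>

lemma (in module) zero_if_killed_by_powers:
  assumes "finite E" "E \<subseteq> carrier R" "Idl\<^bsub>R\<^esub> E = carrier R" "m \<in> carrier M"
    and "\<And>b. b \<in> E \<Longrightarrow> (b [^]\<^bsub>R\<^esub> (k b :: nat)) \<odot>\<^bsub>M\<^esub> m = \<zero>\<^bsub>M\<^esub>"
  shows "m = \<zero>\<^bsub>M\<^esub>"
  using assms(4,5)
proof (induction "\<Sum>b\<in>E. k b" arbitrary: m k rule: less_induct)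
  case less
  have kill: "b \<odot>\<^bsub>M\<^esub> m = \<zero>\<^bsub>M\<^esub>" if b: "b \<in> E" for b
  proof (cases "k b")
    case 0
    then show ?thesis using less.prems(2)[OF b] less.prems(1) b assms(2) by auto
  next
    case (Suc l)
    have bR: "b \<in> carrier R" using b assms(2) by auto
    define k' where "k' = k(b := l)"
    have lt: "(\<Sum>b\<in>E. k' b) < (\<Sum>b\<in>E. k b)"
      using b assms(1) by (intro sum_strict_mono_ex1) (auto simp: k'_def Suc intro!: bexI[of _ b])
    have "(c [^]\<^bsub>R\<^esub> k' c) \<odot>\<^bsub>M\<^esub> (b \<odot>\<^bsub>M\<^esub> m) = \<zero>\<^bsub>M\<^esub>" if c: "c \<in> E" for c
    proof -
      have cR: "c \<in> carrier R" using c assms(2) by auto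
      show ?thesis
      proof (cases "c = b")
        case True
        then show ?thesis using less.prems(2)[OF b] less.prems(1) bR
          by (simp add: k'_def Suc smult_assoc1[symmetric])
      next
        case False
        have "(c [^]\<^bsub>R\<^esub> k' c) \<odot>\<^bsub>M\<^esub> (b \<odot>\<^bsub>M\<^esub> m) = b \<odot>\<^bsub>M\<^esub> ((c [^]\<^bsub>R\<^esub> k c) \<odot>\<^bsub>M\<^esub> m)"
          using False less.prems(1) bR cR by (simp add: k'_def smult_assoc1[symmetric] R.m_comm)
        then show ?thesis using less.prems(2)[OF c] bR by simp
      qed
    qed
    then show ?thesis using less.hyps[OF lt, of "b \<odot>\<^bsub>M\<^esub> m"] less.prems(1) bR by blast
  qed
  let ?I = "{a \<in> carrier R. a \<odot>\<^bsub>M\<^esub> m = \<zero>\<^bsub>M\<^esub>}"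
  have "ideal ?I R"
  proof (rule idealI)
    show "subgroup ?I (add_monoid R)"
    proof (rule R.add.subgroupI)
      show "\<ominus>\<^bsub>R\<^esub> a \<in> ?I" if "a \<in> ?I" for a
        using that less.prems(1) by (simp add: smult_l_minus)
    qed (use less.prems(1) in \<open>auto simp: smult_l_distr intro!: exI[of _ "\<zero>\<^bsub>R\<^esub>"]\<close>)
    fix a x assume a: "a \<in> ?I" and x: "x \<in> carrier R"
    show "x \<otimes>\<^bsub>R\<^esub> a \<in> ?I" using a x less.prems(1) by (simp add: smult_assoc1)
    moreover have "a \<otimes>\<^bsub>R\<^esub> x = x \<otimes>\<^bsub>R\<^esub> a" using a x by (simp add: R.m_comm)
    ultimately show "a \<otimes>\<^bsub>R\<^esub> x \<in> ?I" by (simp only:)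
  qed (rule R.ring_axioms)
  moreover have "E \<subseteq> ?I" using kill assms(2) by auto
  ultimately have "carrier R \<subseteq> ?I" using R.genideal_minimal assms(3) by blast
  then have "\<one>\<^bsub>R\<^esub> \<odot>\<^bsub>M\<^esub> m = \<zero>\<^bsub>M\<^esub>" by blast
  then show ?case using less.prems(1) by simp
qed

lemma (in scalar_extension) tens_eq_zero:
  "x \<in> carrier M \<Longrightarrow> c \<in> carrier C \<Longrightarrow> tens x c = \<zero>\<^bsub>T\<^esub> \<longleftrightarrow> frag_of (x, c) \<in> N"
  using cls_eq[of "frag_of (x, c)" 0] by (simp add: tens_def zero_T)

context carrier_copy begin

text \<open>To see that \<open>m\<close> is killed by a power of \<open>\<beta>\<close> if it dies in \<open>M\<^sub>\<beta>\<close>, one maps \<open>M\<^sub>\<beta>\<close> to the sequences in \<open>M\<close>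
  modulo those that are eventually zero, by \<open>x \<otimes> v \<mapsto> (k \<mapsto> (\<beta>\<^sup>k v) x)\<close>; this is defined as \<open>\<beta>\<^sup>k v\<close> lies in
  \<open>S\<close> for large \<open>k\<close>.  The image of \<open>m \<otimes> 1\<close> is the sequence \<open>\<beta>\<^sup>k m\<close>.\<close>

lemma killed_by_power:
  fixes M :: "('u, 'm, 's) module_scheme"
  assumes S: "is_subring S" and \<beta>: "\<beta> \<in> S" "\<beta> \<noteq> 0" and M: "module (ring_copy S) M" and m: "m \<in> carrier M"
    and zero: "scalar_extension.tens (ring_copy S) (to_loc S (\<iota> \<beta>))
       (Loc S (\<iota> \<beta>)) M m \<one>\<^bsub>Loc S (\<iota> \<beta>)\<^esub>
     = \<zero>\<^bsub>base_change (ring_copy S) (to_loc S (\<iota> \<beta>))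
       (Loc S (\<iota> \<beta>)) M\<^esub>"
  shows "\<exists>k. \<iota> (\<beta> ^ k) \<odot>\<^bsub>M\<^esub> m = \<zero>\<^bsub>M\<^esub>"
proof -
  let ?L = "Loc S (\<iota> \<beta>)"
  let ?f = "to_loc S (\<iota> \<beta>)"
  interpret M: module "ring_copy S" M by (rule M)
  interpret E: scalar_extension "ring_copy S" ?f ?L M
    by (rule scalar_extension_Loc[OF S \<beta> M])
  obtain j where j: "\<And>v. v \<in> fractions S \<beta> \<Longrightarrow> j (fraction S \<beta> v) = v"
    using fraction_value[OF S \<beta>] by blast
  note cl = is_subringD[OF S]
  \<comment> \<open>the default value \<open>0\<close> is taken for finitely many \<open>k\<close> only, as \<open>ev\<close> shows\<close>
  define g where "g k c = (if \<beta> ^ k * j c \<in> S then \<iota> (\<beta> ^ k * j c) else \<iota> 0)" for k :: nat and c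
  have gS: "g k c \<in> \<iota> ` S" for k c using cl(2) by (simp add: g_def)
  have ev: "\<exists>k0. \<forall>k\<ge>k0. \<beta> ^ k * v \<in> S" if "v \<in> fractions S \<beta>" for v
  proof -
    obtain a l where v: "a \<in> S" "v = a / \<beta> ^ l" using \<open>v \<in> fractions S \<beta>\<close> by (auto simp: fractions_def)
    have "\<beta> ^ k * v \<in> S" if "k \<ge> l" for k
    proof -
      have "\<beta> ^ k * v = \<beta> ^ (k - l) * a" using \<open>k \<ge> l\<close> \<beta>(2) by (simp add: v power_diff field_simps)
      then show ?thesis using cl(4)[OF cl(7)[OF \<beta>(1)] v(1)] by simp
    qed
    then show ?thesis by blast
  qed
  have gev: "\<exists>k0. \<forall>k\<ge>k0. \<beta> ^ k * v \<in> S \<and> g k (fraction S \<beta> v) = \<iota> (\<beta> ^ k * v)" if "v \<in> fractions S \<beta>" for v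
    using ev[OF that] j[OF that] by (auto simp: g_def)
  define H :: "(nat \<Rightarrow> 'm) monoid" where "H = \<lparr>carrier = {s. \<forall>k. s k \<in> carrier M},
     monoid.mult = (\<lambda>s t k. s k \<oplus>\<^bsub>M\<^esub> t k), one = (\<lambda>k. \<zero>\<^bsub>M\<^esub>)\<rparr>"
  have H: "carrier H = {s. \<forall>k. s k \<in> carrier M}" "s \<otimes>\<^bsub>H\<^esub> t = (\<lambda>k. s k \<oplus>\<^bsub>M\<^esub> t k)" "\<one>\<^bsub>H\<^esub> = (\<lambda>k. \<zero>\<^bsub>M\<^esub>)" for s t
    by (simp_all add: H_def)
  have Hg: "comm_group H"
  proof (rule comm_groupI)
    fix s assume s: "s \<in> carrier H"
    show "\<exists>t\<in>carrier H. t \<otimes>\<^bsub>H\<^esub> s = \<one>\<^bsub>H\<^esub>"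
      using s by (intro bexI[of _ "\<lambda>k. \<ominus>\<^bsub>M\<^esub> s k"]) (auto simp: H M.M.l_neg)
  qed (auto simp: H M.M.a_ac)
  interpret H: comm_group H by (rule Hg)
  have Hinv: "inv\<^bsub>H\<^esub> s = (\<lambda>k. \<ominus>\<^bsub>M\<^esub> s k)" if "s \<in> carrier H" for s
    using that by (intro H.inv_equality) (auto simp: H M.M.l_neg)
  define J where "J = {s \<in> carrier H. \<exists>k0. \<forall>k\<ge>k0. s k = \<zero>\<^bsub>M\<^esub>}"
  have Jsub: "subgroup J H"
  proof (rule H.subgroupI)
    show "J \<noteq> {}" using H.one_closed by (auto simp: J_def H)
    fix s assume s: "s \<in> J"
    then show "inv\<^bsub>H\<^esub> s \<in> J" by (auto simp: J_def Hinv) (auto simp: H)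
    fix t assume t: "t \<in> J"
    from s t obtain k0 k1 where "\<forall>k\<ge>k0. s k = \<zero>\<^bsub>M\<^esub>" "\<forall>k\<ge>k1. t k = \<zero>\<^bsub>M\<^esub>" by (auto simp: J_def)
    then have "\<forall>k\<ge>max k0 k1. (s \<otimes>\<^bsub>H\<^esub> t) k = \<zero>\<^bsub>M\<^esub>" by (simp add: H)
    moreover have "s \<otimes>\<^bsub>H\<^esub> t \<in> carrier H" using s t by (intro H.m_closed) (auto simp: J_def)
    ultimately show "s \<otimes>\<^bsub>H\<^esub> t \<in> J" unfolding J_def by blast
  qed (auto simp: J_def)
  define f where "f x c = (\<lambda>k. g k c \<odot>\<^bsub>M\<^esub> x)" for x c
  have fH: "f x c \<in> carrier H" if "x \<in> carrier M" for x c
    using that gS by (auto simp: f_def H)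
  have three: "s \<otimes>\<^bsub>H\<^esub> inv\<^bsub>H\<^esub> t \<otimes>\<^bsub>H\<^esub> inv\<^bsub>H\<^esub> u \<in> J"
    if "s \<in> carrier H" "t \<in> carrier H" "u \<in> carrier H" "\<exists>k0. \<forall>k\<ge>k0. s k = t k \<oplus>\<^bsub>M\<^esub> u k" for s t u
  proof -
    from that(4) obtain k0 where k0: "\<forall>k\<ge>k0. s k = t k \<oplus>\<^bsub>M\<^esub> u k" by blast
    have "s k \<oplus>\<^bsub>M\<^esub> \<ominus>\<^bsub>M\<^esub> t k \<oplus>\<^bsub>M\<^esub> \<ominus>\<^bsub>M\<^esub> u k = \<zero>\<^bsub>M\<^esub>" if "k \<ge> k0" for k
    proof -
      have *: "t k \<in> carrier M" "u k \<in> carrier M" using \<open>t \<in> carrier H\<close> \<open>u \<in> carrier H\<close> by (auto simp: H)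
      then have "t k \<oplus>\<^bsub>M\<^esub> u k \<oplus>\<^bsub>M\<^esub> \<ominus>\<^bsub>M\<^esub> t k \<oplus>\<^bsub>M\<^esub> \<ominus>\<^bsub>M\<^esub> u k = (t k \<oplus>\<^bsub>M\<^esub> \<ominus>\<^bsub>M\<^esub> t k) \<oplus>\<^bsub>M\<^esub> (u k \<oplus>\<^bsub>M\<^esub> \<ominus>\<^bsub>M\<^esub> u k)"
        by (simp add: M.M.a_ac)
      then show ?thesis using * k0 that by (simp add: M.M.r_neg)
    qed
    then show ?thesis using that(1-3) H.m_closed H.inv_closed by (auto simp: J_def Hinv H)
  qed
  have two: "s \<otimes>\<^bsub>H\<^esub> inv\<^bsub>H\<^esub> t \<in> J"
    if "s \<in> carrier H" "t \<in> carrier H" "\<exists>k0. \<forall>k\<ge>k0. s k = t k" for s t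
  proof -
    from that(3) obtain k0 where k0: "\<forall>k\<ge>k0. s k = t k" by blast
    have "(s \<otimes>\<^bsub>H\<^esub> inv\<^bsub>H\<^esub> t) k = \<zero>\<^bsub>M\<^esub>" if "k \<ge> k0" for k
      using that k0 \<open>t \<in> carrier H\<close> by (simp add: Hinv) (simp add: H M.M.r_neg)
    then show ?thesis using that(1,2) unfolding J_def by blast
  qed
  obtain \<Phi> where \<Phi>: "\<And>x c. x \<in> carrier M \<Longrightarrow> c \<in> carrier ?L \<Longrightarrow> \<Phi> (frag_of (x, c)) = f x c"
    and ker: "\<And>z. z \<in> E.N \<Longrightarrow> \<Phi> z \<in> J"
  proof (rule E.kernel_eval[OF Hg _ Jsub, of f])
    fix x c d assume x: "x \<in> carrier M" and "c \<in> carrier ?L" "d \<in> carrier ?L"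
    then obtain v w where vw: "v \<in> fractions S \<beta>" "w \<in> fractions S \<beta>" "c = fraction S \<beta> v" "d = fraction S \<beta> w"
      unfolding carrier_Loc[OF S \<beta>] by blast
    obtain k1 k2 k3 where k: "\<forall>k\<ge>k1. \<beta> ^ k * v \<in> S \<and> g k (fraction S \<beta> v) = \<iota> (\<beta> ^ k * v)"
      "\<forall>k\<ge>k2. \<beta> ^ k * w \<in> S \<and> g k (fraction S \<beta> w) = \<iota> (\<beta> ^ k * w)"
      "\<forall>k\<ge>k3. \<beta> ^ k * (v + w) \<in> S \<and> g k (fraction S \<beta> (v + w)) = \<iota> (\<beta> ^ k * (v + w))"
      using gev[OF vw(1)] gev[OF vw(2)] gev[OF is_subringD(3)[OF is_subring_fractions[OF S \<beta>] vw(1,2)]] by blast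
    have "f x (c \<oplus>\<^bsub>?L\<^esub> d) k = f x c k \<oplus>\<^bsub>M\<^esub> f x d k" if "k \<ge> max k1 (max k2 k3)" for k
      using that k M.smult_l_distr[of "\<iota> (\<beta> ^ k * v)" "\<iota> (\<beta> ^ k * w)" x] x
      by (simp add: f_def vw add_Loc[OF S \<beta>] distrib_left)
    then show "f x (c \<oplus>\<^bsub>?L\<^esub> d) \<otimes>\<^bsub>H\<^esub> inv\<^bsub>H\<^esub> f x c \<otimes>\<^bsub>H\<^esub> inv\<^bsub>H\<^esub> f x d \<in> J"
      by (intro three fH[OF x]) blast
  next
    fix x y c assume xy: "x \<in> carrier M" "y \<in> carrier M" and "c \<in> carrier ?L"
    have "f (x \<oplus>\<^bsub>M\<^esub> y) c k = f x c k \<oplus>\<^bsub>M\<^esub> f y c k" for k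
      unfolding f_def using xy gS by (intro M.smult_r_distr) simp_all
    then show "f (x \<oplus>\<^bsub>M\<^esub> y) c \<otimes>\<^bsub>H\<^esub> inv\<^bsub>H\<^esub> f x c \<otimes>\<^bsub>H\<^esub> inv\<^bsub>H\<^esub> f y c \<in> J"
      using xy by (intro three fH) auto
  next
    fix b x c assume b: "b \<in> carrier (ring_copy S)" and x: "x \<in> carrier M" and "c \<in> carrier ?L"
    then obtain v a where v: "v \<in> fractions S \<beta>" "c = fraction S \<beta> v" and a: "a \<in> S" "b = \<iota> a"
      unfolding carrier_Loc[OF S \<beta>] by auto
    have av: "a * v \<in> fractions S \<beta>"
      using is_subringD(4)[OF is_subring_fractions[OF S \<beta>] mem_fractions[OF S \<beta> a(1)] v(1)] .
    have fc: "?f b \<otimes>\<^bsub>?L\<^esub> c = fraction S \<beta> (a * v)"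
      using a v by (simp add: frac_one[OF S \<beta>] mult_Loc[OF S \<beta>] mem_fractions[OF S \<beta>])
    obtain k1 k2 where k: "\<forall>k\<ge>k1. \<beta> ^ k * v \<in> S \<and> g k (fraction S \<beta> v) = \<iota> (\<beta> ^ k * v)"
      "\<forall>k\<ge>k2. \<beta> ^ k * (a * v) \<in> S \<and> g k (fraction S \<beta> (a * v)) = \<iota> (\<beta> ^ k * (a * v))"
      using gev[OF v(1)] gev[OF av] by blast
    have "f (b \<odot>\<^bsub>M\<^esub> x) c k = f x (?f b \<otimes>\<^bsub>?L\<^esub> c) k" if "k \<ge> max k1 k2" for k
      unfolding fc using that k x a M.smult_assoc1[of "\<iota> (\<beta> ^ k * v)" "\<iota> a" x]
      by (simp add: f_def v mult_ac)
    then have "\<exists>k0. \<forall>k\<ge>k0. f (b \<odot>\<^bsub>M\<^esub> x) c k = f x (?f b \<otimes>\<^bsub>?L\<^esub> c) k" by blast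
    then show "f (b \<odot>\<^bsub>M\<^esub> x) c \<otimes>\<^bsub>H\<^esub> inv\<^bsub>H\<^esub> f x (?f b \<otimes>\<^bsub>?L\<^esub> c) \<in> J"
      using b x by (intro two fH M.smult_closed)
  qed (use fH in auto)
  have one: "\<one>\<^bsub>?L\<^esub> \<in> carrier ?L" by simp
  have "frag_of (m, \<one>\<^bsub>?L\<^esub>) \<in> E.N"
    using E.tens_eq_zero[OF m one] zero by blast
  then have "\<Phi> (frag_of (m, \<one>\<^bsub>?L\<^esub>)) \<in> J" using ker by simp
  then have "f m \<one>\<^bsub>?L\<^esub> \<in> J" using \<Phi>[OF m one] by simp
  then obtain k0 where k0: "\<forall>k\<ge>k0. f m \<one>\<^bsub>?L\<^esub> k = \<zero>\<^bsub>M\<^esub>" by (auto simp: J_def)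
  have "1 \<in> fractions S \<beta>" by (rule mem_fractions[OF S \<beta> cl(1)])
  from j[OF this] have "f m \<one>\<^bsub>?L\<^esub> k = \<iota> (\<beta> ^ k) \<odot>\<^bsub>M\<^esub> m" for k
    using cl(7)[OF \<beta>(1)] by (simp add: f_def g_def one_zero_Loc[OF S \<beta>])
  then show ?thesis using k0 by auto
qed

text \<open>A locally free module over a domain is torsion free.  On a free localization \<open>M\<^sub>\<beta>\<close>, each coordinate
  function composed with \<open>M \<rightarrow> M\<^sub>\<beta>\<close> takes values in \<open>S[1/\<beta>] \<subseteq> K\<close> and hence factors through \<open>M \<otimes> K\<close>.  If \<open>m\<close>
  dies in \<open>M \<otimes> K\<close>, its coordinates are zero, and \<open>m\<close> dies in every \<open>M\<^sub>\<beta>\<close>.\<close>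

lemma locally_free_embeds:
  fixes M :: "('u, 'm, 's) module_scheme"
  assumes S: "is_subring S" and K: "is_subring K" "S \<subseteq> K" "\<And>a b. a \<in> K \<Longrightarrow> b \<in> K \<Longrightarrow> a / b \<in> K"
    and M: "module (ring_copy S) M" and lf: "locally_free (ring_copy S) M N" and m: "m \<in> carrier M"
    and zero: "scalar_extension.tens (ring_copy S) (\<lambda>x. x) (ring_copy K) M m \<one>\<^bsub>ring_copy K\<^esub>
     = \<zero>\<^bsub>base_change (ring_copy S) (\<lambda>x. x) (ring_copy K) M\<^esub>"
  shows "m = \<zero>\<^bsub>M\<^esub>"
proof -
  interpret M: module "ring_copy S" M by (rule M)
  interpret C: cring "ring_copy K" by (rule cring_ring_copy[OF K(1)])
  have "(\<lambda>x. x) \<in> ring_hom (ring_copy S) (ring_copy K)"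
    using K(2) by (intro ring_hom_memI) auto
  then interpret E: scalar_extension "ring_copy S" "\<lambda>x. x" "ring_copy K" M
    by (intro scalar_extension.intro scalar_extension_axioms.intro C.is_cring M)
  obtain Z where Z: "finite Z" "Z \<subseteq> carrier (ring_copy S)" "Idl\<^bsub>ring_copy S\<^esub> Z = carrier (ring_copy S)"
    and free: "\<And>b. b \<in> Z \<Longrightarrow> free_of_rank (Loc S b)
        (base_change (ring_copy S) (to_loc S b)
          (Loc S b) M) N"
    using lf unfolding locally_free_def by blast
  have "\<exists>k::nat. (b [^]\<^bsub>ring_copy S\<^esub> k) \<odot>\<^bsub>M\<^esub> m = \<zero>\<^bsub>M\<^esub>" if b: "b \<in> Z" for b
  proof -
    obtain \<beta> where \<beta>: "\<beta> \<in> S" "b = \<iota> \<beta>" using b Z(2) by auto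
    show ?thesis
    proof (cases "\<beta> = 0")
      case True
      then have "(b [^]\<^bsub>ring_copy S\<^esub> (1::nat)) \<odot>\<^bsub>M\<^esub> m = \<zero>\<^bsub>M\<^esub>"
        using M.smult_l_null[OF m] by (simp add: \<beta> pow_ring_copy)
      then show ?thesis by blast
    next
      case False
      note S\<beta> = S \<beta>(1) False
      let ?L = "Loc S b"
      let ?f = "to_loc S b"
      interpret L: scalar_extension "ring_copy S" ?f ?L M
        unfolding \<beta>(2) by (rule scalar_extension_Loc[OF S\<beta> M])
      obtain j where j: "\<And>v. v \<in> fractions S \<beta> \<Longrightarrow> j (fraction S \<beta> v) = v"
        using fraction_value[OF S\<beta>] by blast
      have car: "carrier ?L = fraction S \<beta> ` fractions S \<beta>"
        unfolding \<beta>(2) by (rule carrier_Loc[OF S\<beta>])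
      have ops: "fraction S \<beta> v \<otimes>\<^bsub>?L\<^esub> fraction S \<beta> w = fraction S \<beta> (v * w)"
        "fraction S \<beta> v \<oplus>\<^bsub>?L\<^esub> fraction S \<beta> w = fraction S \<beta> (v + w)"
        if "v \<in> fractions S \<beta>" "w \<in> fractions S \<beta>" for v w
        unfolding \<beta>(2) using that by (simp_all add: mult_Loc[OF S\<beta>] add_Loc[OF S\<beta>])
      have zer: "\<zero>\<^bsub>?L\<^esub> = fraction S \<beta> 0" unfolding \<beta>(2) by (rule one_zero_Loc[OF S\<beta>])
      note Fr = is_subringD[OF is_subring_fractions[OF S\<beta>]]
      have FrK: "v \<in> K" if "v \<in> fractions S \<beta>" for v
        using that K(2) K(3) is_subringD(7)[OF K(1)] \<beta>(1) unfolding fractions_def by blast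
      have j_cl: "j c \<in> K" if "c \<in> carrier ?L" for c using that FrK by (auto simp: car j)
      have j_add: "j (c \<oplus>\<^bsub>?L\<^esub> d) = j c + j d" if "c \<in> carrier ?L" "d \<in> carrier ?L" for c d
        using that by (auto simp: car j ops Fr)
      have j_mult: "j (?f a \<otimes>\<^bsub>?L\<^esub> c) = \<kappa> a * j c" if "a \<in> carrier (ring_copy S)" "c \<in> carrier ?L" for a c
      proof -
        from that obtain a' v where *: "a = \<iota> a'" "a' \<in> S" "c = fraction S \<beta> v" "v \<in> fractions S \<beta>" by (auto simp: car)
        have "?f a = fraction S \<beta> a'" using * by (simp add: frac_one[OF S\<beta>] \<beta>(2))
        then show ?thesis using * by (simp add: ops mem_fractions[OF S\<beta>] j Fr)
      qed
      obtain e where e: "is_basis ?L L.T N e" using free[OF b] by (auto simp: free_of_rank_iff_basis)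
      obtain co where co': "L.TM.coords N e co" using L.TM.is_basis_coords[OF e] by blast
      note co = L.TM.coordsD[OF co']
      have co0: "co i (L.tens m \<one>\<^bsub>?L\<^esub>) = \<zero>\<^bsub>?L\<^esub>" if i: "i < N" for i
      proof -
        define l where "l x = j (co i (L.tens x \<one>\<^bsub>?L\<^esub>))" for x
        have l_cl: "l x \<in> K" if "x \<in> carrier M" for x unfolding l_def using that i by (intro j_cl co L.tens_closed L.C.one_closed)
        have l_add: "l (x \<oplus>\<^bsub>M\<^esub> y) = l x + l y" if "x \<in> carrier M" "y \<in> carrier M" for x y
          unfolding l_def using that i by (simp add: L.tens_add_left co j_add del: ring_copy_simps)
        have l_sm: "l (a \<odot>\<^bsub>M\<^esub> x) = \<kappa> a * l x" if "a \<in> carrier (ring_copy S)" "x \<in> carrier M" for a x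
        proof -
          have fa: "?f a \<in> carrier ?L" using L.base_closed[OF that(1)] .
          have "L.tens (a \<odot>\<^bsub>M\<^esub> x) \<one>\<^bsub>?L\<^esub> = ?f a \<odot>\<^bsub>L.T\<^esub> L.tens x \<one>\<^bsub>?L\<^esub>"
            using that fa by (subst L.tens_smult) (simp_all add: L.smult_tens del: ring_copy_simps)
          then show ?thesis using that i fa j_mult[OF that(1), of "co i (L.tens x \<one>\<^bsub>?L\<^esub>)"] co(1)[OF i, of "L.tens x \<one>\<^bsub>?L\<^esub>"]
            unfolding l_def by (simp add: co del: ring_copy_simps)
        qed
        note Kc = is_subringD[OF K(1)]
        obtain h where h: "\<And>U. U \<in> carrier E.T \<Longrightarrow> h U \<in> carrier (ring_copy K)"
          "\<And>U V. U \<in> carrier E.T \<Longrightarrow> V \<in> carrier E.T \<Longrightarrow> h (U \<oplus>\<^bsub>E.T\<^esub> V) = h U \<oplus>\<^bsub>ring_copy K\<^esub> h V"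
          "\<And>x c. x \<in> carrier M \<Longrightarrow> c \<in> carrier (ring_copy K) \<Longrightarrow> h (E.tens x c) = \<iota> (l x * \<kappa> c)"
        proof (rule E.lift_exists[OF C.is_abelian_group, of "\<lambda>x c. \<iota> (l x * \<kappa> c)"])
          show "\<iota> (l x * \<kappa> c) \<in> carrier (ring_copy K)" if "x \<in> carrier M" "c \<in> carrier (ring_copy K)" for x c
            using that l_cl by (auto intro: Kc)
        qed (auto simp: l_add l_sm algebra_simps)
        have "h \<zero>\<^bsub>E.T\<^esub> = \<zero>\<^bsub>ring_copy K\<^esub>"
          using h(2)[of "\<zero>\<^bsub>E.T\<^esub>" "\<zero>\<^bsub>E.T\<^esub>"] h(1)[of "\<zero>\<^bsub>E.T\<^esub>"]
          by (simp add: C.add.r_cancel_one' del: ring_copy_simps)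
        then have "l m = 0" using h(3)[OF m, of "\<one>\<^bsub>ring_copy K\<^esub>"] zero Kc(1) by simp
        moreover obtain v where "v \<in> fractions S \<beta>" "co i (L.tens m \<one>\<^bsub>?L\<^esub>) = fraction S \<beta> v"
          using co(1)[OF i L.tens_closed[OF m L.C.one_closed]] unfolding car by blast
        ultimately show ?thesis by (simp add: j zer l_def del: ring_copy_simps)
      qed
      have eT: "e \<in> {..<N} \<rightarrow> carrier L.T" using e by (simp add: is_basis_def)
      have "L.tens m \<one>\<^bsub>?L\<^esub> = L.TM.lincomb N e (\<lambda>i. co i (L.tens m \<one>\<^bsub>?L\<^esub>))"
        by (intro co(2) L.tens_closed L.C.one_closed m)
      also have "\<dots> = L.TM.lincomb N e (\<lambda>_. \<zero>\<^bsub>?L\<^esub>)"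
        by (rule L.TM.lincomb_cong[OF eT]) (use co0 in auto)
      also have "\<dots> = \<zero>\<^bsub>L.T\<^esub>" by (rule L.TM.lincomb_zero[OF eT])
      finally have "L.tens m \<one>\<^bsub>?L\<^esub> = \<zero>\<^bsub>L.T\<^esub>" .
      then show ?thesis using killed_by_power[OF S\<beta> M m] by (simp add: \<beta>(2) pow_ring_copy)
    qed
  qed
  then obtain k where "\<And>b. b \<in> Z \<Longrightarrow> (b [^]\<^bsub>ring_copy S\<^esub> (k b :: nat)) \<odot>\<^bsub>M\<^esub> m = \<zero>\<^bsub>M\<^esub>" by metis
  then show ?thesis using M.zero_if_killed_by_powers[OF Z m] by blast
qed

end

section \<open>Permutations acting on a field\<close>

text \<open>\<open>P\<close> plays the part of the polynomials, with fraction field \<open>'l\<close>; \<open>\<epsilon>\<close> is the specialization of the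
  invariant variable \<open>t\<close> to zero; \<open>eps_rem\<close> says that its kernel is \<open>t P\<close>.  By \<open>generated\<close>,
  \<open>P\<close> is generated by invariant elements together with the \<open>x j\<close>, so that an automorphism over
  the invariants is determined by its values on the \<open>x j\<close>.\<close>

locale perm_field =
  fixes n :: nat and act :: "(nat \<Rightarrow> nat) \<Rightarrow> 'l::field \<Rightarrow> 'l" and x :: "nat \<Rightarrow> 'l"
    and P :: "'l set" and t :: 'l and \<epsilon> :: "'l \<Rightarrow> 'l"
  assumes n4: "n \<ge> 4"
    and act_add: "\<sigma> permutes {1..n} \<Longrightarrow> act \<sigma> (a + b) = act \<sigma> a + act \<sigma> b"
    and act_mult: "\<sigma> permutes {1..n} \<Longrightarrow> act \<sigma> (a * b) = act \<sigma> a * act \<sigma> b"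
    and act_one: "\<sigma> permutes {1..n} \<Longrightarrow> act \<sigma> 1 = 1"
    and act_comp: "\<sigma> permutes {1..n} \<Longrightarrow> \<tau> permutes {1..n} \<Longrightarrow> act (\<sigma> \<circ> \<tau>) a = act \<sigma> (act \<tau> a)"
    and act_id: "act id a = a"
    and act_x: "\<sigma> permutes {1..n} \<Longrightarrow> j \<in> {1..n} \<Longrightarrow> act \<sigma> (x j) = x (\<sigma> j)"
    and x_inj: "inj_on x {1..n}"
    and P: "is_subring P"
    and act_P: "\<sigma> permutes {1..n} \<Longrightarrow> a \<in> P \<Longrightarrow> act \<sigma> a \<in> P"
    and x_P: "j \<in> {1..n} \<Longrightarrow> x j \<in> P"
    and t_P: "t \<in> P" and t_nonzero: "t \<noteq> 0"
    and act_t: "\<sigma> permutes {1..n} \<Longrightarrow> act \<sigma> t = t"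
    and eps_P: "a \<in> P \<Longrightarrow> \<epsilon> a \<in> P"
    and eps_add: "a \<in> P \<Longrightarrow> b \<in> P \<Longrightarrow> \<epsilon> (a + b) = \<epsilon> a + \<epsilon> b"
    and eps_mult: "a \<in> P \<Longrightarrow> b \<in> P \<Longrightarrow> \<epsilon> (a * b) = \<epsilon> a * \<epsilon> b"
    and eps_one: "\<epsilon> 1 = 1" and eps_t: "\<epsilon> t = 0"
    and eps_eps: "a \<in> P \<Longrightarrow> \<epsilon> (\<epsilon> a) = \<epsilon> a"
    and eps_x: "j \<in> {1..n} \<Longrightarrow> \<epsilon> (x j) = x j"
    and eps_act: "\<sigma> permutes {1..n} \<Longrightarrow> a \<in> P \<Longrightarrow> \<epsilon> (act \<sigma> a) = act \<sigma> (\<epsilon> a)"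
    and eps_rem: "a \<in> P \<Longrightarrow> \<exists>b\<in>P. a = \<epsilon> a + t * b"
    and quotients: "\<exists>p\<in>P. \<exists>q\<in>P. q \<noteq> 0 \<and> a = p / q"
    and generated: "is_subring E \<Longrightarrow> (\<And>a. a \<in> P \<Longrightarrow> \<forall>\<sigma>. \<sigma> permutes {1..n} \<longrightarrow> act \<sigma> a = a \<Longrightarrow> a \<in> E)
      \<Longrightarrow> (\<And>j. j \<in> {1..n} \<Longrightarrow> x j \<in> E) \<Longrightarrow> P \<subseteq> E"
    and two_nonzero: "(2::'l) \<noteq> 0"
begin

declare One_nat_def [simp del]

abbreviation "Sn \<equiv> {\<sigma>. \<sigma> permutes {1..n}}"

lemma finite_Sn: "finite Sn"
  by (rule finite_permutations) simp

lemma act_zero [simp]: "\<sigma> permutes {1..n} \<Longrightarrow> act \<sigma> 0 = 0"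
  using act_add[of \<sigma> 0 0] by (metis add_cancel_right_right)

lemma act_uminus: "\<sigma> permutes {1..n} \<Longrightarrow> act \<sigma> (- a) = - act \<sigma> a"
  using act_add[of \<sigma> a "- a"] by (simp add: eq_neg_iff_add_eq_0 add.commute)

lemma act_diff: "\<sigma> permutes {1..n} \<Longrightarrow> act \<sigma> (a - b) = act \<sigma> a - act \<sigma> b"
  using act_add[of \<sigma> a "- b"] by (simp add: act_uminus)

lemma act_power: "\<sigma> permutes {1..n} \<Longrightarrow> act \<sigma> (a ^ k) = act \<sigma> a ^ k"
  by (induction k) (simp_all add: act_one act_mult)

lemma act_sum: "\<sigma> permutes {1..n} \<Longrightarrow> act \<sigma> (sum g I) = (\<Sum>i\<in>I. act \<sigma> (g i))"
  by (induction I rule: infinite_finite_induct) (simp_all add: act_add)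

lemma act_inverse: assumes "\<sigma> permutes {1..n}" shows "act \<sigma> (inverse a) = inverse (act \<sigma> a)"
proof (cases "a = 0")
  case False
  then have "act \<sigma> a * act \<sigma> (inverse a) = 1" using assms by (simp add: act_mult[symmetric] act_one)
  then show ?thesis by (metis inverse_unique)
qed (simp add: assms)

lemma act_inv_into: "\<sigma> permutes {1..n} \<Longrightarrow> act (inv_into UNIV \<sigma>) (act \<sigma> a) = a" "\<sigma> permutes {1..n} \<Longrightarrow> act \<sigma> (act (inv_into UNIV \<sigma>) a) = a"
  using act_comp[of "inv_into UNIV \<sigma>" \<sigma> a] act_comp[of \<sigma> "inv_into UNIV \<sigma>" a] permutes_inv[of \<sigma> "{1..n}"]
    permutes_inv_o[of \<sigma> "{1..n}"] act_id by simp_all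

lemma act_inj: "\<sigma> permutes {1..n} \<Longrightarrow> act \<sigma> a = act \<sigma> b \<longleftrightarrow> a = b"
  using act_inv_into(1) by metis

definition K :: "'l set" where "K = {a. \<forall>\<sigma>. \<sigma> permutes {1..n} \<longrightarrow> act \<sigma> a = a}"

lemma K_act: "a \<in> K \<Longrightarrow> \<sigma> permutes {1..n} \<Longrightarrow> act \<sigma> a = a" by (simp add: K_def)

lemma K_subring: "is_subring K"
  unfolding is_subring_def K_def by (auto simp: act_add act_mult act_one act_uminus)

lemma K_inverse: "a \<in> K \<Longrightarrow> inverse a \<in> K"
  unfolding K_def by (simp add: act_inverse)

lemma K_divide: "a \<in> K \<Longrightarrow> b \<in> K \<Longrightarrow> a / b \<in> K"
  using is_subringD(4)[OF K_subring, of a "inverse b"] K_inverse by (simp add: divide_inverse)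

definition orbit :: "'l \<Rightarrow> 'l set" where "orbit y = (\<lambda>\<sigma>. act \<sigma> y) ` Sn"

lemma finite_orbit: "finite (orbit y)" unfolding orbit_def using finite_Sn by simp

lemma orbit_self: "y \<in> orbit y"
  unfolding orbit_def using act_id[of y] permutes_id[of "{1..n}"] by (auto intro!: image_eqI[of _ _ id])

lemma act_orbit: assumes \<sigma>: "\<sigma> permutes {1..n}" shows "act \<sigma> ` orbit y = orbit y"
proof -
  have sub: "act \<tau> ` orbit y \<subseteq> orbit y" if "\<tau> permutes {1..n}" for \<tau>
  proof (clarify, unfold orbit_def, clarify)
    fix \<rho> assume "\<rho> permutes {1..n}"
    then show "act \<tau> (act \<rho> y) \<in> (\<lambda>\<sigma>. act \<sigma> y) ` Sn"
      using act_comp[OF that] permutes_compose[OF _ that] by (metis image_eqI mem_Collect_eq)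
  qed
  have "z \<in> act \<sigma> ` orbit y" if "z \<in> orbit y" for z
  proof -
    have "act (inv_into UNIV \<sigma>) z \<in> orbit y" using sub[OF permutes_inv[OF \<sigma>]] that by auto
    then show ?thesis using act_inv_into(2)[OF \<sigma>, of z] by (metis imageI)
  qed
  with sub[OF \<sigma>] show ?thesis by blast
qed

definition root_poly :: "'l set \<Rightarrow> 'l poly" where "root_poly Z = (\<Prod>z\<in>Z. [:- z, 1:])"

text \<open>Hence the coefficients of the polynomial of an orbit are invariant.\<close>

lemma act_root_poly:
  assumes "finite Z" "\<sigma> permutes {1..n}"
  shows "act \<sigma> (Polynomial.coeff (root_poly Z) k) = Polynomial.coeff (root_poly (act \<sigma> ` Z)) k"
  using assms(1)
proof (induction Z arbitrary: k)
  case empty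
  then show ?case by (simp add: root_poly_def Polynomial.coeff_1 act_one assms(2))
next
  case (insert z Z)
  have "act \<sigma> z \<notin> act \<sigma> ` Z" using insert(2) act_inj[OF assms(2)] by auto
  then have "root_poly (act \<sigma> ` insert z Z) = [:- act \<sigma> z, 1:] * root_poly (act \<sigma> ` Z)"
    using insert(1) by (simp add: root_poly_def)
  moreover have "root_poly (insert z Z) = [:- z, 1:] * root_poly Z"
    using insert(1,2) by (simp add: root_poly_def)
  ultimately show ?case
    by (cases k) (simp_all add: insert.IH act_add act_mult act_uminus act_diff assms(2))
qed

lemma root_poly_orbit_K: "Polynomial.coeff (root_poly (orbit y)) k \<in> K"
  unfolding K_def using act_root_poly[OF finite_orbit] act_orbit by auto

lemma poly_root_poly: "finite Z \<Longrightarrow> poly (root_poly Z) a = 0 \<longleftrightarrow> a \<in> Z"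
  by (simp add: root_poly_def poly_prod)

lemma root_poly_degree: "finite Z \<Longrightarrow> Polynomial.degree (root_poly Z) = card Z"
  unfolding root_poly_def by (subst degree_prod_sum_eq) auto

lemma root_poly_nonzero: "finite Z \<Longrightarrow> root_poly Z \<noteq> 0"
  unfolding root_poly_def by (simp add: prod_zero_iff)

lemma root_poly_monic: "finite Z \<Longrightarrow> Polynomial.coeff (root_poly Z) (card Z) = 1"
  using root_poly_degree[of Z] Polynomial.lead_coeff_prod[of "\<lambda>z. [:- z, 1:]" Z]
  by (simp add: root_poly_def)

lemma act_poly:
  assumes "\<And>k. Polynomial.coeff p k \<in> K" "\<sigma> permutes {1..n}"
  shows "act \<sigma> (poly p a) = poly p (act \<sigma> a)"
  by (simp add: poly_altdef act_sum act_mult act_power assms K_act)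

lemma is_subring_poly: "is_subring E \<Longrightarrow> (\<And>k. Polynomial.coeff p k \<in> E) \<Longrightarrow> a \<in> E \<Longrightarrow> poly p a \<in> E"
  by (simp add: poly_altdef is_subring_sum is_subringD)

text \<open>An element \<open>y\<close> is a root of the polynomial of its orbit, whose coefficients are in \<open>K\<close> and whose
  constant term is not zero if \<open>y\<close> is not; solving for \<open>1 / y\<close> gives a polynomial in \<open>y\<close>.\<close>

lemma inverse_in_intermediate:
  assumes E: "is_subring E" "K \<subseteq> E" and y: "y \<in> E"
  shows "inverse y \<in> E"
proof (cases "y = 0")
  case False
  let ?q = "root_poly (orbit y)"
  obtain c q where q: "?q = pCons c q" by (cases ?q) 
  have "0 \<notin> orbit y" using False act_inj[of _ y 0] by (auto simp: orbit_def)
  then have c: "c \<noteq> 0" using poly_root_poly[OF finite_orbit, of y 0] by (simp add: q)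
  have "poly ?q y = 0" using orbit_self poly_root_poly[OF finite_orbit] by blast
  then have "y * poly q y = - c" by (simp add: q eq_neg_iff_add_eq_0 add.commute)
  then have "inverse y = - (poly q y * inverse c)"
    using False c by (simp add: field_simps)
  moreover have "Polynomial.coeff q k \<in> K" for k
    using root_poly_orbit_K[of y "Suc k"] by (simp add: q)
  moreover have "c \<in> K" using root_poly_orbit_K[of y 0] by (simp add: q)
  ultimately show ?thesis
    using is_subring_poly[OF E(1) _ y, of q] E(2) K_inverse[of c] is_subringD(4,5)[OF E(1)]
    by (metis subsetD)
qed (use is_subringD(2)[OF E(1)] in simp)

text \<open>An intermediate ring containing the roots contains \<open>P\<close>, and its quotients by the previous lemma.\<close>

lemma field_generated:
  assumes E: "is_subring E" "K \<subseteq> E" and "\<And>j. j \<in> {1..n} \<Longrightarrow> x j \<in> E"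
  shows "E = UNIV"
proof -
  have "P \<subseteq> E" using assms by (intro generated) (auto simp: K_def)
  have "a \<in> E" for a
  proof -
    obtain p q where "p \<in> P" "q \<in> P" "a = p * inverse q" using quotients[of a] by (auto simp: divide_inverse)
    then show ?thesis
      using \<open>P \<subseteq> E\<close> inverse_in_intermediate[OF E] is_subringD(4)[OF E(1)] by blast
  qed
  then show ?thesis by auto
qed

lemma orbit_x: assumes j: "j \<in> {1..n}" shows "orbit (x j) = x ` {1..n}"
proof
  show "orbit (x j) \<subseteq> x ` {1..n}"
  proof (unfold orbit_def, clarify)
    fix \<sigma> assume \<sigma>: "\<sigma> permutes {1..n}"
    then have "\<sigma> j \<in> {1..n}" using j by (simp only: permutes_in_image)
    then show "act \<sigma> (x j) \<in> x ` {1..n}" unfolding act_x[OF \<sigma> j] by (rule imageI)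
  qed
  show "x ` {1..n} \<subseteq> orbit (x j)"
  proof (clarify)
    fix i assume i: "i \<in> {1..n}"
    have p: "Transposition.transpose j i permutes {1..n}" by (rule permutes_swap_id[OF j i])
    have "act (Transposition.transpose j i) (x j) = x i" using act_x[OF p j] by simp
    with p show "x i \<in> orbit (x j)" unfolding orbit_def by (metis image_eqI mem_Collect_eq)
  qed
qed

lemma card_x: "card (x ` {1..n}) = n"
  using x_inj by (simp add: card_image)


section \<open>The span of the powers of \<open>x 1\<close>\<close>

definition min_poly :: "'l poly" where "min_poly = root_poly (x ` {1..n})"

lemma min_poly_coeff_K: "Polynomial.coeff min_poly k \<in> K"
  using root_poly_orbit_K[of "x 1" k] orbit_x[of 1] n4 by (simp add: min_poly_def)

lemma min_poly_root: "poly min_poly a = 0 \<longleftrightarrow> a \<in> x ` {1..n}"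
  unfolding min_poly_def by (rule poly_root_poly) simp

lemma min_poly_degree: "Polynomial.degree min_poly = n" "Polynomial.coeff min_poly n = 1"
  using root_poly_degree[of "x ` {1..n}"] root_poly_monic[of "x ` {1..n}"] card_x by (simp_all add: min_poly_def)

lemma min_poly_coeff_P: "Polynomial.coeff min_poly k \<in> P"
proof -
  have "Polynomial.coeff (root_poly Z) k \<in> P" if "finite Z" "Z \<subseteq> P" for Z
    using that
  proof (induction Z arbitrary: k)
    case empty then show ?case by (simp add: root_poly_def Polynomial.coeff_1 is_subringD[OF P])
  next
    case (insert z Z)
    have "root_poly (insert z Z) = [:- z, 1:] * root_poly Z"
      using insert(1,2) by (simp add: root_poly_def)
    then show ?case using insert by (cases k) (simp_all add: is_subringD[OF P])
  qed
  moreover have "x ` {1..n} \<subseteq> P" using x_P by blast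
  ultimately show ?thesis unfolding min_poly_def by simp
qed

lemma one_in: "1 \<in> {1..n}" using n4 by simp

text \<open>For a ring \<open>S\<close> that contains the coefficients of the minimal polynomial this is \<open>S[x 1]\<close>.
  With another product, the same set serves as the special fibre.\<close>

definition spanned :: "'l set \<Rightarrow> 'l set"
  where "spanned S = {\<Sum>a<n. c a * x 1 ^ a | c. \<forall>a. c a \<in> S}"

lemma spannedI: "(\<And>a. c a \<in> S) \<Longrightarrow> (\<Sum>a<n. c a * x 1 ^ a) \<in> spanned S"
  unfolding spanned_def by blast

lemma spannedE:
  assumes "y \<in> spanned S" obtains c where "\<And>a. c a \<in> S" "y = (\<Sum>a<n. c a * x 1 ^ a)"
  using assms unfolding spanned_def by blast

lemma x1_pow_n: "x 1 ^ n = - (\<Sum>a<n. Polynomial.coeff min_poly a * x 1 ^ a)"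
proof -
  have "poly min_poly (x 1) = 0" using min_poly_root one_in by blast
  then have "(\<Sum>a<Suc n. Polynomial.coeff min_poly a * x 1 ^ a) = 0"
    by (simp add: poly_altdef min_poly_degree lessThan_Suc_atMost)
  then show ?thesis by (simp add: min_poly_degree eq_neg_iff_add_eq_0 add.commute)
qed

lemma spanned_x_power:
  assumes S: "is_subring S" "\<And>k. Polynomial.coeff min_poly k \<in> S" and y: "y \<in> spanned S"
  shows "x 1 ^ k * y \<in> spanned S"
proof (induction k)
  case (Suc k)
  from Suc obtain c where c: "\<And>a. c a \<in> S" "x 1 ^ k * y = (\<Sum>a<n. c a * x 1 ^ a)" by (rule spannedE) blast
  obtain m where m: "n = Suc m" using n4 by (cases n) auto
  let ?c = "\<lambda>a. (if a = 0 then 0 else c (a - 1)) - c m * Polynomial.coeff min_poly a"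
  have "x 1 ^ Suc k * y = x 1 * (\<Sum>a<n. c a * x 1 ^ a)" by (simp add: c(2)[symmetric] mult.assoc)
  also have "\<dots> = (\<Sum>a<Suc m. c a * x 1 ^ Suc a)"
    unfolding m by (simp only: sum_distrib_left power_Suc mult.left_commute)
  also have "\<dots> = (\<Sum>a<m. c a * x 1 ^ Suc a) + c m * x 1 ^ n" by (simp add: m)
  also have "(\<Sum>a<m. c a * x 1 ^ Suc a) = (\<Sum>a<n. (if a = 0 then 0 else c (a - 1)) * x 1 ^ a)"
    unfolding m by (subst sum.lessThan_Suc_shift) simp
  also have "c m * x 1 ^ n = - (\<Sum>a<n. c m * Polynomial.coeff min_poly a * x 1 ^ a)"
    by (simp add: x1_pow_n sum_distrib_left mult.assoc)
  finally have "x 1 ^ Suc k * y = (\<Sum>a<n. ?c a * x 1 ^ a)"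
    by (simp add: sum_subtractf left_diff_distrib)
  moreover have "?c a \<in> S" for a using S c by (auto intro!: is_subringD)
  ultimately show ?case using spannedI[of ?c S] by metis
qed (use y in simp)

lemma spanned_add: assumes "is_subring S" "y \<in> spanned S" "z \<in> spanned S" shows "y + z \<in> spanned S"
proof -
  obtain c d where "\<And>a. c a \<in> S" "y = (\<Sum>a<n. c a * x 1 ^ a)" "\<And>a. d a \<in> S" "z = (\<Sum>a<n. d a * x 1 ^ a)"
    using assms(2,3) by (auto elim!: spannedE)
  then show ?thesis using spannedI[of "\<lambda>a. c a + d a" S] is_subringD(3)[OF assms(1)]
    by (simp add: distrib_right sum.distrib)
qed

lemma spanned_smult: assumes "is_subring S" "b \<in> S" "y \<in> spanned S" shows "b * y \<in> spanned S"
proof -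
  obtain c where "\<And>a. c a \<in> S" "y = (\<Sum>a<n. c a * x 1 ^ a)"
    using assms(3) by (auto elim!: spannedE)
  then show ?thesis using spannedI[of "\<lambda>a. b * c a" S] is_subringD(4)[OF assms(1,2)]
    by (simp add: sum_distrib_left mult.assoc)
qed

lemma spanned_sum: "is_subring S \<Longrightarrow> (\<And>i. i \<in> I \<Longrightarrow> g i \<in> spanned S) \<Longrightarrow> sum g I \<in> spanned S"
proof (induction I rule: infinite_finite_induct)
  case (insert i I) then show ?case by (simp add: spanned_add)
qed (use spannedI[of "\<lambda>_. 0" S] is_subringD(2)[of S] in simp_all)

lemma spanned_base: assumes "is_subring S" "b \<in> S" shows "b \<in> spanned S"
proof -
  have "(\<Sum>a<n. (if a = 0 then b else 0) * x 1 ^ a) = b"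
    using n4 by (simp add: if_distrib[of "\<lambda>c. c * _"] sum.delta cong: if_cong)
  then show ?thesis using spannedI[of "\<lambda>a. if a = 0 then b else 0" S] is_subringD(2)[OF assms(1)] assms(2) by auto
qed

lemma spanned_subring:
  assumes S: "is_subring S" "\<And>k. Polynomial.coeff min_poly k \<in> S"
  shows "is_subring (spanned S)"
  unfolding is_subring_def
proof (intro conjI ballI)
  show "1 \<in> spanned S" by (intro spanned_base S is_subringD)
  fix y z assume y: "y \<in> spanned S" and z: "z \<in> spanned S"
  show "y + z \<in> spanned S" by (rule spanned_add[OF S(1) y z])
  obtain c where c: "\<And>a. c a \<in> S" "y = (\<Sum>a<n. c a * x 1 ^ a)" using y by (auto elim: spannedE)
  have "y * z = (\<Sum>a<n. c a * (x 1 ^ a * z))" by (simp add: c sum_distrib_right mult.assoc)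
  also have "\<dots> \<in> spanned S"
    by (intro spanned_sum spanned_smult S c spanned_x_power z)
  finally show "y * z \<in> spanned S" .
next
  fix y assume y: "y \<in> spanned S"
  have "- 1 \<in> S" by (intro is_subringD S)
  then show "- y \<in> spanned S" using spanned_smult[OF S(1) _ y, of "- 1"] by simp
qed

lemma spanned_x: assumes "is_subring S" "a < n" shows "x 1 ^ a \<in> spanned S"
proof -
  have "(\<Sum>b<n. (if b = a then 1 else 0) * x 1 ^ b) = x 1 ^ a"
    using assms(2) by (simp add: if_distrib[of "\<lambda>c. c * _"] sum.delta cong: if_cong)
  then show ?thesis using spannedI[of "\<lambda>b. if b = a then 1 else 0" S] is_subringD(1,2)[OF assms(1)] by auto
qed

text \<open>A polynomial over \<open>K\<close> of degree less than \<open>n\<close> that vanishes at \<open>x 1\<close> vanishes at its \<open>n\<close> conjugates.\<close>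

lemma spanned_unique:
  assumes c: "\<And>a. a < n \<Longrightarrow> c a \<in> K" and d: "\<And>a. a < n \<Longrightarrow> d a \<in> K"
    and eq: "(\<Sum>a<n. c a * x 1 ^ a) = (\<Sum>a<n. d a * x 1 ^ a)" and a: "a < n"
  shows "c a = d a"
proof -
  let ?p = "\<Sum>a<n. Polynomial.monom (c a - d a) a"
  have co: "Polynomial.coeff ?p k = (if k < n then c k - d k else 0)" for k
    by (simp add: Polynomial.coeff_sum)
  have K: "Polynomial.coeff ?p k \<in> K" for k
    using c d by (simp add: co is_subringD[OF K_subring])
  have "poly ?p (x 1) = 0"
    using eq by (simp add: poly_sum poly_monom left_diff_distrib sum_subtractf)
  then have "poly ?p z = 0" if "z \<in> orbit (x 1)" for z
    using that act_poly[OF K, of _ "x 1"] by (auto simp: orbit_def)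
  then have sub: "x ` {1..n} \<subseteq> {z. poly ?p z = 0}" using orbit_x[OF one_in] by auto
  have "?p = 0"
  proof (rule ccontr)
    assume nz: "?p \<noteq> 0"
    have "n \<le> card {z. poly ?p z = 0}"
      using card_mono[OF poly_roots_finite[OF nz] sub] by (simp add: card_x)
    also have "\<dots> \<le> Polynomial.degree ?p" by (rule card_poly_roots_bound[OF nz])
    finally have "Polynomial.coeff ?p (Polynomial.degree ?p) = 0" by (simp add: co)
    then show False using nz by simp
  qed
  then show ?thesis using co[of a] a by simp
qed

end

section \<open>Galois theory of the copies\<close>

context carrier_copy begin

text \<open>Over a ring structure polynomials are lists of coefficients, the leading one first.  Roots are
  counted for the corresponding polynomials over the field \<open>'l\<close>.\<close>

definition pol :: "'u list \<Rightarrow> 'l poly" where "pol p = Poly (rev (map \<kappa> p))"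

lemma pol_Nil [simp]: "pol [] = 0" by (simp add: pol_def)

lemma pol_Cons: "pol (c # p) = pol p + Polynomial.monom (\<kappa> c) (length p)"
proof -
  show ?thesis by (simp add: pol_def Poly_append smult_monom)
qed

lemma coeff_pol: "Polynomial.coeff (pol p) k = (if k < length p then \<kappa> (rev p ! k) else 0)"
  by (simp add: pol_def nth_default_def rev_map)

lemma degree_pol: "p \<noteq> [] \<Longrightarrow> \<kappa> (hd p) \<noteq> 0 \<Longrightarrow> Polynomial.degree (pol p) = length p - 1 \<and> pol p \<noteq> 0"
proof -
  assume p: "p \<noteq> []" "\<kappa> (hd p) \<noteq> 0"
  have "rev p ! (length p - 1) = hd p" using p(1) by (simp add: rev_nth hd_conv_nth)
  then have nz: "Polynomial.coeff (pol p) (length p - 1) \<noteq> 0" using p by (simp add: coeff_pol)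
  have "Polynomial.degree (pol p) \<le> length p - 1" by (rule degree_le) (auto simp: coeff_pol)
  with le_degree[OF nz] nz show ?thesis by auto
qed

lemma coeff_pol_in: "set p \<subseteq> \<iota> ` S \<Longrightarrow> 0 \<in> S \<Longrightarrow> Polynomial.coeff (pol p) k \<in> S"
proof -
  assume p: "set p \<subseteq> \<iota> ` S" "0 \<in> S"
  have "rev p ! k \<in> \<iota> ` S" if "k < length p"
    using p(1) that nth_mem[of k "rev p"] by auto
  then show ?thesis using p(2) by (auto simp: coeff_pol)
qed

definition list_of :: "'l poly \<Rightarrow> 'u list" where "list_of q = map \<iota> (rev (coeffs q))"

lemma pol_list_of [simp]: "pol (list_of q) = q"
proof -
  have "map (\<lambda>x. x) (coeffs q) = coeffs q" by simp
  then show ?thesis by (simp add: pol_def list_of_def rev_map comp_def)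
qed

lemma eval_copy:
  assumes "ring Q" and "\<And>x y. x \<otimes>\<^bsub>Q\<^esub> y = \<iota> (\<kappa> x * \<kappa> y)" "\<And>x y. x \<oplus>\<^bsub>Q\<^esub> y = \<iota> (\<kappa> x + \<kappa> y)"
    and "\<one>\<^bsub>Q\<^esub> = \<iota> 1" "\<zero>\<^bsub>Q\<^esub> = \<iota> 0"
  shows "ring.eval Q p (\<iota> a) = \<iota> (poly (pol p) a)"
proof -
  have pow: "\<iota> a [^]\<^bsub>Q\<^esub> (k::nat) = \<iota> (a ^ k)" for k
    by (induction k) (simp_all add: nat_pow_def assms(2,4) mult.commute)
  show ?thesis
    by (induction p)
       (simp_all add: ring.eval.simps[OF assms(1)] assms(2-) pow pol_Cons poly_monom add.commute)
qed

lemma field_module_copy: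
  assumes S: "is_subring S" and inv: "\<And>a. a \<in> S \<Longrightarrow> inverse a \<in> S"
  shows "field (module_copy (*) S)" "field (ring_copy S)"
proof -
  interpret A: cring "module_copy (*) S" by (rule cring_of_image[OF S]) simp_all
  show "field (module_copy (*) S)"
  proof (rule A.cring_fieldI2)
    fix a assume "a \<in> carrier (module_copy (*) S)" "a \<noteq> \<zero>\<^bsub>module_copy (*) S\<^esub>"
    then show "\<exists>b\<in>carrier (module_copy (*) S). a \<otimes>\<^bsub>module_copy (*) S\<^esub> b = \<one>\<^bsub>module_copy (*) S\<^esub>"
      using inv by (auto intro!: bexI[of _ "inverse _"])
  qed simp
  interpret R: cring "ring_copy S" by (rule cring_of_image[OF S]) simp_all
  show "field (ring_copy S)"
  proof (rule R.cring_fieldI2)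
    fix a assume "a \<in> carrier (ring_copy S)" "a \<noteq> \<zero>\<^bsub>ring_copy S\<^esub>"
    then show "\<exists>b\<in>carrier (ring_copy S). a \<otimes>\<^bsub>ring_copy S\<^esub> b = \<one>\<^bsub>ring_copy S\<^esub>"
      using inv by (auto intro!: bexI[of _ "inverse _"])
  qed simp
qed

lemma base_image_copy: "base_image (ring_copy S) (module_copy m E) = \<iota> ` S"
  by (force simp: base_image_def)

lemma module_copy_carrier: "(module_copy m S)\<lparr>carrier := \<iota> ` E\<rparr> = module_copy m E"
  by (simp add: module_copy_def)

lemma uminus_module_copy:
  assumes "is_subring S" "a \<in> S" shows "\<ominus>\<^bsub>module_copy (*) S\<^esub> \<iota> a = \<iota> (- a)"
proof -
  interpret A: cring "module_copy (*) S" by (rule cring_of_image[OF assms(1)]) simp_all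
  show ?thesis using assms is_subringD(5)[OF assms(1,2)] by (intro A.minus_equality) simp_all
qed

lemma subring_module_copy:
  assumes "is_subring S" "is_subring E" "S \<subseteq> E"
  shows "subring (\<iota> ` S) (module_copy (*) E)"
proof -
  interpret A: cring "module_copy (*) E" by (rule cring_of_image[OF assms(2)]) simp_all
  show ?thesis
    by (rule A.subringI)
       (use assms in \<open>auto simp: uminus_module_copy is_subringD subset_iff\<close>)
qed

end

text \<open>On the type \<open>'u\<close>, the rings \<open>K\<close>, \<open>K(x 1)\<close> and \<open>L\<close> are called \<open>BK\<close>, \<open>AK\<close> and \<open>LL\<close>.  The base ring of
  invariant polynomials and its order are \<open>BB\<close> and \<open>AA\<close>, with special fibres \<open>B0\<close> and \<open>A0\<close>.\<close>

locale galois_copy = perm_field n act x P t \<epsilon> + carrier_copy \<iota>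
  for n :: nat and act :: "(nat \<Rightarrow> nat) \<Rightarrow> 'l::field \<Rightarrow> 'l" and x :: "nat \<Rightarrow> 'l"
    and P :: "'l set" and t :: 'l and \<epsilon> :: "'l \<Rightarrow> 'l" and \<iota> :: "'l \<Rightarrow> 'u"
begin

abbreviation "copy E \<equiv> module_copy (*) E"
abbreviation "BK \<equiv> ring_copy K"

context
  fixes E :: "'l set"
  assumes E: "is_subring E" "K \<subseteq> E"
begin

lemma field_copy: "field (copy E)"
  by (rule field_module_copy[OF E(1) inverse_in_intermediate[OF E]])

lemma field_BK: "field BK"
  by (rule field_module_copy[OF K_subring K_inverse])

lemma subfield_copy: "subfield (\<iota> ` K) (copy E)"
proof -
  interpret A: field "copy E" by (rule field_copy)
  have sub: "subring (\<iota> ` K) (copy E)" by (rule subring_module_copy[OF K_subring E])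
  have "field ((copy E)\<lparr>carrier := \<iota> ` K\<rparr>)"
    unfolding module_copy_carrier by (rule field_module_copy[OF K_subring K_inverse])
  then show ?thesis using A.subfield_iff(1)[of "\<iota> ` K"] E(2) by auto
qed

lemma eval_copy_E: "ring.eval (copy E) p (\<iota> a) = \<iota> (poly (pol p) a)"
proof -
  interpret A: field "copy E" by (rule field_copy)
  show ?thesis by (rule eval_copy) (simp_all add: A.ring_axioms)
qed

lemma list_of_closed:
  assumes "q \<noteq> 0" "\<And>k. Polynomial.coeff q k \<in> K"
  shows "list_of q \<in> carrier (univ_poly (copy E) (\<iota> ` K))" "list_of q \<noteq> []" "length (list_of q) - 1 = Polynomial.degree q"
proof -
  have ne: "coeffs q \<noteq> []" using assms(1) by simp
  have "hd (list_of q) = \<iota> (last (coeffs q))" using ne by (simp add: list_of_def hd_map hd_rev)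
  moreover have "last (coeffs q) \<noteq> 0" using assms(1) by (simp add: last_coeffs_eq_coeff_degree)
  moreover have "set (list_of q) \<subseteq> \<iota> ` K"
    using assms(2) range_coeff[of q] by (auto simp: list_of_def) (metis imageI insertCI range_eqI image_iff)
  ultimately show "list_of q \<in> carrier (univ_poly (copy E) (\<iota> ` K))"
    by (simp add: univ_poly_def polynomial_def)
  show "list_of q \<noteq> []" using ne by (simp add: list_of_def)
  show "length (list_of q) - 1 = Polynomial.degree q" by (simp add: list_of_def length_coeffs_degree assms(1))
qed

lemma algebraic_copy:
  assumes "y \<in> E" shows "(ring.algebraic (copy E) over (\<iota> ` K)) (\<iota> y)"
proof -
  interpret A: field "copy E" by (rule field_copy)
  let ?q = "root_poly (orbit y)"
  have nz: "?q \<noteq> 0" by (rule root_poly_nonzero[OF finite_orbit])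
  show ?thesis
  proof (rule A.algebraicI)
    show "list_of ?q \<in> carrier (univ_poly (copy E) (\<iota> ` K))" "list_of ?q \<noteq> []"
      using list_of_closed[OF nz root_poly_orbit_K] by auto
    show "A.eval (list_of ?q) (\<iota> y) = \<zero>\<^bsub>copy E\<^esub>"
      using poly_root_poly[OF finite_orbit] orbit_self by (simp add: eval_copy_E)
  qed
qed

text \<open>The minimal polynomial of \<open>y\<close> over \<open>K\<close> vanishes on the orbit of \<open>y\<close>, and it divides the polynomial
  with exactly these roots; so the degrees agree and there are no other roots.\<close>

lemma Irr_copy:
  assumes y: "y \<in> E"
  defines "p \<equiv> ring.Irr (copy E) (\<iota> ` K) (\<iota> y)"
  shows "p \<in> carrier (univ_poly (copy E) (\<iota> ` K))" "p \<noteq> []" "set p \<subseteq> \<iota> ` K"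
    "length p - 1 = card (orbit y)" "\<And>z. poly (pol p) z = 0 \<longleftrightarrow> z \<in> orbit y"
proof -
  interpret A: field "copy E" by (rule field_copy)
  have yE: "\<iota> y \<in> carrier (copy E)" using y by simp
  note I = A.IrrE[OF subfield_copy yE algebraic_copy[OF y], folded p_def]
  show pc: "p \<in> carrier (univ_poly (copy E) (\<iota> ` K))" by (rule I(1))
  show ne: "p \<noteq> []"
    by (rule A.pirreducibleE(1)[OF subfieldE(1)[OF subfield_copy] pc I(2)])
  then show setp: "set p \<subseteq> \<iota> ` K" using pc by (simp add: univ_poly_def polynomial_def)
  have hd: "\<kappa> (hd p) \<noteq> 0" using I(3) ne by simp
  have coK: "Polynomial.coeff (pol p) k \<in> K" for k
    by (rule coeff_pol_in[OF setp is_subringD(2)[OF K_subring]])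
  have "poly (pol p) y = 0" using I(4) by (simp add: eval_copy_E)
  then have sub: "orbit y \<subseteq> {z. poly (pol p) z = 0}"
    using act_poly[OF coK, of _ y] by (auto simp: orbit_def)
  let ?q = "root_poly (orbit y)"
  have nz: "?q \<noteq> 0" by (rule root_poly_nonzero[OF finite_orbit])
  note L = list_of_closed[OF nz root_poly_orbit_K]
  have "A.eval (list_of ?q) (\<iota> y) = \<zero>\<^bsub>copy E\<^esub>"
    using poly_root_poly[OF finite_orbit] orbit_self by (simp add: eval_copy_E)
  then have div: "p pdivides\<^bsub>copy E\<^esub> (list_of ?q)"
    unfolding p_def using A.Irr_minimal[OF subfield_copy yE algebraic_copy[OF y] L(1)] by blast
  have poly_ring: "r \<in> carrier (univ_poly (copy E) (\<iota> ` K)) \<Longrightarrow> r \<in> carrier (univ_poly (copy E) (carrier (copy E)))" for r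
    using image_mono[OF E(2), of \<iota>] by (auto simp: univ_poly_def polynomial_def)
  have "length p - 1 \<le> length (list_of ?q) - 1"
    by (rule A.pdivides_imp_degree_le[OF A.carrier_is_subring poly_ring[OF pc] poly_ring[OF L(1)] L(2) div])
  then have le: "length p - 1 \<le> card (orbit y)"
    using L(3) root_poly_degree[OF finite_orbit] by simp
  have dp: "Polynomial.degree (pol p) = length p - 1" "pol p \<noteq> 0" using degree_pol[OF ne hd] by auto
  have fin: "finite {z. poly (pol p) z = 0}" by (rule poly_roots_finite[OF dp(2)])
  have c1: "card (orbit y) \<le> card {z. poly (pol p) z = 0}" by (rule card_mono[OF fin sub])
  have c2: "card {z. poly (pol p) z = 0} \<le> length p - 1" using card_poly_roots_bound[OF dp(2)] dp(1) by simp
  show "length p - 1 = card (orbit y)" using le c1 c2 by simp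
  have "orbit y = {z. poly (pol p) z = 0}" by (rule card_subset_eq[OF fin sub]) (use le c1 c2 in simp)
  then show "poly (pol p) z = 0 \<longleftrightarrow> z \<in> orbit y" for z by auto
qed

lemma algebra_copy: "algebra BK (copy E)"
  by (rule algebra_module_copy[OF K_subring E])

lemma algebraic_ext_copy: "algebraic_ext BK (copy E)"
  unfolding algebraic_ext_def field_ext_def base_image_copy
  using field_BK field_copy algebra_copy algebraic_copy by auto

text \<open>Over \<open>L\<close> the minimal polynomial of \<open>y\<close> has as many roots as the orbit has elements.\<close>

lemma separable_ext_copy: "separable_ext BK (copy E)"
  unfolding separable_ext_def base_image_copy
proof (intro conjI ballI algebraic_ext_copy)
  fix u assume "u \<in> carrier (copy E)"
  then obtain y where y: "y \<in> E" "u = \<iota> y" by auto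
  let ?p = "ring.Irr (copy E) (\<iota> ` K) (\<iota> y)"
  note I = Irr_copy[OF y(1)]
  let ?U = "ring_copy UNIV"
  have U: "field ?U" by (rule field_module_copy) (auto simp: is_subring_def)
  then interpret U: field ?U .
  have ev: "U.eval p (\<iota> a) = \<iota> (poly (pol p) a)" for p a
    by (rule eval_copy) (simp_all add: U.ring_axioms)
  have "{v \<in> carrier ?U. U.eval (map (\<lambda>v. v) ?p) v = \<zero>\<^bsub>?U\<^esub>} = \<iota> ` orbit y"
    using I(5) by (auto simp: ev)
  then have "card {v \<in> carrier ?U. U.eval (map (\<lambda>v. v) ?p) v = \<zero>\<^bsub>?U\<^esub>} = length ?p - 1"
    using I(4) card_image[OF inj_on_subset[OF inj]] by simp
  moreover have "(\<lambda>v. v) \<in> ring_hom (copy E) ?U" by (rule ring_hom_memI) auto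
  ultimately show "separable_poly (copy E) (ring.Irr (copy E) (\<iota> ` K) u)"
    unfolding separable_poly_def y(2) using U by blast
qed

end

abbreviation "LL \<equiv> copy UNIV"

lemma UNIV_subring: "is_subring (UNIV :: 'l set)" by (simp add: is_subring_def)

lemma field_LL: "field LL" by (rule field_copy[OF UNIV_subring]) simp

lemma galois_LL: "galois_ext BK LL"
  unfolding galois_ext_def normal_ext_def base_image_copy
proof (intro conjI ballI algebraic_ext_copy separable_ext_copy UNIV_subring subset_UNIV)
  interpret A: field LL by (rule field_LL)
  fix u assume "u \<in> carrier LL"
  then obtain y where y: "u = \<iota> y" by auto
  let ?p = "ring.Irr LL (\<iota> ` K) (\<iota> y)"
  note I = Irr_copy[OF UNIV_subring subset_UNIV UNIV_I, of y]
  have pc: "?p \<in> carrier (univ_poly LL (carrier LL))" using I(1) by (auto simp: univ_poly_def polynomial_def)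
  have sub: "\<iota> ` orbit y \<subseteq> set_mset (A.roots ?p)"
    using I(2,5) A.roots_mem_iff_is_root[OF pc]
    by (auto simp: A.is_root_def eval_copy_E[OF UNIV_subring subset_UNIV])
  have "card (\<iota> ` orbit y) \<le> card (set_mset (A.roots ?p))" by (rule card_mono[OF _ sub]) simp
  also have "\<dots> \<le> size (A.roots ?p)"
    using size_mset_mono[OF mset_set_set_mset_msubset[of "A.roots ?p"]] by simp
  finally have "length ?p - 1 \<le> size (A.roots ?p)"
    using I(4) card_image[OF inj_on_subset[OF inj], of "orbit y"] by simp
  then show "A.splitted (A.Irr (\<iota> ` K) u)"
    unfolding A.splitted_def y using A.size_roots_le_degree[OF pc] by simp
qed

text \<open>Splitting is expressed by counting roots in \<open>E\<close>; dividing off one linear factor after the other shows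
  that there are no roots in \<open>L\<close> outside \<open>E\<close>.\<close>

lemma splitted_roots:
  assumes E: "is_subring E" "K \<subseteq> E"
  shows "p \<in> carrier (univ_poly (copy E) (carrier (copy E))) \<Longrightarrow> p \<noteq> [] \<Longrightarrow> ring.splitted (copy E) p
    \<Longrightarrow> poly (pol p) z = 0 \<Longrightarrow> z \<in> E"
proof (induction "length p" arbitrary: p rule: less_induct)
  case less
  interpret L: field LL by (rule field_LL)
  interpret A: field "copy E" by (rule field_copy[OF E])
  let ?PR = "univ_poly (copy E) (carrier (copy E))"
  have sub: "subring (\<iota> ` E) LL" by (rule subring_module_copy[OF E(1) UNIV_subring]) simp
  have PR: "?PR = univ_poly LL (\<iota> ` E)"
    using L.univ_poly_consistent[OF sub] by (simp add: module_copy_carrier)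
  have "set p \<subseteq> \<iota> ` E" "hd p \<noteq> \<iota> 0" using less.prems(1,2) by (auto simp: univ_poly_def polynomial_def)
  then have hdp: "\<kappa> (hd p) \<noteq> 0" using less.prems(2) by (cases p) auto
  show ?case
  proof (cases "A.roots p = {#}")
    case True
    then have "length p - 1 = 0" using less.prems(3) by (simp add: A.splitted_def)
    then have "Polynomial.degree (pol p) = 0" "pol p \<noteq> 0" using degree_pol[OF less.prems(2) hdp] by auto
    then obtain c where "pol p = [:c:]" "c \<noteq> 0" by (metis degree_eq_zeroE pCons_0_0)
    then show ?thesis using less.prems(4) by simp
  next
    case False
    obtain a where a: "a \<in> carrier (copy E)" "a \<in># A.roots p"
      "[\<one>\<^bsub>copy E\<^esub>, \<ominus>\<^bsub>copy E\<^esub> a] \<in> carrier ?PR" "[\<one>\<^bsub>copy E\<^esub>, \<ominus>\<^bsub>copy E\<^esub> a] pdivides\<^bsub>copy E\<^esub> p"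
      using A.not_empty_rootsE[OF less.prems(1) False] by blast
    obtain a' where a': "a' \<in> E" "a = \<iota> a'" using a(1) by auto
    obtain q where q: "q \<in> carrier ?PR" "p = [\<one>\<^bsub>copy E\<^esub>, \<ominus>\<^bsub>copy E\<^esub> a] \<otimes>\<^bsub>?PR\<^esub> q"
      using a(4) unfolding pdivides_def factor_def by blast
    interpret PR: ring ?PR by (rule A.univ_poly_is_ring[OF A.carrier_is_subring])
    have qne: "q \<noteq> []"
    proof
      assume "q = []"
      then have "q = \<zero>\<^bsub>?PR\<^esub>" by (simp add: univ_poly_zero)
      then have "p = \<zero>\<^bsub>?PR\<^esub>" using q(2) PR.r_null[OF a(3)] by (simp only:)
      then show False using less.prems(2) by (simp add: univ_poly_zero)
    qed
    have roots: "A.roots p = add_mset a (A.roots q)"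
      using A.poly_mult_degree_one_monic_imp_same_roots[OF a(1) q(1) qne] q(2) by simp
    have ev: "L.eval p (\<iota> w) = L.eval [\<one>\<^bsub>copy E\<^esub>, \<ominus>\<^bsub>copy E\<^esub> a] (\<iota> w) \<otimes>\<^bsub>LL\<^esub> L.eval q (\<iota> w)" for w
    proof -
      interpret ev: ring_hom_ring "univ_poly LL (\<iota> ` E)" LL "\<lambda>p. L.eval p (\<iota> w)"
        by (rule L.eval_ring_hom[OF sub]) simp
      show ?thesis using q a(3) ev.hom_mult[of "[\<one>\<^bsub>copy E\<^esub>, \<ominus>\<^bsub>copy E\<^esub> a]" q] by (simp only: PR)
    qed
    have ev': "poly (pol p) w = (w - a') * poly (pol q) w" for w
      using ev[of w] a' E
      by (simp add: eval_copy_E[OF UNIV_subring subset_UNIV] uminus_module_copy pol_Cons poly_monom algebra_simps)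
    have "length p - 1 = Suc (length q - 1)"
      using A.poly_mult_degree_eq[OF A.carrier_is_subring, of "[\<one>\<^bsub>copy E\<^esub>, \<ominus>\<^bsub>copy E\<^esub> a]" q] a(3) q qne
      by (simp add: univ_poly_carrier univ_poly_mult)
    then have len: "length p = Suc (length q)" using qne less.prems(2) by (cases p; cases q) auto
    show ?thesis
    proof (cases "z = a'")
      case False
      then have "poly (pol q) z = 0" using less.prems(4) ev'[of z] by simp
      moreover have "A.splitted q"
        using less.prems(3) roots len qne by (cases q) (auto simp: A.splitted_def)
      ultimately show ?thesis using less.hyps[of q] len q(1) qne by simp
    qed (use a' in simp)
  qed
qed

text \<open>A normal intermediate field that contains \<open>x 1\<close> contains all its conjugates \<open>x j\<close>, and these
  generate \<open>L\<close> over \<open>K\<close>.\<close>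

lemma closure_minimal:
  assumes sf: "subfield W LL" and sub: "\<iota> ` spanned K \<subseteq> W" and gal: "galois_ext BK (LL\<lparr>carrier := W\<rparr>)"
  shows "W = carrier LL"
proof -
  interpret L: field LL by (rule field_LL)
  define E where "E = \<kappa> ` W"
  have W: "W = \<iota> ` E"
    using subfieldE(3)[OF sf] by (auto simp: E_def image_iff) force
  have wE: "\<iota> a \<in> W \<longleftrightarrow> a \<in> E" for a by (simp add: W)
  have E1: "is_subring E"
    unfolding is_subring_def wE[symmetric]
    using subringE(3,5,6,7)[OF subfieldE(1)[OF sf]] 
    by (auto simp: W) (metis UNIV_I UNIV_subring W iota_in kappa module_copy_simps(2,3) uminus_module_copy)+
  have E2: "K \<subseteq> E"
    using sub spanned_base[OF K_subring] by (fastforce simp: wE[symmetric])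
  have gal': "galois_ext BK (copy E)" using gal by (simp add: W module_copy_carrier)
  have x1: "x 1 \<in> E"
    using sub spanned_x[OF K_subring, of 1] n4 by (auto simp: wE[symmetric])
  let ?p = "ring.Irr (copy E) (\<iota> ` K) (\<iota> (x 1))"
  note I = Irr_copy[OF E1 E2 x1]
  have "ring.splitted (copy E) ?p"
    using gal' x1 unfolding galois_ext_def normal_ext_def base_image_copy by auto
  moreover have "?p \<in> carrier (univ_poly (copy E) (carrier (copy E)))"
    using I(1) image_mono[OF E2, of \<iota>] by (auto simp: univ_poly_def polynomial_def)
  ultimately have "z \<in> E" if "z \<in> orbit (x 1)" for z
    using splitted_roots[OF E1 E2, of ?p z] I(2,5) that by blast
  then have "x j \<in> E" if "j \<in> {1..n}" for j using that orbit_x[OF one_in] by auto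
  then have "E = UNIV" by (rule field_generated[OF E1 E2])
  then show ?thesis by (simp add: W)
qed

lemma spanned_K: "is_subring (spanned K)" "K \<subseteq> spanned K"
  using spanned_subring[OF K_subring min_poly_coeff_K] spanned_base[OF K_subring] by auto

abbreviation "AK \<equiv> copy (spanned K)"

lemma galois_closure_LL: "galois_closure BK AK LL (\<lambda>v. v)"
  unfolding galois_closure_def
  using galois_LL closure_minimal by (auto simp: alg_hom_def intro!: ring_hom_memI)

lemma dimension_AK: "ring.dimension AK n (base_image BK AK) (carrier AK)"
proof -
  interpret A: field AK by (rule field_copy[OF spanned_K])
  have "A.dimension m (\<iota> ` K) (\<iota> ` {\<Sum>a<m. c a * x 1 ^ a | c. \<forall>a. c a \<in> K})" if "m \<le> n" for m
    using that
  proof (induction m)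
    case 0
    have "\<iota> ` {\<Sum>a<0. c a * x 1 ^ a | c. \<forall>a. c a \<in> K} = {\<zero>\<^bsub>AK\<^esub>}"
      using is_subringD(2)[OF K_subring] by auto
    then show ?case using A.dimension.zero_dim by simp
  next
    case (Suc m)
    let ?E = "{\<Sum>a<m. c a * x 1 ^ a | c. \<forall>a. c a \<in> K}"
    have notin: "x 1 ^ m \<notin> ?E"
    proof
      assume "x 1 ^ m \<in> ?E"
      then obtain c where c: "\<forall>a. c a \<in> K" "x 1 ^ m = (\<Sum>a<m. c a * x 1 ^ a)" by blast
      let ?c = "\<lambda>a. if a < m then c a else 0" and ?d = "\<lambda>a. if a = m then 1 else (0::'l)"
      have "(\<Sum>a<n. ?c a * x 1 ^ a) = (\<Sum>a<m. c a * x 1 ^ a)"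
        using Suc.prems by (intro sum.mono_neutral_cong_right) auto
      moreover have "(\<Sum>a<n. ?d a * x 1 ^ a) = x 1 ^ m"
        using Suc.prems by (simp add: if_distrib[of "\<lambda>c. c * _"] sum.delta cong: if_cong)
      ultimately have "?c m = ?d m"
        using c Suc.prems is_subringD(1,2)[OF K_subring]
        by (intro spanned_unique[where c = ?c and d = ?d and a = m]) simp_all
      then show False by simp
    qed
    have "A.line_extension (\<iota> ` K) (\<iota> (x 1 ^ m)) (\<iota> ` ?E) = \<iota> ` {\<Sum>a<Suc m. c a * x 1 ^ a | c. \<forall>a. c a \<in> K}" (is "?l = ?r")
    proof
      show "?l \<subseteq> ?r"
      proof
        fix v assume "v \<in> ?l"
        then obtain k c where kc: "k \<in> K" "\<forall>a. c a \<in> K" "v = \<iota> (k * x 1 ^ m + (\<Sum>a<m. c a * x 1 ^ a))"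
          unfolding A.line_extension_def r_coset_def set_add_def set_mult_def by auto
        have "(\<Sum>a<Suc m. (c(m := k)) a * x 1 ^ a) = k * x 1 ^ m + (\<Sum>a<m. c a * x 1 ^ a)"
          by (simp add: add.commute)
        moreover have "\<forall>a. (c(m := k)) a \<in> K" using kc by simp
        ultimately show "v \<in> ?r" using kc(3) by (intro image_eqI[where x = "\<Sum>a<Suc m. (c(m := k)) a * x 1 ^ a"] CollectI exI[of _ "c(m := k)"] conjI) simp_all
      qed
      show "?r \<subseteq> ?l"
      proof
        fix v assume "v \<in> ?r"
        then obtain c where c: "\<forall>a. c a \<in> K" "v = \<iota> (c m * x 1 ^ m + (\<Sum>a<m. c a * x 1 ^ a))"
          by (auto simp: add.commute)
        then have m1: "\<iota> (c m * x 1 ^ m) \<in> \<iota> ` K #>\<^bsub>AK\<^esub> \<iota> (x 1 ^ m)" by (auto simp: r_coset_def)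
        have m2: "\<iota> (\<Sum>a<m. c a * x 1 ^ a) \<in> \<iota> ` ?E" using c by blast
        have "\<iota> (c m * x 1 ^ m) \<oplus>\<^bsub>AK\<^esub> \<iota> (\<Sum>a<m. c a * x 1 ^ a) \<in> ?l"
          unfolding A.line_extension_def set_add_def set_mult_def
          by (rule UN_I[OF m1], rule UN_I[OF m2]) simp
        then show "v \<in> ?l" by (simp add: c(2))
      qed
    qed
    moreover have "\<iota> (x 1 ^ m) \<in> carrier AK" "\<iota> (x 1 ^ m) \<notin> \<iota> ` ?E"
      using spanned_x[OF K_subring, of m] Suc.prems notin by simp_all
    ultimately show ?case
      using A.dimension.Suc_dim[of "\<iota> (x 1 ^ m)" "\<iota> ` ?E" m "\<iota> ` K"] Suc by simp
  qed
  from this[of n] show ?thesis by (simp add: base_image_copy spanned_def)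
qed

lemma alg_hom_poly:
  assumes E: "is_subring E" "K \<subseteq> E" and h: "h \<in> alg_hom BK (copy E) LL" and y: "y \<in> E"
  shows "\<And>a. a \<in> K \<Longrightarrow> h (\<iota> a) = \<iota> a"
    and "(\<And>k. Polynomial.coeff q k \<in> K) \<Longrightarrow> h (\<iota> (poly q y)) = \<iota> (poly q (\<kappa> (h (\<iota> y))))"
proof -
  have rh: "h \<in> ring_hom (copy E) LL" and sm: "\<And>b u. b \<in> \<iota> ` K \<Longrightarrow> u \<in> \<iota> ` E \<Longrightarrow> h (\<iota> (\<kappa> b * \<kappa> u)) = \<iota> (\<kappa> b * \<kappa> (h u))"
    using h by (auto simp: alg_hom_def)
  have range: "h u \<in> range \<iota>" if "u \<in> \<iota> ` E" for u using ring_hom_closed[OF rh, of u] that by simp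
  have mult: "h (\<iota> (a * b)) = \<iota> (\<kappa> (h (\<iota> a)) * \<kappa> (h (\<iota> b)))" if "a \<in> E" "b \<in> E" for a b
    using ring_hom_mult[OF rh, of "\<iota> a" "\<iota> b"] that by simp
  have add: "h (\<iota> (a + b)) = \<iota> (\<kappa> (h (\<iota> a)) + \<kappa> (h (\<iota> b)))" if "a \<in> E" "b \<in> E" for a b
    using ring_hom_add[OF rh, of "\<iota> a" "\<iota> b"] that by simp
  have one: "h (\<iota> 1) = \<iota> 1" using ring_hom_one[OF rh] by simp
  show hK: "h (\<iota> a) = \<iota> a" if "a \<in> K" for a
    using sm[of "\<iota> a" "\<iota> 1"] that one is_subringD(1)[OF E(1)] by simp
  show "h (\<iota> (poly q y)) = \<iota> (poly q (\<kappa> (h (\<iota> y))))" if "\<And>k. Polynomial.coeff q k \<in> K"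
    using that
  proof (induction q)
    case 0
    then show ?case using hK is_subringD(2)[OF K_subring] by simp
  next
    case (pCons c q)
    have c: "c \<in> K" using pCons.prems[of 0] by simp
    have q: "Polynomial.coeff q k \<in> K" for k using pCons.prems[of "Suc k"] by simp
    have qE: "poly q y \<in> E" using is_subring_poly[OF E(1) _ y] q E(2) by blast
    have "y * poly q y \<in> E" by (rule is_subringD(4)[OF E(1) y qE])
    then show ?case
      using c E(2) qE y by (simp add: add mult hK pCons.IH[OF q] subset_iff)
  qed
qed

text \<open>An embedding takes \<open>x 1\<close> to a root of its minimal polynomial.\<close>

lemma embedding_AK:
  assumes h: "h \<in> alg_hom BK AK LL"
  shows "\<exists>j\<in>{1..n}. \<forall>q. (\<forall>k. Polynomial.coeff q k \<in> K) \<longrightarrow> h (\<iota> (poly q (x 1))) = \<iota> (poly q (x j))"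
proof -
  have x1: "x 1 \<in> spanned K" using spanned_x[OF K_subring, of 1] n4 by simp
  note ah = alg_hom_poly[OF spanned_K h x1]
  have "h (\<iota> (poly min_poly (x 1))) = \<iota> (poly min_poly (\<kappa> (h (\<iota> (x 1)))))" by (rule ah(2)) (rule min_poly_coeff_K)
  moreover have "poly min_poly (x 1) = 0" using min_poly_root one_in by blast
  ultimately have "poly min_poly (\<kappa> (h (\<iota> (x 1)))) = 0" using ah(1)[OF is_subringD(2)[OF K_subring]] by simp
  then obtain j where "j \<in> {1..n}" "\<kappa> (h (\<iota> (x 1))) = x j" using min_poly_root by blast
  then show ?thesis using ah(2) by auto
qed

end

section \<open>The Galois group\<close>

context galois_copy begin

definition act_copy :: "(nat \<Rightarrow> nat) \<Rightarrow> 'u \<Rightarrow> 'u"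
  where "act_copy \<sigma> = restrict (\<lambda>u. \<iota> (act \<sigma> (\<kappa> u))) (carrier LL)"

lemma act_copy_iota [simp]: "act_copy \<sigma> (\<iota> a) = \<iota> (act \<sigma> a)"
  by (simp add: act_copy_def)

lemma act_copy_mem:
  assumes \<sigma>: "\<sigma> permutes {1..n}"
  shows "act_copy \<sigma> \<in> Bij (carrier LL) \<inter> alg_hom BK LL LL"
proof
  have "bij_betw (act_copy \<sigma>) (carrier LL) (carrier LL)"
    by (rule bij_betw_byWitness[where f' = "act_copy (inv_into UNIV \<sigma>)"])
       (auto simp: act_inv_into[OF \<sigma>])
  then show "act_copy \<sigma> \<in> Bij (carrier LL)"
    by (simp add: Bij_def act_copy_def)
  show "act_copy \<sigma> \<in> alg_hom BK LL LL"
    unfolding alg_hom_def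
    by (auto simp: act_add[OF \<sigma>] act_mult[OF \<sigma>] act_one[OF \<sigma>] K_act[OF _ \<sigma>] intro!: ring_hom_memI)
qed

text \<open>An automorphism permutes the roots \<open>x j\<close>; the set where it agrees with the action of this permutation
  is a subring that contains \<open>K\<close> and the \<open>x j\<close>, so that it is everything.\<close>

lemma galois_automorphism:
  assumes g: "g \<in> Bij (carrier LL)" "g \<in> alg_hom BK LL LL"
  shows "\<exists>\<sigma>. \<sigma> permutes {1..n} \<and> g = act_copy \<sigma>"
proof -
  have ginj: "inj_on g (carrier LL)" and gext: "g \<in> extensional (carrier LL)"
    using g(1) by (auto simp: Bij_def bij_betw_def)
  note ap = alg_hom_poly[OF UNIV_subring subset_UNIV g(2) UNIV_I]
  have rh: "g \<in> ring_hom LL LL" using g(2) by (simp add: alg_hom_def)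
  have rng: "g (\<iota> a) = \<iota> (\<kappa> (g (\<iota> a)))" for a using ring_hom_closed[OF rh, of "\<iota> a"] by auto
  have "\<exists>i\<in>{1..n}. g (\<iota> (x j)) = \<iota> (x i)" if j: "j \<in> {1..n}" for j
  proof -
    have "g (\<iota> (poly min_poly (x j))) = \<iota> (poly min_poly (\<kappa> (g (\<iota> (x j)))))" by (rule ap(2)) (rule min_poly_coeff_K)
    moreover have "poly min_poly (x j) = 0" using min_poly_root j by blast
    ultimately have "poly min_poly (\<kappa> (g (\<iota> (x j)))) = 0" using ap(1)[OF is_subringD(2)[OF K_subring]] by simp
    then obtain i where "i \<in> {1..n}" "\<kappa> (g (\<iota> (x j))) = x i" using min_poly_root by blast
    then show ?thesis using rng[of "x j"] by auto
  qed
  then obtain s where s: "\<And>j. j \<in> {1..n} \<Longrightarrow> s j \<in> {1..n} \<and> g (\<iota> (x j)) = \<iota> (x (s j))" by metis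
  define \<sigma> where "\<sigma> j = (if j \<in> {1..n} then s j else j)" for j
  have "inj_on s {1..n}"
  proof (rule inj_onI)
    fix i j assume ij: "i \<in> {1..n}" "j \<in> {1..n}" "s i = s j"
    then have "g (\<iota> (x i)) = g (\<iota> (x j))" using s by metis
    then have "\<iota> (x i) = \<iota> (x j)" using ginj by (auto simp: inj_on_def)
    then show "i = j" using ij x_inj by (simp add: inj_on_eq_iff)
  qed
  then have "bij_betw s {1..n} {1..n}"
    using s by (intro bij_betw_imageI endo_inj_surj) auto
  moreover have "bij_betw s {1..n} {1..n} = bij_betw \<sigma> {1..n} {1..n}"
    by (rule bij_betw_cong) (simp add: \<sigma>_def)
  ultimately have "bij_betw \<sigma> {1..n} {1..n}" by simp
  then have \<sigma>: "\<sigma> permutes {1..n}" by (rule bij_imp_permutes) (auto simp: \<sigma>_def)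
  let ?E = "{a. g (\<iota> a) = \<iota> (act \<sigma> a)}"
  have "is_subring ?E"
    unfolding is_subring_def
  proof (intro conjI ballI)
    show "1 \<in> ?E" using ring_hom_one[OF rh] by (simp add: act_one[OF \<sigma>])
    fix a b assume "a \<in> ?E" "b \<in> ?E"
    then show "a + b \<in> ?E" "a * b \<in> ?E"
      using ring_hom_add[OF rh, of "\<iota> a" "\<iota> b"] ring_hom_mult[OF rh, of "\<iota> a" "\<iota> b"]
      by (simp_all add: act_add[OF \<sigma>] act_mult[OF \<sigma>])
  next
    fix a assume a: "a \<in> ?E"
    have "g (\<iota> 0) = \<iota> 0" by (rule ap(1)[OF is_subringD(2)[OF K_subring]])
    then have "\<kappa> (g (\<iota> a)) + \<kappa> (g (\<iota> (- a))) = 0"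
      using ring_hom_add[OF rh, of "\<iota> a" "\<iota> (- a)"] by simp
    then have "\<kappa> (g (\<iota> (- a))) = act \<sigma> (- a)" using a by (simp add: act_uminus[OF \<sigma>] eq_neg_iff_add_eq_0 add.commute)
    then show "- a \<in> ?E" using rng[of "- a"] by simp
  qed
  moreover have "K \<subseteq> ?E" using ap(1) K_act[OF _ \<sigma>] by auto
  moreover have "x j \<in> ?E" if "j \<in> {1..n}" for j
    using s[OF that] act_x[OF \<sigma> that] that by (simp add: \<sigma>_def)
  ultimately have "?E = UNIV" by (rule field_generated)
  then have "g u = act_copy \<sigma> u" for u
    using gext by (cases "u \<in> carrier LL") (auto simp: act_copy_def extensional_def)
  then show ?thesis using \<sigma> by blast
qed

lemma galois_group_LL: "galois_group BK LL \<cong> sym_group n"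
proof -
  interpret S: group "sym_group n" by (rule sym_group_is_group)
  have "act_copy \<in> iso (sym_group n) (galois_group BK LL)"
  proof (rule isoI)
    show "act_copy \<in> hom (sym_group n) (galois_group BK LL)"
    proof (rule homI)
      show "act_copy \<sigma> \<in> carrier (galois_group BK LL)" if "\<sigma> \<in> carrier (sym_group n)" for \<sigma>
        using that act_copy_mem by (simp add: galois_group_def sym_group_def)
      fix \<sigma> \<tau> assume "\<sigma> \<in> carrier (sym_group n)" "\<tau> \<in> carrier (sym_group n)"
      then have st: "\<sigma> permutes {1..n}" "\<tau> permutes {1..n}" by (simp_all add: sym_group_def)
      have "act_copy (\<sigma> \<circ> \<tau>) = compose (carrier LL) (act_copy \<sigma>) (act_copy \<tau>)"
        by (rule ext) (auto simp: compose_def act_copy_def act_comp[OF st])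
      then show "act_copy (\<sigma> \<otimes>\<^bsub>sym_group n\<^esub> \<tau>) = act_copy \<sigma> \<otimes>\<^bsub>galois_group BK LL\<^esub> act_copy \<tau>"
        using act_copy_mem[OF st(1)] act_copy_mem[OF st(2)]
        by (simp add: galois_group_def sym_group_def BijGroup_def)
    qed
    show "bij_betw act_copy (carrier (sym_group n)) (carrier (galois_group BK LL))"
    proof (rule bij_betw_imageI)
      show "inj_on act_copy (carrier (sym_group n))"
      proof (rule inj_onI)
        fix \<sigma> \<tau> assume "\<sigma> \<in> carrier (sym_group n)" "\<tau> \<in> carrier (sym_group n)" and eq: "act_copy \<sigma> = act_copy \<tau>"
        then have st: "\<sigma> permutes {1..n}" "\<tau> permutes {1..n}" by (simp_all add: sym_group_def)
        show "\<sigma> = \<tau>"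
        proof
          fix j
          show "\<sigma> j = \<tau> j"
          proof (cases "j \<in> {1..n}")
            case True
            have "act_copy \<sigma> (\<iota> (x j)) = act_copy \<tau> (\<iota> (x j))" by (simp only: eq)
            then have "x (\<sigma> j) = x (\<tau> j)" by (simp add: act_x[OF st(1) True] act_x[OF st(2) True])
            moreover have "\<sigma> j \<in> {1..n}" "\<tau> j \<in> {1..n}" using True by (simp_all only: permutes_in_image[OF st(1)] permutes_in_image[OF st(2)])
            ultimately show ?thesis using x_inj by (simp add: inj_on_eq_iff)
          next
            case False
            then show ?thesis using permutes_not_in[OF st(1)] permutes_not_in[OF st(2)] by simp
          qed
        qed
      qed
      show "act_copy ` carrier (sym_group n) = carrier (galois_group BK LL)"
      proof
        show "act_copy ` carrier (sym_group n) \<subseteq> carrier (galois_group BK LL)"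
          using act_copy_mem by (auto simp: galois_group_def sym_group_def)
        show "carrier (galois_group BK LL) \<subseteq> act_copy ` carrier (sym_group n)"
          using galois_automorphism by (auto simp: galois_group_def sym_group_def)
      qed
    qed
  qed
  then show ?thesis using S.iso_set_sym by (auto simp: is_iso_def)
qed

lemma Sn_extension_AK: "Sn_extension n BK AK"
  unfolding Sn_extension_def
  using separable_ext_copy[OF spanned_K] dimension_AK galois_closure_LL galois_group_LL by blast


section \<open>Modules of linear combinations\<close>

lemma finsum_module_copy:
  assumes "abelian_group (module_copy m E)" "\<And>i. i \<in> I \<Longrightarrow> g i \<in> E" "finite I"
  shows "(\<Oplus>\<^bsub>module_copy m E\<^esub>i\<in>I. \<iota> (g i)) = \<iota> (\<Sum>i\<in>I. g i)"
proof -
  interpret A: abelian_group "module_copy m E" by fact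
  show ?thesis using assms(3,2)
  proof (induction I)
    case (insert i I)
    then show ?case by (subst A.finsum_insert) auto
  qed (use A.finsum_empty in simp)
qed

lemma basis_module_copy:
  assumes M: "module (ring_copy S) (module_copy m E)"
    and e: "\<And>a. a < n \<Longrightarrow> e a \<in> E" and E: "E = {\<Sum>a<n. c a * e a | c. \<forall>a. c a \<in> S}"
    and 0: "0 \<in> S"
    and indep: "\<And>c. (\<And>a. c a \<in> S) \<Longrightarrow> (\<Sum>a<n. c a * e a) = 0 \<Longrightarrow> \<forall>a<n. c a = 0"
  shows "is_basis (ring_copy S) (module_copy m E) n (\<lambda>a. \<iota> (e a))"
proof -
  interpret M: module "ring_copy S" "module_copy m E" by fact
  let ?e = "\<lambda>a. \<iota> (e a)"
  have e': "?e \<in> {..<n} \<rightarrow> carrier (module_copy m E)" using e by simp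
  have lin: "M.lincomb n ?e c = \<iota> (\<Sum>a<n. \<kappa> (c a) * e a)" if c: "c \<in> {..<n} \<rightarrow> carrier (ring_copy S)" for c
  proof -
    have "\<kappa> (c a) * e a \<in> E" if "a < n" for a
      using M.smult_closed[of "c a" "?e a"] c e that by (auto simp: Pi_iff)
    then show ?thesis
      unfolding M.lincomb_def using finsum_module_copy[OF M.abelian_group_axioms, of "{..<n}" "\<lambda>a. \<kappa> (c a) * e a"] by simp
  qed
  show ?thesis
  proof (rule M.is_basisI[OF e'])
    fix u assume "u \<in> carrier (module_copy m E)"
    then obtain c where c: "\<forall>a. c a \<in> S" "u = \<iota> (\<Sum>a<n. c a * e a)" unfolding E by auto
    have c': "(\<lambda>a. \<iota> (c a)) \<in> {..<n} \<rightarrow> carrier (ring_copy S)" using c by simp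
    show "\<exists>c\<in>{..<n} \<rightarrow> carrier (ring_copy S). u = M.lincomb n ?e c"
      using lin[OF c'] c(2) by (intro bexI[OF _ c']) simp
  next
    fix c assume c: "c \<in> {..<n} \<rightarrow> carrier (ring_copy S)" and z: "M.lincomb n ?e c = \<zero>\<^bsub>module_copy m E\<^esub>"
    let ?c = "\<lambda>a. if a < n then \<kappa> (c a) else 0"
    have "(\<Sum>a<n. ?c a * e a) = 0" using z lin[OF c] by simp
    moreover have "\<kappa> u \<in> S" if "u \<in> \<iota> ` S" for u using that by auto
    then have "?c a \<in> S" for a using c 0 by (simp add: Pi_iff)
    ultimately have "\<forall>a<n. ?c a = 0" by (rule indep[rotated])
    then show "\<forall>a<n. c a = \<zero>\<^bsub>ring_copy S\<^esub>"
      using c by (auto simp: Pi_iff) (metis imageE kappa lessThan_iff)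
  qed
qed


section \<open>Integral models\<close>

definition base_ring :: "'l set" where "base_ring = P \<inter> K"

lemma base_ring_subring: "is_subring base_ring"
  using P K_subring unfolding is_subring_def base_ring_def by auto

lemma base_ring_K: "base_ring \<subseteq> K" and base_ring_P: "base_ring \<subseteq> P" by (auto simp: base_ring_def)

lemma min_poly_coeff_base_ring: "Polynomial.coeff min_poly k \<in> base_ring" using min_poly_coeff_P min_poly_coeff_K by (simp add: base_ring_def)

lemma t_base_ring: "t \<in> base_ring" using t_P act_t by (simp add: base_ring_def K_def)

definition tx_power :: "nat \<Rightarrow> 'l" where "tx_power a = (if a = 0 then 1 else t * x 1 ^ a)"

text \<open>The order \<open>B + t B[x 1]\<close>.  The factor \<open>t\<close> is invertible in \<open>K\<close>, so that the generic fibre is still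
  \<open>K(x 1)\<close>, but \<open>(t x\<^sup>a) (t x\<^sup>b) = t (t x\<^bsup>a+b\<^esup>)\<close> is divisible by \<open>t\<close>.\<close>

definition order_ring :: "'l set" where "order_ring = {\<Sum>a<n. c a * tx_power a | c. \<forall>a. c a \<in> base_ring}"

definition x_comb :: "(nat \<Rightarrow> 'l) \<Rightarrow> 'l" where "x_comb c = (\<Sum>a<n. c a * x 1 ^ a)"

lemma x_comb_tx_power: "(\<Sum>a<n. c a * tx_power a) = x_comb (\<lambda>a. if a = 0 then c a else c a * t)"
  unfolding x_comb_def tx_power_def by (rule sum.cong) (auto simp: mult.assoc)

text \<open>The coordinates with respect to the powers of \<open>x 1\<close>, unique by \<open>spanned_unique\<close>.\<close>

definition coord :: "'l \<Rightarrow> nat \<Rightarrow> 'l" where "coord y = (SOME c. (\<forall>a. c a \<in> K) \<and> y = x_comb c)"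

lemma coord_x_comb: assumes "\<And>a. a < n \<Longrightarrow> c a \<in> K" "a < n" shows "coord (x_comb c) a = c a"
proof -
  let ?c = "\<lambda>a. if a < n then c a else 0"
  have "x_comb c = x_comb ?c" by (simp add: x_comb_def)
  then have ex: "(\<forall>a. ?c a \<in> K) \<and> x_comb c = x_comb ?c" using assms is_subringD(2)[OF K_subring] by auto
  have "(\<forall>a. coord (x_comb c) a \<in> K) \<and> x_comb c = x_comb (coord (x_comb c))"
    unfolding coord_def by (rule someI[of "\<lambda>d. (\<forall>a. d a \<in> K) \<and> x_comb c = x_comb d", OF ex])
  then show ?thesis using spanned_unique[of "coord (x_comb c)" c a] assms by (auto simp: x_comb_def)
qed

lemma spanned_x_comb: "spanned S = {x_comb c | c. \<forall>a. c a \<in> S}"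
  by (simp add: spanned_def x_comb_def)

lemma x_comb_add: "x_comb c + x_comb d = x_comb (\<lambda>a. c a + d a)"
  by (simp add: x_comb_def distrib_right sum.distrib)

lemma x_comb_diff: "x_comb c - x_comb d = x_comb (\<lambda>a. c a - d a)"
  by (simp add: x_comb_def left_diff_distrib sum_subtractf)

lemma x_comb_smult: "b * x_comb c = x_comb (\<lambda>a. b * c a)"
  by (simp add: x_comb_def sum_distrib_left mult.assoc)

lemma x_comb_const: "x_comb (\<lambda>a. if a = 0 then b else 0) = b"
  using n4 by (simp add: x_comb_def if_distrib[of "\<lambda>c. c * _"] sum.delta cong: if_cong)

lemma x_comb_mult_base_ring:
  assumes "\<And>a. c a \<in> base_ring" "\<And>a. d a \<in> base_ring"
  shows "\<exists>g. (\<forall>a. g a \<in> base_ring) \<and> x_comb c * x_comb d = x_comb g"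
proof -
  have "x_comb c * x_comb d \<in> spanned base_ring"
    using assms by (intro is_subringD(4)[OF spanned_subring[OF base_ring_subring min_poly_coeff_base_ring]]) (auto simp: spanned_x_comb)
  then show ?thesis by (auto simp: spanned_x_comb)
qed

text \<open>Up to a multiple of \<open>t\<close> the product is that of the trivial extension \<open>k \<oplus> V\<close> with \<open>V\<^sup>2 = 0\<close>, where
  \<open>(c + v) (d + w) = c (d + w) + d (c + v) - c d\<close>.  That the product of the parts in \<open>V\<close> is divisible by
  \<open>t\<close> makes \<open>order_ring\<close> a ring and determines its special fibre.\<close>

lemma tx_power_mult:
  assumes c: "\<And>a. c a \<in> base_ring" and d: "\<And>a. d a \<in> base_ring"
  shows "\<exists>g. (\<forall>a. g a \<in> base_ring) \<and> (\<Sum>a<n. c a * tx_power a) * (\<Sum>a<n. d a * tx_power a)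
    = (\<Sum>a<n. (c 0 * d a + d 0 * c a - (if a = 0 then c 0 * d 0 else 0) + t * g a) * tx_power a)"
proof -
  note B = is_subringD[OF base_ring_subring]
  let ?c = "\<lambda>a. if a = 0 then 0 else c a" and ?d = "\<lambda>a. if a = 0 then 0 else d a"
  have c': "?c a \<in> base_ring" and d': "?d a \<in> base_ring" for a using c d B(2) by simp_all
  obtain g where g: "\<forall>a. g a \<in> base_ring" "x_comb ?c * x_comb ?d = x_comb g"
    using x_comb_mult_base_ring[of ?c ?d, OF c' d'] by (elim exE conjE)
  have split: "(\<Sum>a<n. h a * tx_power a) = h 0 + t * x_comb (\<lambda>a. if a = 0 then 0 else h a)" for h
  proof -
    have "(\<lambda>a. if a = 0 then h a else h a * t) = (\<lambda>a. (if a = 0 then h 0 else 0) + t * (if a = 0 then 0 else h a))"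
      by (auto simp: mult.commute)
    then have "(\<Sum>a<n. h a * tx_power a) = x_comb (\<lambda>a. if a = 0 then h 0 else 0) + t * x_comb (\<lambda>a. if a = 0 then 0 else h a)"
      by (simp only: x_comb_tx_power x_comb_smult x_comb_add)
    then show ?thesis by (simp only: x_comb_const)
  qed
  let ?g = "\<lambda>a. if a = 0 then t * g a else g a"
  have g0: "t * g 0 * t + t * x_comb (\<lambda>a. if a = 0 then 0 else t * g a) = t * (t * x_comb g)"
  proof -
    have "t * (t * x_comb g) = x_comb (\<lambda>a. t * (t * g a))" by (simp add: x_comb_smult)
    also have "\<dots> = x_comb (\<lambda>a. (if a = 0 then t * g 0 * t else 0) + t * (if a = 0 then 0 else t * g a))"
      by (rule arg_cong[where f = x_comb]) (auto simp: mult_ac)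
    also have "\<dots> = x_comb (\<lambda>a. if a = 0 then t * g 0 * t else 0) + t * x_comb (\<lambda>a. if a = 0 then 0 else t * g a)"
      by (simp only: x_comb_smult x_comb_add)
    also have "\<dots> = t * g 0 * t + t * x_comb (\<lambda>a. if a = 0 then 0 else t * g a)"
      by (simp only: x_comb_const)
    finally show ?thesis by simp
  qed
  have lin: "x_comb (\<lambda>a. if a = 0 then 0 else c 0 * d a + d 0 * c a - 0 + t * g a)
     = c 0 * x_comb ?d + d 0 * x_comb ?c + x_comb (\<lambda>a. if a = 0 then 0 else t * g a)"
    unfolding x_comb_smult x_comb_add by (rule arg_cong[where f = x_comb]) auto
  have "(\<Sum>a<n. (c 0 * d a + d 0 * c a - (if a = 0 then c 0 * d 0 else 0) + t * ?g a) * tx_power a)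
    = c 0 * d 0 + t * (t * g 0) + t * x_comb (\<lambda>a. if a = 0 then 0 else c 0 * d a + d 0 * c a - 0 + t * g a)"
    unfolding split by (simp add: cong: if_cong)
  also have "\<dots> = c 0 * d 0 + t * (c 0 * x_comb ?d + d 0 * x_comb ?c) + t * (t * x_comb g)"
    unfolding lin g0[symmetric] by (simp add: algebra_simps)
  also have "\<dots> = (c 0 + t * x_comb ?c) * (d 0 + t * x_comb ?d)"
    unfolding g(2)[symmetric] by (simp add: algebra_simps)
  also have "\<dots> = (\<Sum>a<n. c a * tx_power a) * (\<Sum>a<n. d a * tx_power a)"
    unfolding split ..
  finally have "(\<Sum>a<n. c a * tx_power a) * (\<Sum>a<n. d a * tx_power a)
    = (\<Sum>a<n. (c 0 * d a + d 0 * c a - (if a = 0 then c 0 * d 0 else 0) + t * ?g a) * tx_power a)" ..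
  moreover have "\<forall>a. ?g a \<in> base_ring" using g(1) t_base_ring B(4) by auto
  ultimately show ?thesis by (intro exI[of _ ?g]) simp
qed

lemma order_ringI: "(\<And>a. c a \<in> base_ring) \<Longrightarrow> (\<Sum>a<n. c a * tx_power a) \<in> order_ring" by (auto simp: order_ring_def)

lemma tx_power_order_ring: assumes "a < n" shows "tx_power a \<in> order_ring"
proof -
  have "(\<Sum>b<n. (if b = a then 1 else 0) * tx_power b) = tx_power a"
    using assms by (simp add: if_distrib[of "\<lambda>c. c * _"] sum.delta cong: if_cong)
  then show ?thesis using order_ringI[of "\<lambda>b. if b = a then 1 else 0"] is_subringD(1,2)[OF base_ring_subring] by auto
qed

lemma order_ring_subring: "is_subring order_ring"
  unfolding is_subring_def
proof (intro conjI ballI)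
  note B = is_subringD[OF base_ring_subring]
  show "1 \<in> order_ring" using tx_power_order_ring[of 0] n4 by (simp add: tx_power_def)
  fix y z assume "y \<in> order_ring" "z \<in> order_ring"
  then obtain c d where cd: "\<And>a. c a \<in> base_ring" "\<And>a. d a \<in> base_ring" "y = (\<Sum>a<n. c a * tx_power a)" "z = (\<Sum>a<n. d a * tx_power a)"
    by (auto simp: order_ring_def)
  show "y + z \<in> order_ring" using order_ringI[of "\<lambda>a. c a + d a"] cd B(3) by (simp add: distrib_right sum.distrib)
  obtain g where g: "\<forall>a. g a \<in> base_ring" "y * z = (\<Sum>a<n. (c 0 * d a + d 0 * c a - (if a = 0 then c 0 * d 0 else 0) + t * g a) * tx_power a)"
    using tx_power_mult[of c d] cd by blast
  have "c 0 * d a + d 0 * c a - (if a = 0 then c 0 * d 0 else 0) + t * g a \<in> base_ring" for a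
    using cd g(1) t_base_ring B by (auto intro!: B)
  then show "y * z \<in> order_ring" unfolding g(2) by (rule order_ringI)
next
  fix y assume "y \<in> order_ring"
  then obtain c where "\<And>a. c a \<in> base_ring" "y = (\<Sum>a<n. c a * tx_power a)" by (auto simp: order_ring_def)
  then show "- y \<in> order_ring" using order_ringI[of "\<lambda>a. - c a"] is_subringD(5)[OF base_ring_subring] by (simp add: sum_negf)
qed

lemma base_ring_order_ring: "base_ring \<subseteq> order_ring"
proof
  fix b assume b: "b \<in> base_ring"
  have "(\<Sum>a<n. (if a = 0 then b else 0) * tx_power a) = b"
    using n4 by (simp add: if_distrib[of "\<lambda>c. c * _"] sum.delta tx_power_def cong: if_cong)
  then show "b \<in> order_ring" using order_ringI[of "\<lambda>a. if a = 0 then b else 0"] b is_subringD(2)[OF base_ring_subring] by auto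
qed

abbreviation "BB \<equiv> ring_copy base_ring"
abbreviation "AA \<equiv> copy order_ring"

lemma algebra_AA: "algebra BB AA" by (rule algebra_module_copy[OF base_ring_subring order_ring_subring base_ring_order_ring])

lemma tx_power_indep:
  assumes "\<And>a. c a \<in> K" "(\<Sum>a<n. c a * tx_power a) = 0" shows "\<forall>a<n. c a = 0"
proof (intro allI impI)
  fix a assume a: "a < n"
  let ?c = "\<lambda>a. if a = 0 then c a else c a * t"
  have K: "?c a \<in> K" for a using assms(1) is_subringD(4)[OF K_subring] t_base_ring base_ring_K by auto
  have "x_comb ?c = x_comb (\<lambda>_. 0)" using assms(2) by (simp add: x_comb_tx_power) (simp add: x_comb_def)
  then have "?c a = 0"
    using coord_x_comb[of ?c a] coord_x_comb[of "\<lambda>_. 0" a] K a is_subringD(2)[OF K_subring] by simp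
  then show "c a = 0" using t_nonzero by (simp split: if_splits)
qed

lemma basis_AA: "is_basis BB AA n (\<lambda>a. \<iota> (tx_power a))"
  by (rule basis_module_copy[OF algebra.module[OF algebra_AA] tx_power_order_ring order_ring_def is_subringD(2)[OF base_ring_subring]])
     (use tx_power_indep base_ring_K in auto)

lemma x_comb_tx_power_K: assumes "\<forall>a. c a \<in> K" shows "(\<Sum>a<n. c a * tx_power a) \<in> spanned K"
proof -
  have "\<forall>a. (if a = 0 then c a else c a * t) \<in> K"
    using assms is_subringD(4)[OF K_subring] t_base_ring base_ring_K by auto
  then show ?thesis unfolding x_comb_tx_power spanned_x_comb by blast
qed

lemma order_ring_AK: "order_ring \<subseteq> spanned K"
  using x_comb_tx_power_K base_ring_K by (auto simp: order_ring_def)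

lemma basis_AK: "is_basis BK AK n (\<lambda>a. \<iota> (tx_power a))"
proof (rule basis_module_copy[OF algebra.module[OF algebra_copy[OF spanned_K]] _ _ is_subringD(2)[OF K_subring]])
  note Kc = is_subringD[OF K_subring]
  have tK: "t \<in> K" using t_base_ring base_ring_K by auto
  show "tx_power a \<in> spanned K" if "a < n" for a
    using that spanned_x[OF K_subring] spanned_smult[OF K_subring tK] is_subringD(1)[OF spanned_K(1)] by (simp add: tx_power_def)
  show "spanned K = {\<Sum>a<n. c a * tx_power a | c. \<forall>a. c a \<in> K}"
  proof
    show "spanned K \<subseteq> {\<Sum>a<n. c a * tx_power a | c. \<forall>a. c a \<in> K}"
    proof
      fix y assume "y \<in> spanned K"
      then obtain c where c: "\<forall>a. c a \<in> K" "y = x_comb c" by (auto simp: spanned_x_comb)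
      let ?c = "\<lambda>a. if a = 0 then c a else c a / t"
      have "y = (\<Sum>a<n. ?c a * tx_power a)" unfolding c(2) x_comb_tx_power
        by (rule arg_cong[where f = x_comb]) (auto simp: t_nonzero)
      moreover have "\<forall>a. ?c a \<in> K" using c K_divide tK by auto
      ultimately show "y \<in> {\<Sum>a<n. c a * tx_power a | c. \<forall>a. c a \<in> K}"
        by (intro CollectI exI[of _ ?c] conjI)
    qed
    show "{\<Sum>a<n. c a * tx_power a | c. \<forall>a. c a \<in> K} \<subseteq> spanned K"
      using x_comb_tx_power_K by blast
  qed
qed (rule tx_power_indep)

section \<open>The degenerate algebra\<close>

text \<open>As \<open>\<epsilon>\<close> is a retraction, the ring \<open>B / t B\<close> can be found inside \<open>B\<close>.\<close>

definition special_base :: "'l set" where "special_base = \<epsilon> ` base_ring"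

lemma eps_base_ring: "b \<in> base_ring \<Longrightarrow> \<epsilon> b \<in> base_ring"
  using eps_P eps_act[symmetric] by (auto simp: base_ring_def K_def)

lemma special_base_base_ring: "special_base \<subseteq> base_ring" using eps_base_ring by (auto simp: special_base_def)

lemma eps_special_base: "c \<in> special_base \<Longrightarrow> \<epsilon> c = c" using eps_eps base_ring_P by (auto simp: special_base_def)

lemma eps_in_special_base: "b \<in> base_ring \<Longrightarrow> \<epsilon> b \<in> special_base" by (simp add: special_base_def)

lemma eps_zero: "\<epsilon> 0 = 0" using eps_add[of 0 0] is_subringD(2)[OF P] by (metis add_cancel_right_right add_0)

lemma eps_uminus: "a \<in> P \<Longrightarrow> \<epsilon> (- a) = - \<epsilon> a"
  using eps_add[of a "- a"] is_subringD(5)[OF P] eps_zero by (simp add: eq_neg_iff_add_eq_0 add.commute)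

lemma eps_diff: "a \<in> P \<Longrightarrow> b \<in> P \<Longrightarrow> \<epsilon> (a - b) = \<epsilon> a - \<epsilon> b"
  using eps_add[of a "- b"] is_subringD(5)[OF P] by (simp add: eps_uminus)

lemma special_base_subring: "is_subring special_base"
  unfolding is_subring_def
proof (intro conjI ballI)
  show "1 \<in> special_base" using eps_in_special_base[OF is_subringD(1)[OF base_ring_subring]] eps_one by simp
  fix a b assume "a \<in> special_base" "b \<in> special_base"
  then have ab: "a \<in> base_ring" "b \<in> base_ring" "\<epsilon> a = a" "\<epsilon> b = b" using special_base_base_ring eps_special_base by auto
  then show "a + b \<in> special_base" "a * b \<in> special_base"
    using eps_in_special_base[of "a + b"] eps_in_special_base[of "a * b"] is_subringD(3,4)[OF base_ring_subring] base_ring_P by (auto simp: eps_add eps_mult subset_iff)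
next
  fix a assume "a \<in> special_base"
  then have "a \<in> base_ring" "\<epsilon> a = a" using special_base_base_ring eps_special_base by auto
  then show "- a \<in> special_base" using eps_in_special_base[of "- a"] is_subringD(5)[OF base_ring_subring] base_ring_P by (auto simp: eps_uminus subset_iff)
qed

lemma special_base_K: "special_base \<subseteq> K" using special_base_base_ring base_ring_K by blast

text \<open>The product of \<open>k \<oplus> V\<close> with \<open>V\<^sup>2 = 0\<close>, where \<open>k\<close> is the part of degree zero and \<open>V\<close> is spanned by the
  positive powers of \<open>x 1\<close>.\<close>

definition sq_zero_mult :: "'l \<Rightarrow> 'l \<Rightarrow> 'l"
  where "sq_zero_mult y z = coord y 0 * z + coord z 0 * y - coord y 0 * coord z 0"

abbreviation "B0 \<equiv> ring_copy special_base"
abbreviation "A0 \<equiv> module_copy sq_zero_mult (spanned special_base)"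

lemma spanned_special_baseE:
  assumes "y \<in> spanned special_base"
  shows "\<exists>c. (\<forall>a. c a \<in> special_base) \<and> y = x_comb c \<and> (\<forall>a<n. coord y a = c a)"
proof -
  obtain c where c: "\<forall>a. c a \<in> special_base" "y = x_comb c" using assms by (auto simp: spanned_x_comb)
  have "coord y a = c a" if "a < n" for a unfolding c(2) using c(1) special_base_K that by (intro coord_x_comb) auto
  then show ?thesis using c by blast
qed

lemma coord_in_special_base: "y \<in> spanned special_base \<Longrightarrow> a < n \<Longrightarrow> coord y a \<in> special_base"
  by (metis spanned_special_baseE)

lemma coord_add: "y \<in> spanned special_base \<Longrightarrow> z \<in> spanned special_base \<Longrightarrow> a < n \<Longrightarrow> coord (y + z) a = coord y a + coord z a"
proof -
  assume yz: "y \<in> spanned special_base" "z \<in> spanned special_base" and a: "a < n"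
  obtain c where c: "\<And>a. c a \<in> special_base" "y = x_comb c" "\<And>a. a < n \<Longrightarrow> coord y a = c a" using spanned_special_baseE[OF yz(1)] by blast
  obtain d where d: "\<And>a. d a \<in> special_base" "z = x_comb d" "\<And>a. a < n \<Longrightarrow> coord z a = d a" using spanned_special_baseE[OF yz(2)] by blast
  have "coord (x_comb (\<lambda>a. c a + d a)) a = c a + d a"
    using a by (intro coord_x_comb is_subringD(3)[OF K_subring] subsetD[OF special_base_K] c d)
  then show ?thesis using c d a by (simp add: x_comb_add)
qed

lemma coord_smult: "b \<in> special_base \<Longrightarrow> y \<in> spanned special_base \<Longrightarrow> a < n \<Longrightarrow> coord (b * y) a = b * coord y a"
proof -
  assume b: "b \<in> special_base" and y: "y \<in> spanned special_base" and a: "a < n"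
  obtain c where c: "\<And>a. c a \<in> special_base" "y = x_comb c" "\<And>a. a < n \<Longrightarrow> coord y a = c a" using spanned_special_baseE[OF y] by blast
  have "coord (x_comb (\<lambda>a. b * c a)) a = b * c a"
    using a by (intro coord_x_comb is_subringD(4)[OF K_subring] subsetD[OF special_base_K] b c)
  then show ?thesis using c a by (simp add: x_comb_smult)
qed

lemma coord_const: "b \<in> special_base \<Longrightarrow> a < n \<Longrightarrow> coord b a = (if a = 0 then b else 0)"
  using coord_x_comb[of "\<lambda>a. if a = 0 then b else 0" a] special_base_K is_subringD(2)[OF K_subring] by (auto simp: x_comb_const)

lemma coord_x: assumes "a < n" "b < n" shows "coord (x 1 ^ b) a = (if a = b then 1 else 0)"
proof -
  have "x_comb (\<lambda>a. if a = b then 1 else 0) = x 1 ^ b"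
    using assms by (simp add: x_comb_def if_distrib[of "\<lambda>c. c * _"] sum.delta cong: if_cong)
  then show ?thesis
    using coord_x_comb[of "\<lambda>a. if a = b then 1 else 0" a] assms is_subringD(1,2)[OF K_subring] by auto
qed

lemma spanned_special_base_diff: "y \<in> spanned special_base \<Longrightarrow> z \<in> spanned special_base \<Longrightarrow> y - z \<in> spanned special_base"
  using spanned_add[OF special_base_subring, of y "- 1 * z"] spanned_smult[OF special_base_subring, of "- 1" z]
    is_subringD(1,5)[OF special_base_subring] by auto

lemma sq_zero_mult_closed: assumes "y \<in> spanned special_base" "z \<in> spanned special_base" shows "sq_zero_mult y z \<in> spanned special_base"
proof -
  have "coord y 0 \<in> special_base" "coord z 0 \<in> special_base" using assms coord_in_special_base n4 by auto
  then have "coord y 0 * z \<in> spanned special_base" "coord z 0 * y \<in> spanned special_base" "coord y 0 * coord z 0 \<in> spanned special_base"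
    using assms spanned_smult[OF special_base_subring] spanned_base[OF special_base_subring] is_subringD(4)[OF special_base_subring] by auto
  then show ?thesis unfolding sq_zero_mult_def by (intro spanned_special_base_diff spanned_add special_base_subring)
qed

lemma coord_sq_zero_mult:
  assumes "y \<in> spanned special_base" "z \<in> spanned special_base" shows "coord (sq_zero_mult y z) 0 = coord y 0 * coord z 0"
proof -
  have 0: "0 < n" using n4 by simp
  have c: "coord y 0 \<in> special_base" "coord z 0 \<in> special_base" using assms coord_in_special_base 0 by auto
  let ?w = "(- 1) * (coord y 0 * coord z 0)"
  have w: "?w \<in> special_base" using c is_subringD(4,5)[OF special_base_subring] by simp
  have "sq_zero_mult y z = (coord y 0 * z + coord z 0 * y) + ?w" by (simp add: sq_zero_mult_def)
  then have "coord (sq_zero_mult y z) 0 = coord y 0 * coord z 0 + coord z 0 * coord y 0 + ?w"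
    using assms c w 0 by (simp only: coord_add coord_smult coord_const spanned_add spanned_smult spanned_base special_base_subring if_True simp_thms)
  then show ?thesis by (simp add: mult.commute)
qed

lemma cring_A0: "cring A0"
proof (rule cringI)
  have 0: "0 < n" using n4 by simp
  note k = is_subringD[OF special_base_subring]
  show "abelian_group A0"
  proof (rule abelian_groupI)
    fix u assume "u \<in> carrier A0"
    then obtain y where y: "y \<in> spanned special_base" "u = \<iota> y" by auto
    then have "- y \<in> spanned special_base" using spanned_special_base_diff[of 0 y] spanned_base[OF special_base_subring k(2)] by simp
    then show "\<exists>v\<in>carrier A0. v \<oplus>\<^bsub>A0\<^esub> u = \<zero>\<^bsub>A0\<^esub>" using y by (intro bexI[of _ "\<iota> (- y)"]) auto
  qed (auto simp: spanned_add[OF special_base_subring] spanned_base[OF special_base_subring k(2)] add_ac)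
  show "comm_monoid A0"
  proof (rule comm_monoidI)
    show "\<one>\<^bsub>A0\<^esub> \<in> carrier A0" using spanned_base[OF special_base_subring k(1)] by simp
    show "\<one>\<^bsub>A0\<^esub> \<otimes>\<^bsub>A0\<^esub> u = u" if "u \<in> carrier A0" for u
      using that coord_const[OF k(1) 0] by (auto simp: sq_zero_mult_def)
    show "u \<otimes>\<^bsub>A0\<^esub> v \<otimes>\<^bsub>A0\<^esub> w = u \<otimes>\<^bsub>A0\<^esub> (v \<otimes>\<^bsub>A0\<^esub> w)"
      if "u \<in> carrier A0" "v \<in> carrier A0" "w \<in> carrier A0" for u v w
    proof -
      have "sq_zero_mult (sq_zero_mult y z) w = sq_zero_mult y (sq_zero_mult z w)" if "y \<in> spanned special_base" "z \<in> spanned special_base" "w \<in> spanned special_base" for y z w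
        unfolding sq_zero_mult_def[of "sq_zero_mult y z"] sq_zero_mult_def[of y "sq_zero_mult z w"] coord_sq_zero_mult[OF that(1,2)] coord_sq_zero_mult[OF that(2,3)]
        by (simp add: sq_zero_mult_def algebra_simps)
      then show ?thesis using that by auto
    qed
    show "u \<otimes>\<^bsub>A0\<^esub> v = v \<otimes>\<^bsub>A0\<^esub> u" for u v
      by (simp add: sq_zero_mult_def algebra_simps)
  qed (auto simp: sq_zero_mult_closed)
  fix u v w assume "u \<in> carrier A0" "v \<in> carrier A0" "w \<in> carrier A0"
  then show "(u \<oplus>\<^bsub>A0\<^esub> v) \<otimes>\<^bsub>A0\<^esub> w = u \<otimes>\<^bsub>A0\<^esub> w \<oplus>\<^bsub>A0\<^esub> v \<otimes>\<^bsub>A0\<^esub> w"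
    using 0 by (auto simp: sq_zero_mult_def coord_add algebra_simps)
qed

lemma algebra_A0: "algebra B0 A0"
proof (rule algebraI)
  have 0: "0 < n" using n4 by simp
  show "cring B0" by (rule cring_ring_copy[OF special_base_subring])
  show "cring A0" by (rule cring_A0)
  fix a u v assume "a \<in> carrier B0" "u \<in> carrier A0" "v \<in> carrier A0"
  then show "(a \<odot>\<^bsub>A0\<^esub> u) \<otimes>\<^bsub>A0\<^esub> v = a \<odot>\<^bsub>A0\<^esub> (u \<otimes>\<^bsub>A0\<^esub> v)"
    using 0 by (auto simp: sq_zero_mult_def coord_smult algebra_simps)
qed (auto simp: spanned_smult[OF special_base_subring] algebra_simps)

lemma basis_A0: "is_basis B0 A0 n (\<lambda>a. \<iota> (x 1 ^ a))"
proof (rule basis_module_copy[OF algebra.module[OF algebra_A0] spanned_x[OF special_base_subring] spanned_def is_subringD(2)[OF special_base_subring]])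
  fix c assume c: "\<And>a. c a \<in> special_base" and z: "(\<Sum>a<n. c a * x 1 ^ a) = 0"
  have "x_comb c = x_comb (\<lambda>_. 0)" using z by (simp add: x_comb_def)
  then show "\<forall>a<n. c a = 0"
    using coord_x_comb[of c] coord_x_comb[of "\<lambda>_. 0"] c special_base_K is_subringD(2)[OF K_subring] by (metis subsetD)
qed

text \<open>The reduction modulo \<open>t\<close> of the order: the coordinates with respect to \<open>tx_power\<close> are
  specialized, and \<open>t x\<^sup>a\<close> goes to the basis vector \<open>x\<^sup>a\<close> of the special fibre.\<close>

definition \<psi> :: "'l \<Rightarrow> 'l"
  where "\<psi> z = x_comb (\<lambda>a. \<epsilon> (if a = 0 then coord z a else coord z a / t))"

lemma psi_tx_power:
  assumes c: "\<And>a. c a \<in> base_ring"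
  shows "\<psi> (\<Sum>a<n. c a * tx_power a) = x_comb (\<lambda>a. \<epsilon> (c a))"
proof -
  let ?c = "\<lambda>a. if a = 0 then c a else c a * t"
  have "?c a \<in> K" for a using c is_subringD(4)[OF K_subring] t_base_ring base_ring_K by auto
  then have "coord (x_comb ?c) a = ?c a" if "a < n" for a using that by (intro coord_x_comb)
  then have "\<epsilon> (if a = 0 then coord (x_comb ?c) a else coord (x_comb ?c) a / t) = \<epsilon> (c a)" if "a < n" for a
    using that t_nonzero by simp
  then show ?thesis unfolding \<psi>_def x_comb_tx_power unfolding x_comb_def[of "\<lambda>a. \<epsilon> (c a)"] x_comb_def[of "\<lambda>a. \<epsilon> (if a = 0 then _ a else _ a)"]
    by (intro sum.cong) auto
qed

lemma psi_closed: "z \<in> order_ring \<Longrightarrow> \<psi> z \<in> spanned special_base"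
  by (auto simp: order_ring_def psi_tx_power spanned_x_comb eps_in_special_base)

text \<open>The multiplicative law is \<open>tx_power_mult\<close> modulo \<open>t\<close>.\<close>

lemma psi_hom:
  assumes "y \<in> order_ring" "z \<in> order_ring"
  shows "\<psi> (y + z) = \<psi> y + \<psi> z" "\<psi> (y * z) = sq_zero_mult (\<psi> y) (\<psi> z)"
proof -
  note B = is_subringD[OF base_ring_subring]
  have 0: "0 < n" using n4 by simp
  obtain c d where cd: "\<And>a. c a \<in> base_ring" "\<And>a. d a \<in> base_ring" "y = (\<Sum>a<n. c a * tx_power a)" "z = (\<Sum>a<n. d a * tx_power a)"
    using assms by (auto simp: order_ring_def)
  have BP: "b \<in> base_ring \<Longrightarrow> b \<in> P" for b using base_ring_P by blast
  show "\<psi> (y + z) = \<psi> y + \<psi> z"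
    using psi_tx_power[of "\<lambda>a. c a + d a"] cd B(3)
    by (simp add: psi_tx_power distrib_right sum.distrib x_comb_add eps_add BP)
  obtain g where g: "\<forall>a. g a \<in> base_ring" "y * z = (\<Sum>a<n. (c 0 * d a + d 0 * c a - (if a = 0 then c 0 * d 0 else 0) + t * g a) * tx_power a)"
    using tx_power_mult[of c d] cd by blast
  have in_base_ring: "c 0 * d a + d 0 * c a - (if a = 0 then c 0 * d 0 else 0) + t * g a \<in> base_ring" for a
    using cd g(1) t_base_ring by (auto intro!: B)
  have "\<epsilon> (c 0 * d a + d 0 * c a - (if a = 0 then c 0 * d 0 else 0) + t * g a)
    = \<epsilon> (c 0) * \<epsilon> (d a) + \<epsilon> (d 0) * \<epsilon> (c a) - (if a = 0 then \<epsilon> (c 0) * \<epsilon> (d 0) else 0)" for a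
  proof -
    have "c 0 * d a \<in> P" "d 0 * c a \<in> P" "c 0 * d 0 \<in> P" "t * g a \<in> P"
      using cd g t_base_ring B(4) BP by auto
    then show ?thesis
      using cd g(1) t_base_ring BP is_subringD(2,3,6)[OF P]
      by (auto simp: eps_add eps_diff eps_mult eps_t eps_zero)
  qed
  then have "\<psi> (y * z) = x_comb (\<lambda>a. \<epsilon> (c 0) * \<epsilon> (d a) + \<epsilon> (d 0) * \<epsilon> (c a) - (if a = 0 then \<epsilon> (c 0) * \<epsilon> (d 0) else 0))"
    unfolding g(2) by (subst psi_tx_power[OF in_base_ring]) simp
  also have "\<dots> = \<epsilon> (c 0) * \<psi> z + \<epsilon> (d 0) * \<psi> y - \<epsilon> (c 0) * \<epsilon> (d 0)"
    unfolding cd(3,4) psi_tx_power[OF cd(1)] psi_tx_power[OF cd(2)]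
    by (subst x_comb_const[of "\<epsilon> (c 0) * \<epsilon> (d 0)", symmetric]) (simp only: x_comb_smult x_comb_add x_comb_diff)
  also have "\<dots> = sq_zero_mult (\<psi> y) (\<psi> z)"
  proof -
    have "coord (\<psi> y) 0 = \<epsilon> (c 0)" "coord (\<psi> z) 0 = \<epsilon> (d 0)"
      unfolding cd(3,4) psi_tx_power[OF cd(1)] psi_tx_power[OF cd(2)]
      using cd special_base_K eps_in_special_base 0 by (auto intro!: coord_x_comb)
    then show ?thesis by (simp add: sq_zero_mult_def)
  qed
  finally show "\<psi> (y * z) = sq_zero_mult (\<psi> y) (\<psi> z)" .
qed

lemma psi_smult:
  assumes "b \<in> base_ring" "z \<in> order_ring" shows "\<psi> (b * z) = \<epsilon> b * \<psi> z"
proof -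
  obtain d where d: "\<And>a. d a \<in> base_ring" "z = (\<Sum>a<n. d a * tx_power a)" using assms(2) by (auto simp: order_ring_def)
  have "\<psi> (\<Sum>a<n. (b * d a) * tx_power a) = x_comb (\<lambda>a. \<epsilon> (b * d a))"
    by (rule psi_tx_power) (rule is_subringD(4)[OF base_ring_subring assms(1) d(1)])
  then show ?thesis using assms(1) d(1) base_ring_P
    by (simp add: d(2) psi_tx_power[OF d(1)] sum_distrib_left mult.assoc x_comb_smult eps_mult subset_iff)
qed

lemma psi_basis: assumes "a < n" shows "\<psi> (tx_power a) = x 1 ^ a"
proof -
  note B = is_subringD[OF base_ring_subring]
  have "(\<Sum>b<n. (if b = a then 1 else 0) * tx_power b) = tx_power a"
    using assms by (simp add: if_distrib[of "\<lambda>c. c * _"] sum.delta cong: if_cong)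
  then have "\<psi> (tx_power a) = x_comb (\<lambda>b. \<epsilon> (if b = a then 1 else 0))"
    using psi_tx_power[of "\<lambda>b. if b = a then 1 else 0"] B(1,2) by auto
  also have "\<dots> = x 1 ^ a"
    using assms by (simp add: x_comb_def if_distrib[of \<epsilon>] eps_one eps_zero if_distrib[of "\<lambda>c. c * _"] sum.delta cong: if_cong)
  finally show ?thesis .
qed

lemma psi_one: "\<psi> 1 = 1" using psi_basis[of 0] n4 by (simp add: tx_power_def)

end

section \<open>Comparing closures under base change\<close>

lemma tensor_map_tens:
  assumes "scalar_extension B \<phi> C M" and "scalar_extension B \<phi> C M'"
    and cl: "\<And>u. u \<in> carrier M \<Longrightarrow> f u \<in> carrier M'"
    and add: "\<And>u v. u \<in> carrier M \<Longrightarrow> v \<in> carrier M \<Longrightarrow> f (u \<oplus>\<^bsub>M\<^esub> v) = f u \<oplus>\<^bsub>M'\<^esub> f v"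
    and smult: "\<And>b u. b \<in> carrier B \<Longrightarrow> u \<in> carrier M \<Longrightarrow> f (b \<odot>\<^bsub>M\<^esub> u) = b \<odot>\<^bsub>M'\<^esub> f u"
    and u: "u \<in> carrier M" and c: "c \<in> carrier C"
  shows "tensor_map B \<phi> C M' f (scalar_extension.tens B \<phi> C M u c) = scalar_extension.tens B \<phi> C M' (f u) c"
proof -
  interpret E: scalar_extension B \<phi> C M by fact
  interpret E': scalar_extension B \<phi> C M' by fact
  let ?g = "\<lambda>(u, c). frag_of (f u, c)"
  have ker: "frag_extend ?g z \<in> E'.N" if "z \<in> E.N" for z
    using that by (rule E.frag_extend_kernel) (simp_all add: E'.kernel_diff E'.kernel_rels add smult cl)
  have keys: "Poly_Mapping.keys (frag_extend ?g z) \<subseteq> E'.P" if "Poly_Mapping.keys z \<subseteq> E.P" for z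
    using that
  proof (rule free_Abelian_group_induct)
    show "Poly_Mapping.keys (frag_extend ?g (frag_of a)) \<subseteq> E'.P" if "a \<in> E.P" for a
      using that cl by (cases a) simp
  qed (simp_all add: frag_extend_diff keys_diffI)
  have k: "Poly_Mapping.keys (frag_of (u, c)) \<subseteq> E.P" using u c by simp
  have "E'.cls (frag_extend ?g z) = E'.tens (f u) c" if "z \<in> E.tens u c" for z
  proof -
    have z: "z - frag_of (u, c) \<in> E.N" "Poly_Mapping.keys z \<subseteq> E.P"
      using that E.cls_mem E.cls_keys[OF k] by (auto simp: E.tens_def)
    have "frag_extend ?g z - frag_of (f u, c) \<in> E'.N" using ker[OF z(1)] by (simp add: frag_extend_diff)
    then show ?thesis unfolding E'.tens_def using keys[OF z(2)] cl[OF u] c by (subst E'.cls_eq) simp_all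
  qed
  moreover have "frag_of (u, c) \<in> E.tens u c" unfolding E.tens_def by (rule E.cls_self)
  ultimately have "(\<Union>z\<in>E.tens u c. E'.cls (frag_extend ?g z)) = E'.tens (f u) c" by blast
  then show ?thesis unfolding tensor_map_def .
qed

lemma alg_iso_zero:
  assumes h: "h \<in> alg_iso C T D" and "abelian_group T" "abelian_group D" and U: "U \<in> carrier T" "h U = \<zero>\<^bsub>D\<^esub>"
  shows "U = \<zero>\<^bsub>T\<^esub>"
proof -
  interpret T: abelian_group T by fact
  interpret D: abelian_group D by fact
  have rh: "h \<in> ring_hom T D" and inj: "inj_on h (carrier T)"
    using h by (auto simp: alg_iso_def alg_hom_def bij_betw_def)
  have "h \<zero>\<^bsub>T\<^esub> = \<zero>\<^bsub>D\<^esub>"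
    using ring_hom_add[OF rh, of "\<zero>\<^bsub>T\<^esub>" "\<zero>\<^bsub>T\<^esub>"] ring_hom_closed[OF rh, of "\<zero>\<^bsub>T\<^esub>"] by (simp add: D.add.r_cancel_one')
  then show ?thesis using inj U by (auto simp: inj_on_def)
qed

text \<open>The map \<open>s\<close> is \<open>m \<mapsto> m \<otimes> 1\<close> followed by the isomorphism \<open>G'(A/B) \<otimes>\<^sub>B C \<cong> G'(D/C)\<close>.  In this form base
  change is applied to both fibres without tensor products in the statement, except for the kernel.\<close>

lemma comparison_map:
  fixes G :: "('u, 'g) closure_obj"
  assumes ca: "closure_assignment n G i" and bc: "respects_base_change n G i F"
    and C: "cring C" and \<phi>: "\<phi> \<in> ring_hom B C"
    and A: "rank_algebra n B A" and D: "rank_algebra n C D"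
    and e: "e \<in> alg_iso C (base_change B \<phi> C A) D"
  shows "\<exists>s. s \<in> ring_hom (G B A) (G C D)
    \<and> (\<forall>b\<in>carrier B. \<forall>m\<in>carrier (G B A). s (b \<odot>\<^bsub>G B A\<^esub> m) = \<phi> b \<odot>\<^bsub>G C D\<^esub> s m)
    \<and> (\<forall>j\<in>{1..n}. \<forall>a\<in>carrier A. s (i B A j a) = i C D j (e (scalar_extension.tens B \<phi> C A a \<one>\<^bsub>C\<^esub>)))
    \<and> (\<forall>m\<in>carrier (G B A). s m = \<zero>\<^bsub>G C D\<^esub> \<longrightarrow>
         scalar_extension.tens B \<phi> C (G B A) m \<one>\<^bsub>C\<^esub> = \<zero>\<^bsub>base_change B \<phi> C (G B A)\<^esub>)"
proof -
  let ?M = "G B A" and ?M' = "G C D"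
  have algA: "algebra B A" using A by (simp add: rank_algebra_def)
  then have B: "cring B" by (rule algebra.R_cring)
  have rM: "rank_algebra (fact n) B ?M" "rank_algebra (fact n) C ?M'"
    and im: "\<And>j. j \<in> {1..n} \<Longrightarrow> i B A j \<in> alg_hom B A ?M"
    using ca A D by (auto simp: closure_assignment_def)
  have algM: "algebra B ?M" "algebra C ?M'" using rM by (simp_all add: rank_algebra_def)
  interpret M: algebra B ?M by (rule algM)
  interpret M': algebra C ?M' by (rule algM)
  interpret A: algebra B A by (rule algA)
  interpret EA: algebra_extension B \<phi> C A
    by (intro algebra_extension.intro scalar_extension.intro scalar_extension_axioms.intro C \<phi> algA algebra.module[OF algA])
  interpret EM: algebra_extension B \<phi> C ?M
    by (intro algebra_extension.intro scalar_extension.intro scalar_extension_axioms.intro C \<phi> algM algebra.module[OF algM(1)])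
  have "\<exists>\<theta>. \<theta> \<in> alg_iso C (base_change B \<phi> C ?M) ?M' \<and>
     (\<forall>j\<in>{1..n}. \<forall>z\<in>carrier (base_change B \<phi> C A). \<theta> (tensor_map B \<phi> C ?M (i B A j) z) = i C D j (e z))"
    using bc B C \<phi> A D e unfolding respects_base_change_def by meson
  then obtain \<theta> where \<theta>: "\<theta> \<in> alg_iso C (base_change B \<phi> C ?M) ?M'"
    and \<theta>i: "\<And>j z. j \<in> {1..n} \<Longrightarrow> z \<in> carrier (base_change B \<phi> C A) \<Longrightarrow> \<theta> (tensor_map B \<phi> C ?M (i B A j) z) = i C D j (e z)"
    by blast
  have rh: "\<theta> \<in> ring_hom EM.T ?M'" and sm: "\<And>c U. c \<in> carrier C \<Longrightarrow> U \<in> carrier EM.T \<Longrightarrow> \<theta> (c \<odot>\<^bsub>EM.T\<^esub> U) = c \<odot>\<^bsub>?M'\<^esub> \<theta> U"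
    using \<theta> by (auto simp: alg_iso_def alg_hom_def)
  let ?s = "\<lambda>m. \<theta> (EM.tens m \<one>\<^bsub>C\<^esub>)"
  have one: "\<one>\<^bsub>C\<^esub> \<in> carrier C" by simp
  have "?s \<in> ring_hom ?M ?M'"
  proof (rule ring_hom_memI)
    fix u v assume uv: "u \<in> carrier ?M" "v \<in> carrier ?M"
    show "?s u \<in> carrier ?M'" by (rule ring_hom_closed[OF rh]) (use uv in simp)
    have "EM.tens (u \<otimes>\<^bsub>?M\<^esub> v) \<one>\<^bsub>C\<^esub> = EM.tens u \<one>\<^bsub>C\<^esub> \<otimes>\<^bsub>EM.T\<^esub> EM.tens v \<one>\<^bsub>C\<^esub>"
      using EM.tens_mult[OF uv one one] by simp
    then show "?s (u \<otimes>\<^bsub>?M\<^esub> v) = ?s u \<otimes>\<^bsub>?M'\<^esub> ?s v" using uv by (simp add: ring_hom_mult[OF rh])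
    show "?s (u \<oplus>\<^bsub>?M\<^esub> v) = ?s u \<oplus>\<^bsub>?M'\<^esub> ?s v" using uv by (simp add: EM.tens_add_left ring_hom_add[OF rh])
  next
    show "?s \<one>\<^bsub>?M\<^esub> = \<one>\<^bsub>?M'\<^esub>" using ring_hom_one[OF rh] by (simp add: EM.one_T)
  qed
  moreover have "?s (b \<odot>\<^bsub>?M\<^esub> m) = \<phi> b \<odot>\<^bsub>?M'\<^esub> ?s m" if "b \<in> carrier B" "m \<in> carrier ?M" for b m
  proof -
    have "EM.tens (b \<odot>\<^bsub>?M\<^esub> m) \<one>\<^bsub>C\<^esub> = \<phi> b \<odot>\<^bsub>EM.T\<^esub> EM.tens m \<one>\<^bsub>C\<^esub>"
      using that by (subst EM.tens_smult) (simp_all add: EM.smult_tens)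
    then show ?thesis using that by (simp add: sm)
  qed
  moreover have "?s (i B A j a) = i C D j (e (EA.tens a \<one>\<^bsub>C\<^esub>))" if j: "j \<in> {1..n}" and a: "a \<in> carrier A" for j a
  proof -
    have ij: "i B A j \<in> ring_hom A ?M" "\<And>b u. b \<in> carrier B \<Longrightarrow> u \<in> carrier A \<Longrightarrow> i B A j (b \<odot>\<^bsub>A\<^esub> u) = b \<odot>\<^bsub>?M\<^esub> i B A j u"
      using im[OF j] by (auto simp: alg_hom_def)
    have "tensor_map B \<phi> C ?M (i B A j) (EA.tens a \<one>\<^bsub>C\<^esub>) = EM.tens (i B A j a) \<one>\<^bsub>C\<^esub>"
      by (rule tensor_map_tens[OF EA.scalar_extension_axioms EM.scalar_extension_axioms])
         (use a ij ring_hom_closed[OF ij(1)] ring_hom_add[OF ij(1)] in auto)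
    then show ?thesis using \<theta>i[OF j EA.tens_closed[OF a one]] by simp
  qed
  moreover have "EM.tens m \<one>\<^bsub>C\<^esub> = \<zero>\<^bsub>EM.T\<^esub>" if "m \<in> carrier ?M" "?s m = \<zero>\<^bsub>?M'\<^esub>" for m
    by (rule alg_iso_zero[OF \<theta> EM.abelian_T M'.abelian_group_axioms]) (use that in simp_all)
  ultimately show ?thesis by (intro exI[of _ ?s]) simp
qed

lemma sum_of_finsum:
  fixes h :: "'m \<Rightarrow> 'l::field"
  assumes "abelian_group M" "finite I" "\<And>a. a \<in> I \<Longrightarrow> g a \<in> carrier M"
    and add: "\<And>u v. u \<in> carrier M \<Longrightarrow> v \<in> carrier M \<Longrightarrow> h (u \<oplus>\<^bsub>M\<^esub> v) = h u + h v"
  shows "h (\<Oplus>\<^bsub>M\<^esub>a\<in>I. g a) = (\<Sum>a\<in>I. h (g a))"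
proof -
  interpret M: abelian_group M by fact
  have 0: "h \<zero>\<^bsub>M\<^esub> = 0" using add[of "\<zero>\<^bsub>M\<^esub>" "\<zero>\<^bsub>M\<^esub>"] by (metis M.l_zero M.zero_closed add_cancel_right_right)
  show ?thesis using assms(2,3)
  proof (induction I)
    case (insert a I)
    then show ?case by (subst M.finsum_insert) (auto simp: add)
  qed (simp add: 0)
qed

context galois_copy begin

lemma finsum_smult_const:
  assumes "module (ring_copy S) M" and S: "is_subring S" and "W \<in> carrier M" "finite I" "\<And>a. a \<in> I \<Longrightarrow> c a \<in> S"
  shows "(\<Oplus>\<^bsub>M\<^esub>a\<in>I. \<iota> (c a) \<odot>\<^bsub>M\<^esub> W) = \<iota> (\<Sum>a\<in>I. c a) \<odot>\<^bsub>M\<^esub> W"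
proof -
  interpret M: module "ring_copy S" M by fact
  show ?thesis using assms(4,5)
  proof (induction I)
    case empty
    then show ?case using M.smult_l_null[OF assms(3)] by simp
  next
    case (insert a I)
    have "(\<Sum>a\<in>I. c a) \<in> S" using insert by (intro is_subring_sum S) auto
    then show ?case
      using insert assms(3) M.smult_l_distr[of "\<iota> (c a)" "\<iota> (\<Sum>a\<in>I. c a)" W]
      by (subst M.finsum_insert) auto
  qed
qed


section \<open>The quadratic relation between two roots\<close>

text \<open>The sum is the divided difference \<open>(f(u) - f(v)) / (u - v)\<close>; after multiplication by
  \<open>u - v\<close> it telescopes.\<close>

lemma root_relation:
  assumes "poly min_poly u = 0" "poly min_poly v = 0" "u \<noteq> v"
  shows "(\<Sum>a<n. \<Sum>b<n. Polynomial.coeff min_poly (Suc (a + b)) * (u ^ a * v ^ b)) = 0"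
proof -
  let ?T = "\<lambda>a b. Polynomial.coeff min_poly (a + b) * (u ^ a * v ^ b)"
  have shift: "(\<Sum>a<n. g (Suc a)) = (\<Sum>a<n. g a) + g n - g 0" for g :: "nat \<Rightarrow> 'l"
    using sum.lessThan_Suc_shift[of g n] by simp
  have high: "Polynomial.coeff min_poly k = 0" if "k > n" for k
    using that by (intro coeff_eq_0) (simp add: min_poly_degree)
  have f: "poly min_poly Z = (\<Sum>a<n. Polynomial.coeff min_poly a * Z ^ a) + Z ^ n" for Z
    using min_poly_degree by (simp add: poly_altdef lessThan_Suc_atMost[symmetric])
  have n0: "0 < n" using n4 by simp
  have edge: "(\<Sum>b<n. ?T n b) = u ^ n" "(\<Sum>a<n. ?T a n) = v ^ n"
  proof -
    have "(\<Sum>b<n. ?T n b) = (\<Sum>b\<in>{0}. ?T n b)" by (rule sum.mono_neutral_right) (use n0 high in auto)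
    then show "(\<Sum>b<n. ?T n b) = u ^ n" by (simp add: min_poly_degree)
    have "(\<Sum>a<n. ?T a n) = (\<Sum>a\<in>{0}. ?T a n)" by (rule sum.mono_neutral_right) (use n0 high in auto)
    then show "(\<Sum>a<n. ?T a n) = v ^ n" by (simp add: min_poly_degree)
  qed
  have "(u - v) * (\<Sum>a<n. \<Sum>b<n. Polynomial.coeff min_poly (Suc (a + b)) * (u ^ a * v ^ b))
    = (\<Sum>a<n. \<Sum>b<n. ?T (Suc a) b - ?T a (Suc b))"
    unfolding sum_distrib_left
  proof (intro sum.cong refl)
    fix a b :: nat
    show "(u - v) * (Polynomial.coeff min_poly (Suc (a + b)) * (u ^ a * v ^ b)) = ?T (Suc a) b - ?T a (Suc b)"
      by (simp add: algebra_simps)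
  qed
  also have "\<dots> = (\<Sum>b<n. \<Sum>a<n. ?T (Suc a) b) - (\<Sum>a<n. \<Sum>b<n. ?T a (Suc b))"
    by (subst (2) sum.swap) (simp add: sum_subtractf)
  also have "(\<Sum>b<n. \<Sum>a<n. ?T (Suc a) b) = (\<Sum>b<n. \<Sum>a<n. ?T a b) + (\<Sum>b<n. ?T n b) - (\<Sum>b<n. ?T 0 b)"
    by (subst shift) (simp add: sum.distrib sum_subtractf)
  also have "(\<Sum>a<n. \<Sum>b<n. ?T a (Suc b)) = (\<Sum>a<n. \<Sum>b<n. ?T a b) + (\<Sum>a<n. ?T a n) - (\<Sum>a<n. ?T a 0)"
    by (subst shift) (simp add: sum.distrib sum_subtractf)
  also have "(\<Sum>b<n. \<Sum>a<n. ?T a b) = (\<Sum>a<n. \<Sum>b<n. ?T a b)" by (rule sum.swap)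
  finally have "(u - v) * (\<Sum>a<n. \<Sum>b<n. Polynomial.coeff min_poly (Suc (a + b)) * (u ^ a * v ^ b)) = poly min_poly u - poly min_poly v"
    by (simp add: edge f)
  then show ?thesis using assms by simp
qed

text \<open>The terms of \<open>root_relation\<close> with \<open>a = 0\<close> or \<open>b = 0\<close> are moved to the right-hand side, where the
  roots \<open>u\<close> and \<open>v\<close> occur separately.\<close>

lemma quadratic_relation:
  assumes "poly min_poly u = 0" "poly min_poly v = 0" "u \<noteq> v"
  shows "(\<Sum>a\<in>{1..<n}. \<Sum>b\<in>{1..<n}. Polynomial.coeff min_poly (Suc (a + b)) * (u ^ a * v ^ b))
    = - Polynomial.coeff min_poly (Suc 0) - (\<Sum>a\<in>{1..<n}. Polynomial.coeff min_poly (Suc a) * (u ^ a + v ^ a))"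
proof -
  have split: "(\<Sum>a<n. g a) = g 0 + (\<Sum>a\<in>{1..<n}. g a)" for g :: "nat \<Rightarrow> 'l"
  proof -
    have "{..<n} = insert 0 {1..<n}" using n4 by auto
    then show ?thesis by simp
  qed
  show ?thesis
    using root_relation[OF assms]
    by (simp add: split sum.distrib distrib_left algebra_simps add_eq_0_iff)
qed


section \<open>An obstruction in degree two\<close>

text \<open>The operator \<open>(1 - \<rho>) (1 - \<sigma>)\<close> of the group ring.  For disjoint transpositions it kills every
  function of a single \<open>x k\<close>, as at most one of them moves \<open>x k\<close>, but not the product of two roots that
  are moved by different ones.\<close>

definition skew :: "(nat \<Rightarrow> nat) \<Rightarrow> (nat \<Rightarrow> nat) \<Rightarrow> 'l \<Rightarrow> 'l"
  where "skew \<rho> \<sigma> y = y - act \<rho> y - act \<sigma> y + act (\<rho> \<circ> \<sigma>) y"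

context
  fixes \<alpha> \<beta> \<gamma> \<delta> :: nat and \<rho> \<sigma> :: "nat \<Rightarrow> nat"
  assumes idx: "\<alpha> \<in> {1..n}" "\<beta> \<in> {1..n}" "\<gamma> \<in> {1..n}" "\<delta> \<in> {1..n}"
    and dist: "distinct [\<alpha>, \<beta>, \<gamma>, \<delta>]"
    and rho: "\<rho> = Transposition.transpose \<alpha> \<gamma>" and sig: "\<sigma> = Transposition.transpose \<beta> \<delta>"
begin

lemma perms: "\<rho> permutes {1..n}" "\<sigma> permutes {1..n}" "\<rho> \<circ> \<sigma> permutes {1..n}"
proof -
  show 1: "\<rho> permutes {1..n}" "\<sigma> permutes {1..n}"
    unfolding rho sig by (rule permutes_swap_id[OF idx(1,3)], rule permutes_swap_id[OF idx(2,4)])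
  show "\<rho> \<circ> \<sigma> permutes {1..n}" by (rule permutes_compose[OF 1(2,1)])
qed

lemma skew_add: "skew \<rho> \<sigma> (y + z) = skew \<rho> \<sigma> y + skew \<rho> \<sigma> z"
  by (simp add: skew_def act_add[OF perms(1)] act_add[OF perms(2)] act_add[OF perms(3)])

lemma skew_smult: "b \<in> K \<Longrightarrow> skew \<rho> \<sigma> (b * y) = b * skew \<rho> \<sigma> y"
  by (simp add: skew_def act_mult[OF perms(1)] act_mult[OF perms(2)] act_mult[OF perms(3)]
    K_act[OF _ perms(1)] K_act[OF _ perms(2)] K_act[OF _ perms(3)] algebra_simps)

lemma skew_K: "b \<in> K \<Longrightarrow> skew \<rho> \<sigma> b = 0"
  by (simp add: skew_def K_act[OF _ perms(1)] K_act[OF _ perms(2)] K_act[OF _ perms(3)])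

lemma skew_sum: "skew \<rho> \<sigma> (sum g I) = (\<Sum>a\<in>I. skew \<rho> \<sigma> (g a))"
  by (induction I rule: infinite_finite_induct)
     (simp_all add: skew_add skew_K is_subringD(2)[OF K_subring])

lemma skew_P: "y \<in> P \<Longrightarrow> skew \<rho> \<sigma> y \<in> P"
  unfolding skew_def using act_P[OF perms(1)] act_P[OF perms(2)] act_P[OF perms(3)] is_subringD(3,6)[OF P] by auto

lemma skew_x_power: assumes "k \<in> {1..n}" shows "skew \<rho> \<sigma> (x k ^ a) = 0"
proof -
  have "skew \<rho> \<sigma> (x k ^ a) = x k ^ a - x (\<rho> k) ^ a - x (\<sigma> k) ^ a + x (\<rho> (\<sigma> k)) ^ a"
    using assms by (simp add: skew_def act_power perms act_x[OF perms(1)] act_x[OF perms(2)] act_x[OF perms(3)])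
  also have "\<dots> = 0"
    using dist by (auto simp: rho sig Transposition.transpose_def)
  finally show ?thesis .
qed

lemma skew_product: "skew \<rho> \<sigma> (x \<alpha> * x \<beta>) = (x \<alpha> - x \<gamma>) * (x \<beta> - x \<delta>)"
proof -
  have "skew \<rho> \<sigma> (x \<alpha> * x \<beta>) = x \<alpha> * x \<beta> - x (\<rho> \<alpha>) * x (\<rho> \<beta>) - x (\<sigma> \<alpha>) * x (\<sigma> \<beta>) + x (\<rho> (\<sigma> \<alpha>)) * x (\<rho> (\<sigma> \<beta>))"
    using idx by (simp add: skew_def act_mult perms act_x[OF perms(1)] act_x[OF perms(2)] act_x[OF perms(3)])
  also have "\<dots> = (x \<alpha> - x \<gamma>) * (x \<beta> - x \<delta>)"
    using dist by (auto simp: rho sig Transposition.transpose_def algebra_simps)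
  finally show ?thesis .
qed

text \<open>These sums form a ring because modulo \<open>t\<^sup>2\<close> the product of \<open>b + t y\<close> and \<open>b' + t y'\<close> has the linear
  coefficient \<open>b y' + b' y\<close>, and \<open>skew\<close> is linear over the invariants.\<close>

definition first_order_ring :: "'l set"
  where "first_order_ring = {b + t * y + t ^ 2 * z | b y z. b \<in> base_ring \<and> y \<in> P \<and> skew \<rho> \<sigma> y = 0 \<and> z \<in> P}"

lemma first_order_ringI: "b \<in> base_ring \<Longrightarrow> y \<in> P \<Longrightarrow> skew \<rho> \<sigma> y = 0 \<Longrightarrow> z \<in> P \<Longrightarrow> s = b + t * y + t ^ 2 * z \<Longrightarrow> s \<in> first_order_ring"
  unfolding first_order_ring_def by blast

lemma first_order_ring_subring: "is_subring first_order_ring"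
  unfolding is_subring_def
proof (intro conjI ballI)
  note B = is_subringD[OF base_ring_subring] and Pc = is_subringD[OF P]
  have BP: "b \<in> base_ring \<Longrightarrow> b \<in> P" and BK: "b \<in> base_ring \<Longrightarrow> b \<in> K" for b using base_ring_P base_ring_K by auto
  have s0: "skew \<rho> \<sigma> 0 = 0" by (rule skew_K[OF is_subringD(2)[OF K_subring]])
  show "1 \<in> first_order_ring" by (rule first_order_ringI[of 1 0 0]) (simp_all add: B Pc s0)
  fix s s' assume "s \<in> first_order_ring" "s' \<in> first_order_ring"
  then obtain b y z b' y' z' where *: "b \<in> base_ring" "y \<in> P" "skew \<rho> \<sigma> y = 0" "z \<in> P" "s = b + t * y + t ^ 2 * z"
    "b' \<in> base_ring" "y' \<in> P" "skew \<rho> \<sigma> y' = 0" "z' \<in> P" "s' = b' + t * y' + t ^ 2 * z'"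
    unfolding first_order_ring_def by blast
  show "s + s' \<in> first_order_ring"
    by (rule first_order_ringI[of "b + b'" "y + y'" "z + z'"]) (use * B(3) Pc(3) in \<open>simp_all add: skew_add algebra_simps\<close>)
  have m: "b * y' + b' * y \<in> P" "skew \<rho> \<sigma> (b * y' + b' * y) = 0"
    using * BP BK Pc(3,4) by (simp_all add: skew_add skew_smult)
  have z: "b * z' + b' * z + y * y' + t * (y * z' + y' * z) + t ^ 2 * (z * z') \<in> P"
    using * BP Pc(3,4,7) t_P by simp
  show "s * s' \<in> first_order_ring"
    by (rule first_order_ringI[OF B(4)[OF *(1,6)] m z]) (simp add: * algebra_simps power2_eq_square)
next
  fix s assume "s \<in> first_order_ring"
  then obtain b y z where *: "b \<in> base_ring" "y \<in> P" "skew \<rho> \<sigma> y = 0" "z \<in> P" "s = b + t * y + t ^ 2 * z"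
    unfolding first_order_ring_def by blast
  have "- 1 \<in> K" using is_subringD(1,5)[OF K_subring] by simp
  from skew_smult[OF this, of y] have "skew \<rho> \<sigma> (- y) = 0" using * by simp
  then show "- s \<in> first_order_ring"
    by (intro first_order_ringI[of "- b" "- y" "- z"]) (use * is_subringD(5)[OF base_ring_subring] is_subringD(5)[OF P] in \<open>simp_all\<close>)
qed

lemma first_order_ring_conjugate:
  assumes c: "\<And>a. c a \<in> base_ring" and k: "k \<in> {1..n}"
  shows "c 0 + t * (\<Sum>a\<in>{1..<n}. c a * x k ^ a) \<in> first_order_ring"
proof (rule first_order_ringI[of "c 0" "\<Sum>a\<in>{1..<n}. c a * x k ^ a" 0])
  have BP: "b \<in> base_ring \<Longrightarrow> b \<in> P" and BK: "b \<in> base_ring \<Longrightarrow> b \<in> K" for b using base_ring_P base_ring_K by auto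
  show "(\<Sum>a\<in>{1..<n}. c a * x k ^ a) \<in> P"
    using c BP x_P[OF k] is_subringD(4,7)[OF P] by (intro is_subring_sum P) simp
  show "skew \<rho> \<sigma> (\<Sum>a\<in>{1..<n}. c a * x k ^ a) = 0"
    unfolding skew_sum by (intro sum.neutral ballI) (simp add: skew_smult[OF BK[OF c]] skew_x_power[OF k])
qed (use c is_subringD(2)[OF P] in auto)

text \<open>Applying \<open>skew\<close> leaves \<open>2 (x \<alpha> - x \<gamma>) (x \<beta> - x \<delta>) \<in> t P\<close>, which fails after specialization to \<open>t = 0\<close>.\<close>

lemma first_order_ring_obstruction: "2 * t * (x \<alpha> * x \<beta>) \<notin> first_order_ring"
proof
  note Pc = is_subringD[OF P]
  have BK: "b \<in> base_ring \<Longrightarrow> b \<in> K" for b using base_ring_K by auto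
  have tK: "t \<in> K" using t_base_ring BK by blast
  assume "2 * t * (x \<alpha> * x \<beta>) \<in> first_order_ring"
  then obtain b y z where *: "b \<in> base_ring" "y \<in> P" "skew \<rho> \<sigma> y = 0" "z \<in> P" "2 * t * (x \<alpha> * x \<beta>) = b + t * y + t ^ 2 * z"
    unfolding first_order_ring_def by blast
  have "2 \<in> K" using is_subringD(3)[OF K_subring, of 1 1] is_subringD(1)[OF K_subring] by simp
  then have tK2: "2 * t \<in> K" "t ^ 2 \<in> K" using is_subringD(4,7)[OF K_subring] tK by auto
  have "(2 * t) * skew \<rho> \<sigma> (x \<alpha> * x \<beta>) = skew \<rho> \<sigma> (b + t * y + t ^ 2 * z)"
    using skew_smult[OF tK2(1), of "x \<alpha> * x \<beta>"] *(5) by simp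
  also have "\<dots> = t ^ 2 * skew \<rho> \<sigma> z"
    using * by (simp add: skew_add skew_smult tK tK2 skew_K BK)
  finally have eq: "2 * ((x \<alpha> - x \<gamma>) * (x \<beta> - x \<delta>)) = t * skew \<rho> \<sigma> z"
    using t_nonzero by (simp add: skew_product power2_eq_square)
  have xP: "x \<alpha> - x \<gamma> \<in> P" "x \<beta> - x \<delta> \<in> P" using x_P idx Pc(6) by auto
  have xx: "(x \<alpha> - x \<gamma>) * (x \<beta> - x \<delta>) \<in> P" by (rule Pc(4)[OF xP])
  have "\<epsilon> 2 = 2" "2 \<in> P" using eps_add[of 1 1] Pc(3)[of 1 1] Pc(1) by (simp_all add: eps_one)
  moreover have "\<epsilon> ((x \<alpha> - x \<gamma>) * (x \<beta> - x \<delta>)) = (x \<alpha> - x \<gamma>) * (x \<beta> - x \<delta>)"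
    using xP x_P idx by (simp add: eps_mult eps_diff eps_x)
  ultimately have "\<epsilon> (2 * ((x \<alpha> - x \<gamma>) * (x \<beta> - x \<delta>))) = 2 * ((x \<alpha> - x \<gamma>) * (x \<beta> - x \<delta>))"
    using eps_mult[OF _ xx, of 2] by simp
  moreover have "\<epsilon> (t * skew \<rho> \<sigma> z) = 0" using skew_P[OF *(4)] t_P by (simp add: eps_mult eps_t)
  ultimately have "2 * ((x \<alpha> - x \<gamma>) * (x \<beta> - x \<delta>)) = 0" using eq by simp
  moreover have "x \<alpha> \<noteq> x \<gamma>" "x \<beta> \<noteq> x \<delta>" using dist idx x_inj by (auto simp: inj_on_eq_iff)
  ultimately show False using two_nonzero by simp
qed

end


section \<open>Endomorphisms of the degenerate algebra\<close>

text \<open>The endomorphism \<open>x \<mapsto> x\<close>, \<open>x\<^bsup>n-2\<^esup> \<mapsto> \<beta> x\<close>, \<open>x\<^sup>a \<mapsto> 0\<close> for the other positive \<open>a\<close>, which is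
  multiplicative because products of positive powers vanish in the special fibre.\<close>

definition endo :: "'l \<Rightarrow> 'l \<Rightarrow> 'l"
  where "endo \<beta> y = coord y 0 + (coord y 1 + \<beta> * coord y (n - 2)) * x 1"

lemma endo_hom:
  assumes \<beta>: "\<beta> \<in> special_base"
  shows "(\<lambda>u. \<iota> (endo \<beta> (\<kappa> u))) \<in> alg_hom B0 A0 A0"
proof -
  note k = is_subringD[OF special_base_subring]
  have i: "0 < n" "1 < n" "n - 2 < n" using n4 by auto
  have cl: "endo \<beta> y \<in> spanned special_base" if "y \<in> spanned special_base" for y
  proof -
    have "coord y 0 \<in> special_base" "coord y 1 + \<beta> * coord y (n - 2) \<in> special_base" using coord_in_special_base[OF that] i \<beta> k(3,4) by auto
    then show ?thesis unfolding endo_def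
      using spanned_x[OF special_base_subring i(2)] spanned_base[OF special_base_subring] spanned_smult[OF special_base_subring]
      by (intro spanned_add[OF special_base_subring]) simp_all
  qed
  have add: "endo \<beta> (y + z) = endo \<beta> y + endo \<beta> z" if "y \<in> spanned special_base" "z \<in> spanned special_base" for y z
    using that i by (simp add: endo_def coord_add algebra_simps)
  have sm: "endo \<beta> (b * y) = b * endo \<beta> y" if "b \<in> special_base" "y \<in> spanned special_base" for b y
    using that i by (simp add: endo_def coord_smult algebra_simps)
  have const: "endo \<beta> b = b" if "b \<in> special_base" for b
    using that n4 i by (simp add: endo_def coord_const)
  have crd0: "coord (endo \<beta> y) 0 = coord y 0" if "y \<in> spanned special_base" for y
  proof -
    have c: "coord y 0 \<in> special_base" "coord y 1 + \<beta> * coord y (n - 2) \<in> special_base" using coord_in_special_base[OF that] i \<beta> k(3,4) by auto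
    have "coord (x 1) 0 = 0" using coord_x[OF i(1,2)] by simp
    then show ?thesis unfolding endo_def
      using c i spanned_x[OF special_base_subring i(2)] by (simp add: coord_add coord_smult coord_const spanned_base spanned_smult special_base_subring)
  qed
  have mult: "endo \<beta> (sq_zero_mult y z) = sq_zero_mult (endo \<beta> y) (endo \<beta> z)" if yz: "y \<in> spanned special_base" "z \<in> spanned special_base" for y z
  proof -
    have c: "coord y 0 \<in> special_base" "coord z 0 \<in> special_base" using yz coord_in_special_base i by auto
    let ?w = "(- 1) * (coord y 0 * coord z 0)"
    have w: "?w \<in> special_base" using c k(4,5) by simp
    have "sq_zero_mult y z = (coord y 0 * z + coord z 0 * y) + ?w" by (simp add: sq_zero_mult_def)
    then have "endo \<beta> (sq_zero_mult y z) = coord y 0 * endo \<beta> z + coord z 0 * endo \<beta> y + ?w"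
      using yz c w by (simp only: add sm const spanned_add spanned_smult spanned_base special_base_subring)
    then show ?thesis using yz by (simp add: sq_zero_mult_def crd0)
  qed
  show ?thesis
    unfolding alg_hom_def using const[OF k(1)]
    by (auto simp: cl add mult sm intro!: ring_hom_memI)
qed

lemma endo_power:
  assumes "a \<in> {1..<n}"
  shows "endo \<beta> (x 1 ^ a) = (if a = 1 then 1 else if a = n - 2 then \<beta> else 0) * x 1"
proof -
  have "coord (x 1 ^ a) 0 = 0" "coord (x 1 ^ a) 1 = (if a = 1 then 1 else 0)"
    "coord (x 1 ^ a) (n - 2) = (if a = n - 2 then 1 else 0)"
    using assms n4 by (simp_all add: coord_x)
  moreover have "n - 2 \<noteq> 1" using n4 by simp
  ultimately show ?thesis by (simp add: endo_def)
qed

text \<open>The quadratic form with matrix \<open>f\<^bsub>a+b+1\<^esub>\<close> is evaluated at \<open>(1, 0, \<dots>, 0, \<beta>, 0)\<close>, with \<open>\<beta>\<close> in the position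
  \<open>n - 2\<close>.  This position is chosen because the mixed coefficient is \<open>f\<^sub>n = 1\<close>, while the coefficient of
  \<open>\<beta>\<^sup>2\<close> is \<open>f\<^bsub>2n-3\<^esub> = 0\<close>.\<close>

lemma quadratic_form_value:
  assumes g: "\<And>a. \<gamma> a = (if a = 1 then 1 else if a = n - 2 then \<beta> else 0)"
  shows "(\<Sum>a\<in>{1..<n}. \<Sum>b\<in>{1..<n}. \<epsilon> (Polynomial.coeff min_poly (Suc (a + b))) * \<gamma> a * \<gamma> b)
    = \<epsilon> (Polynomial.coeff min_poly 3) + 2 * \<beta>"
proof -
  have sum: "(\<Sum>a\<in>{1..<n}. h a * \<gamma> a) = h 1 + h (n - 2) * \<beta>" for h :: "nat \<Rightarrow> 'l"
  proof -
    have "(\<Sum>a\<in>{1..<n}. h a * \<gamma> a) = (\<Sum>a\<in>{1, n - 2}. h a * \<gamma> a)"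
      by (rule sum.mono_neutral_right) (use n4 g in auto)
    also have "\<dots> = h 1 + h (n - 2) * \<beta>" using n4 g by simp
    finally show ?thesis .
  qed
  have "(\<Sum>a\<in>{1..<n}. \<Sum>b\<in>{1..<n}. \<epsilon> (Polynomial.coeff min_poly (Suc (a + b))) * \<gamma> a * \<gamma> b)
    = (\<Sum>a\<in>{1..<n}. (\<epsilon> (Polynomial.coeff min_poly (Suc (a + 1))) + \<epsilon> (Polynomial.coeff min_poly (Suc (a + (n - 2)))) * \<beta>) * \<gamma> a)"
  proof (intro sum.cong refl)
    fix a
    show "(\<Sum>b\<in>{1..<n}. \<epsilon> (Polynomial.coeff min_poly (Suc (a + b))) * \<gamma> a * \<gamma> b)
      = (\<epsilon> (Polynomial.coeff min_poly (Suc (a + 1))) + \<epsilon> (Polynomial.coeff min_poly (Suc (a + (n - 2)))) * \<beta>) * \<gamma> a"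
      unfolding sum by (simp add: algebra_simps)
  qed
  also have "\<dots> = \<epsilon> (Polynomial.coeff min_poly 3) + \<epsilon> (Polynomial.coeff min_poly n) * \<beta>
     + (\<epsilon> (Polynomial.coeff min_poly n) + \<epsilon> (Polynomial.coeff min_poly (Suc (n - 2 + (n - 2)))) * \<beta>) * \<beta>"
  proof -
    have "Suc (1 + (n - 2)) = n" "Suc (n - 2 + 1) = n" "Suc (1 + 1) = 3" using n4 by auto
    then show ?thesis unfolding sum by (simp only:)
  qed
  also have "Polynomial.coeff min_poly (Suc (n - 2 + (n - 2))) = 0"
    using n4 by (intro coeff_eq_0) (simp add: min_poly_degree)
  finally show ?thesis by (simp add: min_poly_degree eps_one eps_zero)
qed

end

section \<open>The two fibres of a closure\<close>

context galois_copy begin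

lemma rank_AA: "rank_algebra n BB AA"
  using algebra_AA locally_free_of_basis[OF base_ring_subring algebra.module[OF algebra_AA] basis_AA]
  by (simp add: rank_algebra_def)

lemma rank_AK: "rank_algebra n BK AK"
  using algebra_copy[OF spanned_K] locally_free_of_basis[OF K_subring algebra.module[OF algebra_copy[OF spanned_K]] basis_AK]
  by (simp add: rank_algebra_def)

lemma rank_A0: "rank_algebra n B0 A0"
  using algebra_A0 locally_free_of_basis[OF special_base_subring algebra.module[OF algebra_A0] basis_A0]
  by (simp add: rank_algebra_def)

lemma order_ring_poly:
  assumes c: "\<And>a. c a \<in> base_ring"
  shows "\<exists>q. (\<forall>k. Polynomial.coeff q k \<in> K) \<and> (\<forall>z. poly q z = c 0 + t * (\<Sum>a\<in>{1..<n}. c a * z ^ a))"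
proof (intro exI conjI allI)
  let ?q = "[:c 0:] + Polynomial.smult t (\<Sum>a\<in>{1..<n}. Polynomial.monom (c a) a)"
  have cK: "c a \<in> K" for a using c base_ring_K by blast
  have tK: "t \<in> K" using t_base_ring base_ring_K by blast
  note k = is_subringD[OF K_subring]
  show "poly ?q z = c 0 + t * (\<Sum>a\<in>{1..<n}. c a * z ^ a)" for z
    by (simp add: poly_sum poly_monom)
  have "Polynomial.coeff [:c 0:] i \<in> K" for i using cK k(2) by (cases i) auto
  moreover have "Polynomial.coeff (\<Sum>a\<in>{1..<n}. Polynomial.monom (c a) a) i \<in> K" for i
    unfolding Polynomial.coeff_sum using cK k(2) by (intro is_subring_sum[OF K_subring]) simp
  ultimately show "Polynomial.coeff ?q i \<in> K" for i using k(3,4) tK by simp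
qed

lemma order_ring_value: "(\<Sum>a<n. c a * tx_power a) = c 0 + t * (\<Sum>a\<in>{1..<n}. c a * x 1 ^ a)"
proof -
  have "{..<n} = insert 0 {1..<n}" using n4 by auto
  then show ?thesis by (simp add: tx_power_def sum_distrib_left mult_ac)
qed

text \<open>The map \<open>ev\<close> is \<open>M \<rightarrow> M \<otimes>\<^sub>B K = G'(K(x)/K) = L\<close>.  It is injective because \<open>M\<close> is locally free over the
  domain \<open>B\<close>, so that identities in \<open>M\<close> can be verified in \<open>L\<close>.  The \<open>n\<close> maps \<open>i\<^sub>j\<close> become the \<open>n\<close> different
  embeddings of \<open>K(x)\<close>, which gives the permutation \<open>\<pi>\<close> of the roots.\<close>

lemma generic_fibre:
  fixes G :: "('u, 'g) closure_obj"
  assumes ca: "closure_assignment n G i" and bc: "respects_base_change n G i F"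
    and gal: "extends_galois_closure n G i"
  shows "\<exists>ev \<pi>. inj_on \<pi> {1..n} \<and> \<pi> ` {1..n} \<subseteq> {1..n}
    \<and> (\<forall>u\<in>carrier (G BB AA). \<forall>v\<in>carrier (G BB AA).
         ev (u \<oplus>\<^bsub>G BB AA\<^esub> v) = ev u + ev v \<and> ev (u \<otimes>\<^bsub>G BB AA\<^esub> v) = ev u * ev v)
    \<and> ev \<one>\<^bsub>G BB AA\<^esub> = 1
    \<and> (\<forall>b\<in>base_ring. \<forall>u\<in>carrier (G BB AA). ev (\<iota> b \<odot>\<^bsub>G BB AA\<^esub> u) = b * ev u)
    \<and> (\<forall>u\<in>carrier (G BB AA). ev u = 0 \<longrightarrow> u = \<zero>\<^bsub>G BB AA\<^esub>)
    \<and> (\<forall>j\<in>{1..n}. \<forall>c. (\<forall>a. c a \<in> base_ring) \<longrightarrow>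
         ev (i BB AA j (\<iota> (\<Sum>a<n. c a * tx_power a))) = c 0 + t * (\<Sum>a\<in>{1..<n}. c a * x (\<pi> j) ^ a))"
proof -
  let ?M = "G BB AA" and ?MK = "G BK AK"
  have rM: "rank_algebra (fact n) BB ?M" "rank_algebra (fact n) BK ?MK"
    and iK: "\<And>j. j \<in> {1..n} \<Longrightarrow> i BK AK j \<in> alg_hom BK AK ?MK"
    using ca rank_AA rank_AK by (auto simp: closure_assignment_def)
  have algM: "algebra BB ?M" "algebra BK ?MK" and lfM: "locally_free BB ?M (fact n)"
    using rM by (simp_all add: rank_algebra_def)
  interpret M: algebra BB ?M by (rule algM)
  interpret MK: algebra BK ?MK by (rule algM)
  have cBK: "cring BK" by (rule cring_ring_copy[OF K_subring])
  have inc: "(\<lambda>v. v) \<in> ring_hom BB BK" by (rule ring_hom_memI) (use base_ring_K in auto)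
  interpret E: algebra_extension BB "\<lambda>v. v" BK AA
    by (intro algebra_extension.intro scalar_extension.intro scalar_extension_axioms.intro cBK inc algebra_AA algebra.module[OF algebra_AA])
  have incA: "(\<lambda>v. v) \<in> ring_hom AA AK" by (rule ring_hom_memI) (use order_ring_AK in auto)
  obtain e where e: "e \<in> alg_iso BK E.T AK"
    and e_tens: "\<And>u c. u \<in> carrier AA \<Longrightarrow> c \<in> carrier BK \<Longrightarrow> e (E.tens u c) = c \<odot>\<^bsub>AK\<^esub> u"
  proof (rule E.base_change_iso[OF algebra_copy[OF spanned_K] incA _ basis_AA])
    show "is_basis BK AK n (\<lambda>a. \<iota> (tx_power a))" by (rule basis_AK)
  qed auto
  obtain s where s: "s \<in> ring_hom ?M ?MK"
    and s_sm: "\<And>b m. b \<in> carrier BB \<Longrightarrow> m \<in> carrier ?M \<Longrightarrow> s (b \<odot>\<^bsub>?M\<^esub> m) = b \<odot>\<^bsub>?MK\<^esub> s m"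
    and s_i: "\<And>j a. j \<in> {1..n} \<Longrightarrow> a \<in> carrier AA \<Longrightarrow> s (i BB AA j a) = i BK AK j (e (E.tens a \<one>\<^bsub>BK\<^esub>))"
    and s_0: "\<And>m. m \<in> carrier ?M \<Longrightarrow> s m = \<zero>\<^bsub>?MK\<^esub> \<Longrightarrow>
       scalar_extension.tens BB (\<lambda>v. v) BK ?M m \<one>\<^bsub>BK\<^esub> = \<zero>\<^bsub>base_change BB (\<lambda>v. v) BK ?M\<^esub>"
    using comparison_map[OF ca bc cBK inc rank_AA rank_AK e] by blast
  obtain \<theta> where \<theta>: "\<theta> \<in> alg_iso BK ?MK LL"
    and \<theta>_bij: "bij_betw (\<lambda>j. restrict (\<theta> \<circ> i BK AK j) (carrier AK)) {1..n}
            (alg_hom BK AK LL \<inter> extensional (carrier AK))"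
    using gal Sn_extension_AK galois_closure_LL unfolding extends_galois_closure_def by blast
  have \<theta>r: "\<theta> \<in> ring_hom ?MK LL" and \<theta>s: "\<And>b m. b \<in> carrier BK \<Longrightarrow> m \<in> carrier ?MK \<Longrightarrow> \<theta> (b \<odot>\<^bsub>?MK\<^esub> m) = b \<odot>\<^bsub>LL\<^esub> \<theta> m"
    using \<theta> by (auto simp: alg_iso_def alg_hom_def)
  let ?h = "\<lambda>j. restrict (\<theta> \<circ> i BK AK j) (carrier AK)"
  have "?h j \<in> alg_hom BK AK LL" if "j \<in> {1..n}" for j
    using bij_betwE[OF \<theta>_bij] that by blast
  then have "\<forall>j\<in>{1..n}. \<exists>k\<in>{1..n}. \<forall>q. (\<forall>l. Polynomial.coeff q l \<in> K) \<longrightarrow> ?h j (\<iota> (poly q (x 1))) = \<iota> (poly q (x k))"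
    using embedding_AK by blast
  then obtain \<pi> where \<pi>: "\<And>j. j \<in> {1..n} \<Longrightarrow> \<pi> j \<in> {1..n}"
    and \<pi>h: "\<And>j q. j \<in> {1..n} \<Longrightarrow> \<forall>l. Polynomial.coeff q l \<in> K \<Longrightarrow> ?h j (\<iota> (poly q (x 1))) = \<iota> (poly q (x (\<pi> j)))"
    by metis
  have inj\<pi>: "inj_on \<pi> {1..n}"
  proof (rule inj_onI)
    fix j j' assume j: "j \<in> {1..n}" "j' \<in> {1..n}" "\<pi> j = \<pi> j'"
    have "?h j u = ?h j' u" for u
    proof (cases "u \<in> carrier AK")
      case True
      then obtain c where c: "\<forall>a. c a \<in> K" "u = \<iota> (\<Sum>a<n. c a * x 1 ^ a)" by (auto simp: spanned_def)
      let ?q = "\<Sum>a<n. Polynomial.monom (c a) a"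
      have qK: "\<forall>l. Polynomial.coeff ?q l \<in> K"
        using c(1) is_subringD(2)[OF K_subring] by (simp add: Polynomial.coeff_sum)
      have "?h j (\<iota> (poly ?q (x 1))) = ?h j' (\<iota> (poly ?q (x 1)))"
        unfolding \<pi>h[OF j(1) qK] \<pi>h[OF j(2) qK] j(3) ..
      moreover have "poly ?q (x 1) = (\<Sum>a<n. c a * x 1 ^ a)" by (simp add: poly_sum poly_monom)
      ultimately show ?thesis by (simp only: c(2))
    qed simp
    then have "?h j = ?h j'" by (rule ext)
    from inj_onD[OF bij_betw_imp_inj_on[OF \<theta>_bij] this j(1,2)] show "j = j'" .
  qed
  let ?ev = "\<lambda>m. \<kappa> (\<theta> (s m))"
  note sc = ring_hom_closed[OF s]
  have ev_add: "?ev (u \<oplus>\<^bsub>?M\<^esub> v) = ?ev u + ?ev v" if "u \<in> carrier ?M" "v \<in> carrier ?M" for u v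
    using that by (simp add: ring_hom_add[OF s] ring_hom_add[OF \<theta>r] sc)
  have ev_mult: "?ev (u \<otimes>\<^bsub>?M\<^esub> v) = ?ev u * ?ev v" if "u \<in> carrier ?M" "v \<in> carrier ?M" for u v
    using that by (simp add: ring_hom_mult[OF s] ring_hom_mult[OF \<theta>r] sc)
  have ev_one: "?ev \<one>\<^bsub>?M\<^esub> = 1" by (simp add: ring_hom_one[OF s] ring_hom_one[OF \<theta>r])
  have ev_sm: "?ev (\<iota> b \<odot>\<^bsub>?M\<^esub> u) = b * ?ev u" if "b \<in> base_ring" "u \<in> carrier ?M" for b u
    using that base_ring_K by (subst s_sm) (auto simp: \<theta>s sc subset_iff)
  have ev_inj: "u = \<zero>\<^bsub>?M\<^esub>" if u: "u \<in> carrier ?M" "?ev u = 0" for u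
  proof -
    have "\<theta> (s u) \<in> carrier LL" using ring_hom_closed[OF \<theta>r] sc u by blast
    then have "\<theta> (s u) = \<zero>\<^bsub>LL\<^esub>" using u(2) by auto
    then have "s u = \<zero>\<^bsub>?MK\<^esub>"
      using alg_iso_zero[OF \<theta> MK.abelian_group_axioms _ sc[OF u(1)]]
        algebra.axioms(1)[OF algebra_copy[OF UNIV_subring subset_UNIV]] module.axioms(2) by blast
    from s_0[OF u(1) this] show ?thesis
      by (intro locally_free_embeds[OF base_ring_subring K_subring base_ring_K K_divide M.module lfM u(1)])
  qed
  have ev_i: "?ev (i BB AA j (\<iota> (\<Sum>a<n. c a * tx_power a))) = c 0 + t * (\<Sum>a\<in>{1..<n}. c a * x (\<pi> j) ^ a)"
    if j: "j \<in> {1..n}" and c: "\<forall>a. c a \<in> base_ring" for j c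
  proof -
    let ?y = "\<Sum>a<n. c a * tx_power a"
    have yA: "\<iota> ?y \<in> carrier AA" using order_ringI[of c] c by simp
    then have yK: "\<iota> ?y \<in> carrier AK" using order_ring_AK by auto
    obtain q where q: "\<forall>k. Polynomial.coeff q k \<in> K" "\<And>z. poly q z = c 0 + t * (\<Sum>a\<in>{1..<n}. c a * z ^ a)"
      using order_ring_poly[of c] c by blast
    have y: "?y = poly q (x 1)" unfolding q(2) by (rule order_ring_value)
    have "e (E.tens (\<iota> ?y) \<one>\<^bsub>BK\<^esub>) = \<iota> ?y"
      using e_tens[OF yA] is_subringD(1)[OF K_subring] by simp
    then have "s (i BB AA j (\<iota> ?y)) = i BK AK j (\<iota> ?y)" using s_i[OF j yA] by simp
    then have "\<theta> (s (i BB AA j (\<iota> ?y))) = ?h j (\<iota> ?y)" using yK by simp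
    also have "\<dots> = \<iota> (poly q (x (\<pi> j)))" unfolding y by (rule \<pi>h[OF j q(1)])
    finally show ?thesis by (simp add: q(2))
  qed
  show ?thesis
    by (intro exI[of _ ?ev] exI[of _ \<pi>] conjI ballI allI impI)
       (rule inj\<pi> | rule ev_one | (rule image_subsetI, rule \<pi>, assumption)
         | (rule ev_add ev_mult ev_sm ev_inj ev_i, assumption+))+
qed

text \<open>The kernel of \<open>M \<rightarrow> M \<otimes>\<^sub>B B / t B\<close> is \<open>t M\<close>: since \<open>b - \<epsilon> b\<close> is in \<open>t B\<close>, the map
  \<open>v \<otimes> c \<mapsto> c v\<close> respects the relations modulo \<open>t M\<close>, and it sends \<open>u \<otimes> 1\<close> to \<open>u\<close>.\<close>

lemma special_fibre:
  fixes G :: "('u, 'g) closure_obj"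
  assumes ca: "closure_assignment n G i" and bc: "respects_base_change n G i F"
  shows "\<exists>s. s \<in> ring_hom (G BB AA) (G B0 A0)
    \<and> (\<forall>b\<in>base_ring. \<forall>u\<in>carrier (G BB AA). s (\<iota> b \<odot>\<^bsub>G BB AA\<^esub> u) = \<iota> (\<epsilon> b) \<odot>\<^bsub>G B0 A0\<^esub> s u)
    \<and> (\<forall>u\<in>carrier (G BB AA). s u = \<zero>\<^bsub>G B0 A0\<^esub> \<longrightarrow> (\<exists>r\<in>carrier (G BB AA). u = \<iota> t \<odot>\<^bsub>G BB AA\<^esub> r))
    \<and> (\<forall>j\<in>{1..n}. \<forall>y\<in>order_ring. s (i BB AA j (\<iota> y)) = i B0 A0 j (\<iota> (\<psi> y)))"
proof -
  let ?M = "G BB AA" and ?D = "G B0 A0"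
  have rM: "rank_algebra (fact n) BB ?M" using ca rank_AA by (auto simp: closure_assignment_def)
  then have algM: "algebra BB ?M" by (simp add: rank_algebra_def)
  interpret M: algebra BB ?M by (rule algM)
  have cB0: "cring B0" by (rule cring_ring_copy[OF special_base_subring])
  let ?f = "\<lambda>u. \<iota> (\<epsilon> (\<kappa> u))"
  have BP: "b \<in> base_ring \<Longrightarrow> b \<in> P" for b using base_ring_P by blast
  have f: "?f \<in> ring_hom BB B0"
    by (rule ring_hom_memI) (auto simp: eps_in_special_base eps_add eps_mult eps_one BP)
  interpret E: algebra_extension BB ?f B0 AA
    by (intro algebra_extension.intro scalar_extension.intro scalar_extension_axioms.intro cB0 f algebra_AA algebra.module[OF algebra_AA])
  interpret EM: scalar_extension BB ?f B0 ?M
    by (intro scalar_extension.intro scalar_extension_axioms.intro cB0 f M.module)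
  let ?p = "\<lambda>u. \<iota> (\<psi> (\<kappa> u))"
  have p: "?p \<in> ring_hom AA A0"
    by (rule ring_hom_memI) (auto simp: psi_closed psi_hom psi_one)
  interpret A0: module B0 A0 by (rule algebra.module[OF algebra_A0])
  obtain e where e: "e \<in> alg_iso B0 E.T A0"
    and e_tens: "\<And>u c. u \<in> carrier AA \<Longrightarrow> c \<in> carrier B0 \<Longrightarrow> e (E.tens u c) = c \<odot>\<^bsub>A0\<^esub> ?p u"
  proof (rule E.base_change_iso[OF algebra_A0 p _ basis_AA])
    show "is_basis B0 A0 n (\<lambda>a. ?p (\<iota> (tx_power a)))"
      by (rule A0.is_basis_cong[OF basis_A0]) (simp add: psi_basis)
  qed (auto simp: psi_smult)
  obtain s where s: "s \<in> ring_hom ?M ?D"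
    and s_sm: "\<And>b m. b \<in> carrier BB \<Longrightarrow> m \<in> carrier ?M \<Longrightarrow> s (b \<odot>\<^bsub>?M\<^esub> m) = ?f b \<odot>\<^bsub>?D\<^esub> s m"
    and s_i: "\<And>j a. j \<in> {1..n} \<Longrightarrow> a \<in> carrier AA \<Longrightarrow> s (i BB AA j a) = i B0 A0 j (e (E.tens a \<one>\<^bsub>B0\<^esub>))"
    and s_0: "\<And>m. m \<in> carrier ?M \<Longrightarrow> s m = \<zero>\<^bsub>?D\<^esub> \<Longrightarrow> EM.tens m \<one>\<^bsub>B0\<^esub> = \<zero>\<^bsub>EM.T\<^esub>"
    using comparison_map[OF ca bc cB0 f rank_AA rank_A0 e] by blast
  have one0: "\<one>\<^bsub>B0\<^esub> \<in> carrier B0" using is_subringD(1)[OF special_base_subring] by simp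
  have ker: "\<exists>r\<in>carrier ?M. u = \<iota> t \<odot>\<^bsub>?M\<^esub> r" if u: "u \<in> carrier ?M" "s u = \<zero>\<^bsub>?D\<^esub>" for u
  proof -
    have tB: "\<iota> t \<in> carrier BB" using t_base_ring by simp
    let ?J = "{\<iota> t \<odot>\<^bsub>?M\<^esub> r | r. r \<in> carrier ?M}"
    have Jin: "\<iota> t \<odot>\<^bsub>?M\<^esub> r \<in> ?J" if "r \<in> carrier ?M" for r using that by blast
    have J: "subgroup ?J (add_monoid ?M)"
    proof (rule M.M.add.subgroupI)
      show "?J \<subseteq> carrier ?M" using M.smult_closed[OF tB] by auto
      show "?J \<noteq> {}" using Jin[OF M.M.zero_closed] by blast
      fix v assume "v \<in> ?J"
      then obtain r where r: "r \<in> carrier ?M" "v = \<iota> t \<odot>\<^bsub>?M\<^esub> r" by blast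
      then have "\<ominus>\<^bsub>?M\<^esub> v = \<iota> t \<odot>\<^bsub>?M\<^esub> (\<ominus>\<^bsub>?M\<^esub> r)" using tB by (simp add: M.smult_r_minus)
      then show "\<ominus>\<^bsub>?M\<^esub> v \<in> ?J" using Jin[OF M.M.a_inv_closed[OF r(1)]] by simp
      fix w assume "w \<in> ?J"
      then obtain r' where r': "r' \<in> carrier ?M" "w = \<iota> t \<odot>\<^bsub>?M\<^esub> r'" by blast
      have "v \<oplus>\<^bsub>?M\<^esub> w = \<iota> t \<odot>\<^bsub>?M\<^esub> (r \<oplus>\<^bsub>?M\<^esub> r')" using r r' tB by (simp add: M.smult_r_distr)
      then show "v \<oplus>\<^bsub>?M\<^esub> w \<in> ?J" using Jin[OF M.M.a_closed[OF r(1) r'(1)]] by simp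
    qed
    have zJ: "\<zero>\<^bsub>?M\<^esub> \<in> ?J" using subgroup.one_closed[OF J] by simp
    have kB: "c \<in> carrier B0 \<Longrightarrow> c \<in> carrier BB" for c using special_base_base_ring by auto
    have cancel: "(v \<oplus>\<^bsub>?M\<^esub> w) \<oplus>\<^bsub>?M\<^esub> \<ominus>\<^bsub>?M\<^esub> v \<oplus>\<^bsub>?M\<^esub> \<ominus>\<^bsub>?M\<^esub> w = \<zero>\<^bsub>?M\<^esub>"
      if "v \<in> carrier ?M" "w \<in> carrier ?M" for v w
    proof -
      have "(v \<oplus>\<^bsub>?M\<^esub> w) \<oplus>\<^bsub>?M\<^esub> \<ominus>\<^bsub>?M\<^esub> v \<oplus>\<^bsub>?M\<^esub> \<ominus>\<^bsub>?M\<^esub> w = (v \<oplus>\<^bsub>?M\<^esub> \<ominus>\<^bsub>?M\<^esub> v) \<oplus>\<^bsub>?M\<^esub> (w \<oplus>\<^bsub>?M\<^esub> \<ominus>\<^bsub>?M\<^esub> w)"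
        using that by (simp add: M.M.a_ac)
      then show ?thesis using that by (simp add: M.M.r_neg)
    qed
    have inv: "inv\<^bsub>add_monoid ?M\<^esub> v = \<ominus>\<^bsub>?M\<^esub> v" for v by (simp add: a_inv_def)
    obtain \<Phi> where \<Phi>: "\<And>v c. v \<in> carrier ?M \<Longrightarrow> c \<in> carrier B0 \<Longrightarrow> \<Phi> (frag_of (v, c)) = c \<odot>\<^bsub>?M\<^esub> v"
      and \<Phi>N: "\<And>z. z \<in> EM.N \<Longrightarrow> \<Phi> z \<in> ?J"
    proof (rule EM.kernel_eval[OF M.M.a_comm_group _ J, of "\<lambda>v c. c \<odot>\<^bsub>?M\<^esub> v"])
      show "c \<odot>\<^bsub>?M\<^esub> v \<in> carrier (add_monoid ?M)" if "v \<in> carrier ?M" "c \<in> carrier B0" for v c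
        using that kB by simp
      show "c \<odot>\<^bsub>?M\<^esub> (v \<oplus>\<^bsub>?M\<^esub> w) \<otimes>\<^bsub>add_monoid ?M\<^esub> inv\<^bsub>add_monoid ?M\<^esub> (c \<odot>\<^bsub>?M\<^esub> v) \<otimes>\<^bsub>add_monoid ?M\<^esub> inv\<^bsub>add_monoid ?M\<^esub> (c \<odot>\<^bsub>?M\<^esub> w) \<in> ?J"
        if "v \<in> carrier ?M" "w \<in> carrier ?M" "c \<in> carrier B0" for v w c
        using zJ that kB[OF that(3)] by (simp add: inv M.smult_r_distr cancel del: ring_copy_simps)
      show "(c \<oplus>\<^bsub>B0\<^esub> d) \<odot>\<^bsub>?M\<^esub> v \<otimes>\<^bsub>add_monoid ?M\<^esub> inv\<^bsub>add_monoid ?M\<^esub> (c \<odot>\<^bsub>?M\<^esub> v) \<otimes>\<^bsub>add_monoid ?M\<^esub> inv\<^bsub>add_monoid ?M\<^esub> (d \<odot>\<^bsub>?M\<^esub> v) \<in> ?J"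
        if v: "v \<in> carrier ?M" and c: "c \<in> carrier B0" and d: "d \<in> carrier B0" for v c d
      proof -
        have "(c \<oplus>\<^bsub>B0\<^esub> d) \<odot>\<^bsub>?M\<^esub> v = c \<odot>\<^bsub>?M\<^esub> v \<oplus>\<^bsub>?M\<^esub> d \<odot>\<^bsub>?M\<^esub> v"
          using M.smult_l_distr[OF kB[OF c] kB[OF d] v] by simp
        then show ?thesis using zJ v kB[OF c] kB[OF d] by (simp add: inv cancel del: ring_copy_simps)
      qed
      show "c \<odot>\<^bsub>?M\<^esub> (b \<odot>\<^bsub>?M\<^esub> v) \<otimes>\<^bsub>add_monoid ?M\<^esub> inv\<^bsub>add_monoid ?M\<^esub> ((?f b \<otimes>\<^bsub>B0\<^esub> c) \<odot>\<^bsub>?M\<^esub> v) \<in> ?J"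
        if b: "b \<in> carrier BB" and v: "v \<in> carrier ?M" and c: "c \<in> carrier B0" for b v c
      proof -
        obtain b' where b': "b' \<in> base_ring" "b = \<iota> b'" using b by auto
        obtain c' where c': "c' \<in> special_base" "c = \<iota> c'" using c by auto
        obtain d where d: "d \<in> P" "b' = \<epsilon> b' + t * d" using eps_rem BP[OF b'(1)] by blast
        have "d = (b' - \<epsilon> b') / t" using d(2) t_nonzero by (simp add: field_simps)
        then have "d \<in> K"
          using b'(1) eps_base_ring[OF b'(1)] base_ring_K t_base_ring is_subringD(6)[OF K_subring] by (auto intro!: K_divide)
        then have dB: "d \<in> base_ring" using d(1) by (simp add: base_ring_def)
        have cB: "c' \<in> base_ring" using c' special_base_base_ring by auto
        note Bc = is_subringD[OF base_ring_subring]
        have "c \<odot>\<^bsub>?M\<^esub> (b \<odot>\<^bsub>?M\<^esub> v) = \<iota> (c' * b') \<odot>\<^bsub>?M\<^esub> v"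
          using M.smult_assoc1[OF kB[OF c] b v] by (simp add: b'(2) c'(2))
        also have "c' * b' = \<epsilon> b' * c' + t * (d * c')"
        proof -
          have "c' * b' = c' * (\<epsilon> b' + t * d)" by (simp only: d(2)[symmetric])
          then show ?thesis by (simp add: algebra_simps)
        qed
        also have "\<iota> (\<epsilon> b' * c' + t * (d * c')) \<odot>\<^bsub>?M\<^esub> v = \<iota> (\<epsilon> b' * c') \<odot>\<^bsub>?M\<^esub> v \<oplus>\<^bsub>?M\<^esub> \<iota> (t * (d * c')) \<odot>\<^bsub>?M\<^esub> v"
          using M.smult_l_distr[of "\<iota> (\<epsilon> b' * c')" "\<iota> (t * (d * c'))" v] v Bc(4) dB cB t_base_ring eps_base_ring[OF b'(1)] by simp
        also have "\<iota> (t * (d * c')) \<odot>\<^bsub>?M\<^esub> v = \<iota> t \<odot>\<^bsub>?M\<^esub> (\<iota> (d * c') \<odot>\<^bsub>?M\<^esub> v)"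
          using M.smult_assoc1[of "\<iota> t" "\<iota> (d * c')" v] v Bc(4)[OF dB cB] t_base_ring by simp
        finally have eq: "c \<odot>\<^bsub>?M\<^esub> (b \<odot>\<^bsub>?M\<^esub> v) = \<iota> (\<epsilon> b' * c') \<odot>\<^bsub>?M\<^esub> v \<oplus>\<^bsub>?M\<^esub> \<iota> t \<odot>\<^bsub>?M\<^esub> (\<iota> (d * c') \<odot>\<^bsub>?M\<^esub> v)" .
        have cl: "\<iota> (\<epsilon> b' * c') \<odot>\<^bsub>?M\<^esub> v \<in> carrier ?M" "\<iota> (d * c') \<odot>\<^bsub>?M\<^esub> v \<in> carrier ?M"
          using v Bc(4) dB cB eps_base_ring[OF b'(1)] by (auto intro!: M.smult_closed)
        have sm: "\<iota> t \<odot>\<^bsub>?M\<^esub> (\<iota> (d * c') \<odot>\<^bsub>?M\<^esub> v) \<in> carrier ?M" by (rule M.smult_closed[OF tB cl(2)])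
        have "u' \<oplus>\<^bsub>?M\<^esub> w \<oplus>\<^bsub>?M\<^esub> \<ominus>\<^bsub>?M\<^esub> u' = w" if "u' \<in> carrier ?M" "w \<in> carrier ?M" for u' w
          using that M.M.r_neg1 by (simp add: M.M.a_ac)
        moreover have fb: "?f b \<otimes>\<^bsub>B0\<^esub> c = \<iota> (\<epsilon> b' * c')" by (simp add: b'(2) c'(2))
        ultimately show ?thesis unfolding inv eq fb using cl(1) sm Jin[OF cl(2)] by simp
      qed
    qed blast
    have "frag_of (u, \<one>\<^bsub>B0\<^esub>) \<in> EM.N" using s_0[OF u] EM.tens_eq_zero[OF u(1) one0] by blast
    from \<Phi>N[OF this] have "\<one>\<^bsub>B0\<^esub> \<odot>\<^bsub>?M\<^esub> u \<in> ?J" using \<Phi>[OF u(1) one0] by simp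
    then have "u \<in> ?J" using M.smult_one[OF u(1)] by simp
    then show ?thesis by blast
  qed
  have si: "s (i BB AA j (\<iota> y)) = i B0 A0 j (\<iota> (\<psi> y))" if j: "j \<in> {1..n}" and y: "y \<in> order_ring" for j y
  proof -
    have yA: "\<iota> y \<in> carrier AA" using y by simp
    have "e (E.tens (\<iota> y) \<one>\<^bsub>B0\<^esub>) = \<iota> (\<psi> y)" using e_tens[OF yA one0] by simp
    then show ?thesis using s_i[OF j yA] by simp
  qed
  have ssm: "s (\<iota> b \<odot>\<^bsub>?M\<^esub> u) = \<iota> (\<epsilon> b) \<odot>\<^bsub>?D\<^esub> s u" if "b \<in> base_ring" "u \<in> carrier ?M" for b u
    using s_sm[of "\<iota> b" u] that by simp
  show ?thesis
    by (intro exI[of _ s] conjI ballI impI) (rule s | (rule ssm ker si, assumption+))+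
qed

section \<open>The contradiction\<close>

lemma no_closure:
  fixes G :: "('u, 'g) closure_obj"
  assumes ca: "closure_assignment n G i" and gen: "generated_by_images n G i"
    and fu: "functorial n G i F" and bc: "respects_base_change n G i F"
    and gal: "extends_galois_closure n G i"
  shows False
proof -
  let ?M = "G BB AA" and ?D = "G B0 A0"
  have rM: "rank_algebra (fact n) BB ?M" "rank_algebra (fact n) B0 ?D"
    and iM: "\<And>j. j \<in> {1..n} \<Longrightarrow> i BB AA j \<in> alg_hom BB AA ?M"
    and i0: "\<And>j. j \<in> {1..n} \<Longrightarrow> i B0 A0 j \<in> alg_hom B0 A0 ?D"
    using ca rank_AA rank_A0 by (auto simp: closure_assignment_def)
  have algM: "algebra BB ?M" "algebra B0 ?D" using rM by (simp_all add: rank_algebra_def)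
  interpret M: algebra BB ?M by (rule algM)
  interpret M0: algebra B0 ?D by (rule algM)
  have idx: "1 \<in> {1..n}" "2 \<in> {1..n}" "3 \<in> {1..n}" "4 \<in> {1..n}" using n4 by auto
  note Bc = is_subringD[OF base_ring_subring]
  obtain ev \<pi> where inj\<pi>: "inj_on \<pi> {1..n}" and \<pi>: "\<pi> ` {1..n} \<subseteq> {1..n}"
    and ev_add: "\<And>u v. u \<in> carrier ?M \<Longrightarrow> v \<in> carrier ?M \<Longrightarrow> ev (u \<oplus>\<^bsub>?M\<^esub> v) = ev u + ev v"
    and ev_mult: "\<And>u v. u \<in> carrier ?M \<Longrightarrow> v \<in> carrier ?M \<Longrightarrow> ev (u \<otimes>\<^bsub>?M\<^esub> v) = ev u * ev v"
    and ev_one: "ev \<one>\<^bsub>?M\<^esub> = 1"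
    and ev_sm: "\<And>b u. b \<in> base_ring \<Longrightarrow> u \<in> carrier ?M \<Longrightarrow> ev (\<iota> b \<odot>\<^bsub>?M\<^esub> u) = b * ev u"
    and ev_inj: "\<And>u. u \<in> carrier ?M \<Longrightarrow> ev u = 0 \<Longrightarrow> u = \<zero>\<^bsub>?M\<^esub>"
    and ev_i: "\<And>j c. j \<in> {1..n} \<Longrightarrow> \<forall>a. c a \<in> base_ring \<Longrightarrow>
      ev (i BB AA j (\<iota> (\<Sum>a<n. c a * tx_power a))) = c 0 + t * (\<Sum>a\<in>{1..<n}. c a * x (\<pi> j) ^ a)"
    using generic_fibre[OF ca bc gal] by (elim exE conjE) blast
  obtain s where s: "s \<in> ring_hom ?M ?D"
    and s_sm: "\<And>b u. b \<in> base_ring \<Longrightarrow> u \<in> carrier ?M \<Longrightarrow> s (\<iota> b \<odot>\<^bsub>?M\<^esub> u) = \<iota> (\<epsilon> b) \<odot>\<^bsub>?D\<^esub> s u"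
    and s_ker: "\<And>u. u \<in> carrier ?M \<Longrightarrow> s u = \<zero>\<^bsub>?D\<^esub> \<Longrightarrow> \<exists>r\<in>carrier ?M. u = \<iota> t \<odot>\<^bsub>?M\<^esub> r"
    and s_i: "\<And>j y. j \<in> {1..n} \<Longrightarrow> y \<in> order_ring \<Longrightarrow> s (i BB AA j (\<iota> y)) = i B0 A0 j (\<iota> (\<psi> y))"
    using special_fibre[OF ca bc] by (elim exE conjE) blast
  note sc = ring_hom_closed[OF s]
  have ev_zero: "ev \<zero>\<^bsub>?M\<^esub> = 0" using ev_add[of "\<zero>\<^bsub>?M\<^esub>" "\<zero>\<^bsub>?M\<^esub>"] by (metis M.M.l_zero M.M.zero_closed add_cancel_right_right)
  have ev_minus: "ev (\<ominus>\<^bsub>?M\<^esub> u) = - ev u" if "u \<in> carrier ?M" for u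
    using ev_add[of "\<ominus>\<^bsub>?M\<^esub> u" u] that by (simp add: M.M.l_neg ev_zero eq_neg_iff_add_eq_0)
  let ?I = "{1..<n}"
  define g where "g j a = i BB AA j (\<iota> (tx_power a))" for j a
  have g_cl: "g j a \<in> carrier ?M" if "j \<in> {1..n}" "a < n" for j a
    using iM[OF that(1)] tx_power_order_ring[OF that(2)] ring_hom_closed[of "i BB AA j" AA ?M "\<iota> (tx_power a)"]
    by (auto simp: g_def alg_hom_def)
  have g_ev: "ev (g j a) = t * x (\<pi> j) ^ a" if j: "j \<in> {1..n}" and a: "a \<in> ?I" for j a
  proof -
    let ?c = "\<lambda>b. if b = a then 1 else (0::'l)"
    have "tx_power a = (\<Sum>b<n. ?c b * tx_power b)" using a by (simp add: if_distrib[of "\<lambda>c. c * _"] sum.delta cong: if_cong)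
    moreover have "(\<Sum>b\<in>?I. ?c b * x (\<pi> j) ^ b) = x (\<pi> j) ^ a"
      using a by (simp add: if_distrib[of "\<lambda>c. c * _"] sum.delta cong: if_cong)
    moreover have "\<forall>b. ?c b \<in> base_ring" using Bc(1,2) by simp
    ultimately show ?thesis using ev_i[OF j, of ?c] a by (simp add: g_def)
  qed
  let ?u = "x (\<pi> 1)" and ?v = "x (\<pi> 2)"
  have \<pi>in: "\<pi> 1 \<in> {1..n}" "\<pi> 2 \<in> {1..n}" "\<pi> 3 \<in> {1..n}" "\<pi> 4 \<in> {1..n}" using \<pi> idx by blast+
  have \<pi>dist: "distinct [\<pi> 1, \<pi> 2, \<pi> 3, \<pi> 4]" using inj\<pi> idx by (auto simp: inj_on_eq_iff)
  have uv: "poly min_poly ?u = 0" "poly min_poly ?v = 0" "?u \<noteq> ?v"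
    using min_poly_root \<pi>in \<pi>dist x_inj by (auto simp: inj_on_eq_iff)
  have FB: "Polynomial.coeff min_poly k \<in> base_ring" for k by (rule min_poly_coeff_base_ring)
  \<comment> \<open>\<open>U\<close> is the quadratic part of the relation between two roots, \<open>t V\<close> is the linear part; as \<open>U\<close> carries
    the factor \<open>t\<^sup>2\<close> and \<open>V\<close> only \<open>t\<close>, they are equal, and \<open>U\<close> vanishes in the special fibre\<close>
  let ?R = "\<lambda>a b. \<iota> (Polynomial.coeff min_poly (Suc (a + b))) \<odot>\<^bsub>?M\<^esub> (g 1 a \<otimes>\<^bsub>?M\<^esub> g 2 b)"
  let ?L = "\<lambda>a. \<iota> (Polynomial.coeff min_poly (Suc a)) \<odot>\<^bsub>?M\<^esub> (g 1 a \<oplus>\<^bsub>?M\<^esub> g 2 a)"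
  define U where "U = (\<Oplus>\<^bsub>?M\<^esub>a\<in>?I. \<Oplus>\<^bsub>?M\<^esub>b\<in>?I. ?R a b)"
  define V where "V = \<ominus>\<^bsub>?M\<^esub> ((\<iota> (t * Polynomial.coeff min_poly (Suc 0)) \<odot>\<^bsub>?M\<^esub> \<one>\<^bsub>?M\<^esub>)
      \<oplus>\<^bsub>?M\<^esub> (\<Oplus>\<^bsub>?M\<^esub>a\<in>?I. ?L a))"
  have gI: "g 1 a \<in> carrier ?M" "g 2 a \<in> carrier ?M" if "a \<in> ?I" for a using g_cl idx that by auto
  have term_cl: "?R a b \<in> carrier ?M" if "a \<in> ?I" "b \<in> ?I" for a b
    using gI that FB by (intro M.smult_closed M.m_closed) simp_all
  have inner_cl: "(\<Oplus>\<^bsub>?M\<^esub>b\<in>?I. ?R a b) \<in> carrier ?M" if "a \<in> ?I" for a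
    using term_cl[OF that] by (intro M.M.finsum_closed) auto
  have U_cl: "U \<in> carrier ?M" unfolding U_def using inner_cl by (intro M.M.finsum_closed) auto
  have ev_sum: "ev (\<Oplus>\<^bsub>?M\<^esub>a\<in>?I. h a) = (\<Sum>a\<in>?I. ev (h a))" if "\<And>a. a \<in> ?I \<Longrightarrow> h a \<in> carrier ?M" for h
    using that ev_add by (intro sum_of_finsum[OF M.M.abelian_group_axioms]) auto
  have lin_cl: "?L a \<in> carrier ?M" if "a \<in> ?I" for a
    using gI[OF that] FB by (intro M.smult_closed M.M.a_closed) simp_all
  have lin_sum_cl: "(\<Oplus>\<^bsub>?M\<^esub>a\<in>?I. ?L a) \<in> carrier ?M"
    using lin_cl by (intro M.M.finsum_closed) auto
  have tF: "t * Polynomial.coeff min_poly (Suc 0) \<in> base_ring" by (rule Bc(4)[OF t_base_ring FB])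
  have const_cl: "\<iota> (t * Polynomial.coeff min_poly (Suc 0)) \<odot>\<^bsub>?M\<^esub> \<one>\<^bsub>?M\<^esub> \<in> carrier ?M"
    using tF by (intro M.smult_closed) simp_all
  have V_cl: "V \<in> carrier ?M" unfolding V_def using const_cl lin_sum_cl by simp
  have evU: "ev U = t ^ 2 * (\<Sum>a\<in>?I. \<Sum>b\<in>?I. Polynomial.coeff min_poly (Suc (a + b)) * (?u ^ a * ?v ^ b))"
  proof -
    have "ev U = (\<Sum>a\<in>?I. \<Sum>b\<in>?I. ev (?R a b))"
      unfolding U_def by (subst ev_sum[OF inner_cl], assumption, intro sum.cong refl ev_sum term_cl)
    also have "\<dots> = (\<Sum>a\<in>?I. \<Sum>b\<in>?I. t ^ 2 * (Polynomial.coeff min_poly (Suc (a + b)) * (?u ^ a * ?v ^ b)))"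
    proof (intro sum.cong refl)
      fix a b assume ab: "a \<in> ?I" "b \<in> ?I"
      have "g 1 a \<otimes>\<^bsub>?M\<^esub> g 2 b \<in> carrier ?M" using gI ab by (intro M.m_closed)
      then have "ev (?R a b) = Polynomial.coeff min_poly (Suc (a + b)) * (ev (g 1 a) * ev (g 2 b))"
        using ev_sm[OF FB] ev_mult gI ab by simp
      then show "ev (?R a b) = t ^ 2 * (Polynomial.coeff min_poly (Suc (a + b)) * (?u ^ a * ?v ^ b))"
        unfolding g_ev[OF idx(1) ab(1)] g_ev[OF idx(2) ab(2)] by (simp add: power2_eq_square algebra_simps)
    qed
    finally show ?thesis by (simp add: sum_distrib_left)
  qed
  have evV: "ev V = - (t * Polynomial.coeff min_poly (Suc 0)) - t * (\<Sum>a\<in>?I. Polynomial.coeff min_poly (Suc a) * (?u ^ a + ?v ^ a))"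
  proof -
    have "ev (\<Oplus>\<^bsub>?M\<^esub>a\<in>?I. ?L a)
      = (\<Sum>a\<in>?I. ev (?L a))"
      by (rule ev_sum) (rule lin_cl)
    also have "\<dots> = (\<Sum>a\<in>?I. t * (Polynomial.coeff min_poly (Suc a) * (?u ^ a + ?v ^ a)))"
    proof (intro sum.cong refl)
      fix a assume a: "a \<in> ?I"
      have "g 1 a \<oplus>\<^bsub>?M\<^esub> g 2 a \<in> carrier ?M" using gI[OF a] by (intro M.M.a_closed)
      then show "ev (?L a) = t * (Polynomial.coeff min_poly (Suc a) * (?u ^ a + ?v ^ a))"
        using ev_sm[OF FB] ev_add[OF gI[OF a]] g_ev[OF idx(1) a] g_ev[OF idx(2) a] by (simp add: algebra_simps)
    qed
    finally show ?thesis
      unfolding V_def using const_cl lin_sum_cl ev_sm[OF tF, of "\<one>\<^bsub>?M\<^esub>"] M.one_closed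
      by (simp add: ev_minus ev_add ev_one sum_distrib_left)
  qed
  have tB: "\<iota> t \<in> carrier BB" using t_base_ring by simp
  have tV_cl: "\<iota> t \<odot>\<^bsub>?M\<^esub> V \<in> carrier ?M" by (rule M.smult_closed[OF tB V_cl])
  have "ev U = ev (\<iota> t \<odot>\<^bsub>?M\<^esub> V)"
    unfolding evU ev_sm[OF t_base_ring V_cl] evV quadratic_relation[OF uv] by (simp add: power2_eq_square algebra_simps)
  then have "ev (U \<oplus>\<^bsub>?M\<^esub> \<ominus>\<^bsub>?M\<^esub> (\<iota> t \<odot>\<^bsub>?M\<^esub> V)) = 0"
    using U_cl tV_cl by (simp add: ev_add ev_minus)
  then have "U \<oplus>\<^bsub>?M\<^esub> \<ominus>\<^bsub>?M\<^esub> (\<iota> t \<odot>\<^bsub>?M\<^esub> V) = \<zero>\<^bsub>?M\<^esub>"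
    using U_cl tV_cl by (intro ev_inj) simp_all
  then have UV: "U = \<iota> t \<odot>\<^bsub>?M\<^esub> V"
    using U_cl tV_cl M.M.minus_equality[of U "\<ominus>\<^bsub>?M\<^esub> (\<iota> t \<odot>\<^bsub>?M\<^esub> V)"] by simp
  have "s U = \<iota> 0 \<odot>\<^bsub>?D\<^esub> s V" unfolding UV using s_sm[OF t_base_ring V_cl] by (simp add: eps_t)
  then have sU: "s U = \<zero>\<^bsub>?D\<^esub>" using M0.smult_l_null[OF sc[OF V_cl]] by simp
  \<comment> \<open>an endomorphism of the special fibre that maps all \<open>x\<^sup>a\<close> to multiples \<open>\<gamma> a\<close> of \<open>x\<close> turns \<open>U\<close> into
    the value of the quadratic form at \<open>\<gamma>\<close> times the single product \<open>W\<close>\<close>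
  define w where "w j = i B0 A0 j (\<iota> (x 1))" for j
  have x1: "x 1 \<in> spanned special_base" using spanned_x[OF special_base_subring, of 1] n4 by simp
  have w_cl: "w j \<in> carrier ?D" if "j \<in> {1..n}" for j
    using i0[OF that] x1 ring_hom_closed[of "i B0 A0 j" A0 ?D "\<iota> (x 1)"] by (auto simp: w_def alg_hom_def)
  define W where "W = w 1 \<otimes>\<^bsub>?D\<^esub> w 2"
  have W_cl: "W \<in> carrier ?D" unfolding W_def using w_cl idx by (intro M0.m_closed)
  have relation: "\<iota> (\<epsilon> (Polynomial.coeff min_poly 3) + 2 * \<beta>) \<odot>\<^bsub>?D\<^esub> W = \<zero>\<^bsub>?D\<^esub>" if \<beta>: "\<beta> \<in> special_base" for \<beta>
  proof -
    let ?e = "\<lambda>u. \<iota> (endo \<beta> (\<kappa> u))"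
    define \<gamma> where "\<gamma> a = (if a = 1 then 1 else if a = n - 2 then \<beta> else 0)" for a :: nat
    have \<gamma>k: "\<gamma> a \<in> special_base" for a using \<beta> is_subringD(1,2)[OF special_base_subring] by (simp add: \<gamma>_def)
    have f: "F B0 A0 A0 ?e \<in> alg_hom B0 ?D ?D"
      and fi: "\<And>j v. j \<in> {1..n} \<Longrightarrow> v \<in> carrier A0 \<Longrightarrow> F B0 A0 A0 ?e (i B0 A0 j v) = i B0 A0 j (?e v)"
      using fu rank_A0 endo_hom[OF \<beta>] unfolding functorial_def by blast+
    have fr: "F B0 A0 A0 ?e \<in> ring_hom ?D ?D"
      and fs: "\<And>b v. b \<in> carrier B0 \<Longrightarrow> v \<in> carrier ?D \<Longrightarrow> F B0 A0 A0 ?e (b \<odot>\<^bsub>?D\<^esub> v) = b \<odot>\<^bsub>?D\<^esub> F B0 A0 A0 ?e v"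
      using f by (auto simp: alg_hom_def)
    define \<Psi> where "\<Psi> m = F B0 A0 A0 ?e (s m)" for m
    have \<Psi>_cl: "\<Psi> m \<in> carrier ?D" if "m \<in> carrier ?M" for m
      unfolding \<Psi>_def by (intro ring_hom_closed[OF fr] sc that)
    have \<Psi>_add: "\<Psi> (m \<oplus>\<^bsub>?M\<^esub> m') = \<Psi> m \<oplus>\<^bsub>?D\<^esub> \<Psi> m'" if "m \<in> carrier ?M" "m' \<in> carrier ?M" for m m'
      unfolding \<Psi>_def using that sc by (simp add: ring_hom_add[OF s] ring_hom_add[OF fr])
    have \<Psi>_mult: "\<Psi> (m \<otimes>\<^bsub>?M\<^esub> m') = \<Psi> m \<otimes>\<^bsub>?D\<^esub> \<Psi> m'" if "m \<in> carrier ?M" "m' \<in> carrier ?M" for m m'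
      unfolding \<Psi>_def using that sc by (simp add: ring_hom_mult[OF s] ring_hom_mult[OF fr])
    have \<Psi>_sm: "\<Psi> (\<iota> b \<odot>\<^bsub>?M\<^esub> m) = \<iota> (\<epsilon> b) \<odot>\<^bsub>?D\<^esub> \<Psi> m" if "b \<in> base_ring" "m \<in> carrier ?M" for b m
      unfolding \<Psi>_def s_sm[OF that] using eps_in_special_base[OF that(1)] sc[OF that(2)] by (intro fs) simp_all
    have \<Psi>_g: "\<Psi> (g j a) = \<iota> (\<gamma> a) \<odot>\<^bsub>?D\<^esub> w j" if j: "j \<in> {1..n}" and a: "a \<in> ?I" for j a
    proof -
      have an: "a < n" using a by simp
      have "s (g j a) = i B0 A0 j (\<iota> (x 1 ^ a))"
        unfolding g_def s_i[OF j tx_power_order_ring[OF an]] psi_basis[OF an] ..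
      then have "\<Psi> (g j a) = i B0 A0 j (\<iota> (endo \<beta> (x 1 ^ a)))"
        unfolding \<Psi>_def using fi[OF j, of "\<iota> (x 1 ^ a)"] spanned_x[OF special_base_subring an] by simp
      also have "endo \<beta> (x 1 ^ a) = \<gamma> a * x 1" using endo_power[OF a] by (simp add: \<gamma>_def)
      also have "i B0 A0 j (\<iota> (\<gamma> a * x 1)) = \<iota> (\<gamma> a) \<odot>\<^bsub>?D\<^esub> w j"
        using i0[OF j] \<gamma>k[of a] x1 unfolding alg_hom_def w_def by force
      finally show ?thesis .
    qed
    let ?f = "\<lambda>a b. \<epsilon> (Polynomial.coeff min_poly (Suc (a + b))) * \<gamma> a * \<gamma> b"
    have fk: "?f a b \<in> special_base" for a b
      by (intro is_subringD(4)[OF special_base_subring] eps_in_special_base FB \<gamma>k)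
    have \<Psi>_term: "\<Psi> (?R a b) = \<iota> (?f a b) \<odot>\<^bsub>?D\<^esub> W"
      if ab: "a \<in> ?I" "b \<in> ?I" for a b
    proof -
      let ?c = "\<epsilon> (Polynomial.coeff min_poly (Suc (a + b)))"
      have ck: "\<iota> ?c \<in> carrier B0" "\<iota> (\<gamma> a) \<in> carrier B0" "\<iota> (\<gamma> b) \<in> carrier B0"
        using eps_in_special_base[OF FB] \<gamma>k by simp_all
      have gg: "g 1 a \<otimes>\<^bsub>?M\<^esub> g 2 b \<in> carrier ?M" using gI ab by (intro M.m_closed)
      have w12: "w 1 \<in> carrier ?D" "w 2 \<in> carrier ?D" using w_cl idx by auto
      have "\<Psi> (?R a b)
        = \<iota> ?c \<odot>\<^bsub>?D\<^esub> ((\<iota> (\<gamma> a) \<odot>\<^bsub>?D\<^esub> w 1) \<otimes>\<^bsub>?D\<^esub> (\<iota> (\<gamma> b) \<odot>\<^bsub>?D\<^esub> w 2))"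
        unfolding \<Psi>_sm[OF FB gg] \<Psi>_mult[OF gI(1)[OF ab(1)] gI(2)[OF ab(2)]] \<Psi>_g[OF idx(1) ab(1)] \<Psi>_g[OF idx(2) ab(2)] ..
      also have "(\<iota> (\<gamma> a) \<odot>\<^bsub>?D\<^esub> w 1) \<otimes>\<^bsub>?D\<^esub> (\<iota> (\<gamma> b) \<odot>\<^bsub>?D\<^esub> w 2) = \<iota> (\<gamma> a) \<odot>\<^bsub>?D\<^esub> (\<iota> (\<gamma> b) \<odot>\<^bsub>?D\<^esub> W)"
      proof -
        have b2: "\<iota> (\<gamma> b) \<odot>\<^bsub>?D\<^esub> w 2 \<in> carrier ?D" by (rule M0.smult_closed[OF ck(3) w12(2)])
        have "w 1 \<otimes>\<^bsub>?D\<^esub> (\<iota> (\<gamma> b) \<odot>\<^bsub>?D\<^esub> w 2) = (\<iota> (\<gamma> b) \<odot>\<^bsub>?D\<^esub> w 2) \<otimes>\<^bsub>?D\<^esub> w 1" by (rule M0.m_comm[OF w12(1) b2])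
        also have "\<dots> = \<iota> (\<gamma> b) \<odot>\<^bsub>?D\<^esub> (w 2 \<otimes>\<^bsub>?D\<^esub> w 1)" by (rule M0.smult_assoc2[OF ck(3) w12(2,1)])
        also have "w 2 \<otimes>\<^bsub>?D\<^esub> w 1 = W" unfolding W_def by (rule M0.m_comm[OF w12(2,1)])
        finally show ?thesis using M0.smult_assoc2[OF ck(2) w12(1) b2] by simp
      qed
      also have "\<iota> ?c \<odot>\<^bsub>?D\<^esub> (\<iota> (\<gamma> a) \<odot>\<^bsub>?D\<^esub> (\<iota> (\<gamma> b) \<odot>\<^bsub>?D\<^esub> W)) = \<iota> (?f a b) \<odot>\<^bsub>?D\<^esub> W"
        using M0.smult_assoc1[OF ck(2,3) W_cl] M0.smult_assoc1[of "\<iota> ?c" "\<iota> (\<gamma> a * \<gamma> b)" W] ck W_cl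
          is_subringD(4)[OF special_base_subring \<gamma>k \<gamma>k, of a b] by (simp add: mult.assoc)
      finally show ?thesis .
    qed
    have fks: "(\<Sum>b\<in>?I. ?f a b) \<in> special_base" for a by (rule is_subring_sum[OF special_base_subring]) (rule fk)
    have mod0: "module B0 ?D" by (rule M0.module)
    have "\<Psi> U = (\<Oplus>\<^bsub>?D\<^esub>a\<in>?I. \<Psi> (\<Oplus>\<^bsub>?M\<^esub>b\<in>?I. ?R a b))"
      unfolding U_def
      by (rule finsum_additive[OF M.M.abelian_group_axioms M0.M.abelian_group_axioms])
         (use inner_cl \<Psi>_cl \<Psi>_add in auto)
    also have "\<dots> = (\<Oplus>\<^bsub>?D\<^esub>a\<in>?I. \<iota> (\<Sum>b\<in>?I. ?f a b) \<odot>\<^bsub>?D\<^esub> W)"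
    proof (rule M0.M.finsum_cong')
      fix a assume a: "a \<in> ?I"
      have "\<Psi> (\<Oplus>\<^bsub>?M\<^esub>b\<in>?I. ?R a b)
        = (\<Oplus>\<^bsub>?D\<^esub>b\<in>?I. \<Psi> (?R a b))"
        by (rule finsum_additive[OF M.M.abelian_group_axioms M0.M.abelian_group_axioms])
           (use term_cl[OF a] \<Psi>_cl \<Psi>_add in auto)
      also have "\<dots> = (\<Oplus>\<^bsub>?D\<^esub>b\<in>?I. \<iota> (?f a b) \<odot>\<^bsub>?D\<^esub> W)"
        using \<Psi>_term[OF a] fk W_cl by (intro M0.M.finsum_cong') (auto intro!: M0.smult_closed)
      also have "\<dots> = \<iota> (\<Sum>b\<in>?I. ?f a b) \<odot>\<^bsub>?D\<^esub> W"
        using fk by (intro finsum_smult_const[OF mod0 special_base_subring W_cl]) auto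
      finally show "\<Psi> (\<Oplus>\<^bsub>?M\<^esub>b\<in>?I. ?R a b)
        = \<iota> (\<Sum>b\<in>?I. ?f a b) \<odot>\<^bsub>?D\<^esub> W" .
    qed (use fks W_cl in \<open>auto intro!: M0.smult_closed\<close>)
    also have "\<dots> = \<iota> (\<Sum>a\<in>?I. \<Sum>b\<in>?I. ?f a b) \<odot>\<^bsub>?D\<^esub> W"
      by (rule finsum_smult_const[OF mod0 special_base_subring W_cl _ fks]) simp
    also have "(\<Sum>a\<in>?I. \<Sum>b\<in>?I. ?f a b) = \<epsilon> (Polynomial.coeff min_poly 3) + 2 * \<beta>"
      by (rule quadratic_form_value) (rule \<gamma>_def)
    finally have "\<Psi> U = \<iota> (\<epsilon> (Polynomial.coeff min_poly 3) + 2 * \<beta>) \<odot>\<^bsub>?D\<^esub> W" .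
    moreover have "\<Psi> U = \<zero>\<^bsub>?D\<^esub>"
    proof -
      have "\<Psi> \<zero>\<^bsub>?M\<^esub> = \<zero>\<^bsub>?D\<^esub>"
        using \<Psi>_add[of "\<zero>\<^bsub>?M\<^esub>" "\<zero>\<^bsub>?M\<^esub>"] \<Psi>_cl[of "\<zero>\<^bsub>?M\<^esub>"] by (simp add: M0.M.add.r_cancel_one')
      moreover have "s \<zero>\<^bsub>?M\<^esub> = \<zero>\<^bsub>?D\<^esub>"
        using ring_hom_add[OF s, of "\<zero>\<^bsub>?M\<^esub>" "\<zero>\<^bsub>?M\<^esub>"] sc[of "\<zero>\<^bsub>?M\<^esub>"] by (simp add: M0.M.add.r_cancel_one')
      ultimately show ?thesis by (simp add: \<Psi>_def sU)
    qed
    ultimately show ?thesis by simp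
  qed
  have two: "2 \<in> special_base" using is_subringD(3)[OF special_base_subring, of 1 1] is_subringD(1)[OF special_base_subring] by simp
  have zero2: "\<iota> 2 \<odot>\<^bsub>?D\<^esub> W = \<zero>\<^bsub>?D\<^esub>"
  proof -
    let ?c = "\<epsilon> (Polynomial.coeff min_poly 3)"
    have c: "?c \<in> special_base" by (rule eps_in_special_base[OF FB])
    have "\<iota> ?c \<odot>\<^bsub>?D\<^esub> W = \<zero>\<^bsub>?D\<^esub>" "\<iota> (?c + 2) \<odot>\<^bsub>?D\<^esub> W = \<zero>\<^bsub>?D\<^esub>"
      using relation[of 0] relation[of 1] is_subringD(1,2)[OF special_base_subring] by simp_all
    moreover have "\<iota> (?c + 2) \<odot>\<^bsub>?D\<^esub> W = \<iota> ?c \<odot>\<^bsub>?D\<^esub> W \<oplus>\<^bsub>?D\<^esub> \<iota> 2 \<odot>\<^bsub>?D\<^esub> W"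
      using M0.smult_l_distr[of "\<iota> ?c" "\<iota> 2" W] c two W_cl by simp
    moreover have "\<iota> 2 \<odot>\<^bsub>?D\<^esub> W \<in> carrier ?D" using two W_cl by (intro M0.smult_closed) simp_all
    ultimately show ?thesis by simp
  qed
  \<comment> \<open>as \<open>2 W = 0\<close>, its lift \<open>Q\<close> is divisible by \<open>t\<close>, and the quotient has only one factor \<open>t\<close>\<close>
  have one: "1 \<in> ?I" using n4 by simp
  have twoB: "2 \<in> base_ring" using two special_base_base_ring by auto
  define Q where "Q = \<iota> 2 \<odot>\<^bsub>?M\<^esub> (g 1 1 \<otimes>\<^bsub>?M\<^esub> g 2 1)"
  have gg: "g 1 1 \<otimes>\<^bsub>?M\<^esub> g 2 1 \<in> carrier ?M" using gI[OF one] by (intro M.m_closed)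
  have Q_cl: "Q \<in> carrier ?M" unfolding Q_def using twoB gg by (intro M.smult_closed) simp_all
  have sg: "s (g j 1) = w j" if "j \<in> {1..n}" for j
    unfolding g_def w_def using s_i[OF that tx_power_order_ring[of 1]] psi_basis[of 1] n4 by simp
  have "s Q = \<iota> (\<epsilon> 2) \<odot>\<^bsub>?D\<^esub> W"
    unfolding Q_def s_sm[OF twoB gg] W_def ring_hom_mult[OF s gI(1)[OF one] gI(2)[OF one]] sg[OF idx(1)] sg[OF idx(2)] ..
  then have "s Q = \<zero>\<^bsub>?D\<^esub>" using zero2 eps_special_base[OF two] by simp
  then obtain r where r: "r \<in> carrier ?M" "Q = \<iota> t \<odot>\<^bsub>?M\<^esub> r" using s_ker[OF Q_cl] by blast
  have "ev Q = 2 * (t * ?u * (t * ?v))"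
    unfolding Q_def ev_sm[OF twoB gg] ev_mult[OF gI(1)[OF one] gI(2)[OF one]] g_ev[OF idx(1) one] g_ev[OF idx(2) one] by simp
  moreover have "ev Q = t * ev r" unfolding r(2) by (rule ev_sm[OF t_base_ring r(1)])
  ultimately have evr: "ev r = 2 * t * (?u * ?v)" using t_nonzero by (simp add: algebra_simps)
  \<comment> \<open>the values of \<open>ev\<close> on the generators lie in \<open>first_order_ring\<close>, and this is a ring\<close>
  define \<rho> where "\<rho> = Transposition.transpose (\<pi> 1) (\<pi> 3)"
  define \<sigma> where "\<sigma> = Transposition.transpose (\<pi> 2) (\<pi> 4)"
  note ctx = \<pi>in \<pi>dist \<rho>_def \<sigma>_def
  note first_orders = is_subringD[OF first_order_ring_subring[OF ctx]]
  have Bfo: "b \<in> first_order_ring \<rho> \<sigma>" if "b \<in> base_ring" for b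
  proof (rule first_order_ringI[OF ctx that])
    show "(0::'l) \<in> P" "(0::'l) \<in> P" by (rule is_subringD(2)[OF P])+
    show "skew \<rho> \<sigma> 0 = 0" by (rule skew_K[OF ctx is_subringD(2)[OF K_subring]])
  qed simp
  have "ev m \<in> first_order_ring \<rho> \<sigma>" if "m \<in> carrier ?M" for m
  proof -
    let ?H = "base_image BB ?M \<union> (\<Union>j\<in>{1..n}. i BB AA j ` carrier AA)"
    have Hc: "?H \<subseteq> carrier ?M"
    proof -
      have "base_image BB ?M \<subseteq> carrier ?M" unfolding base_image_def by (auto simp del: ring_copy_simps)
      moreover have "i BB AA j ` carrier AA \<subseteq> carrier ?M" if "j \<in> {1..n}" for j
        using iM[OF that] ring_hom_closed[of "i BB AA j" AA ?M] by (auto simp: alg_hom_def)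
      ultimately show ?thesis by blast
    qed
    have "carrier ?M = generate_ring ?M ?H"
      using gen rank_AA unfolding generated_by_images_def generated_subalgebra_def by metis
    then have "m \<in> generate_ring ?M ?H" using that by simp
    then have "m \<in> carrier ?M \<and> ev m \<in> first_order_ring \<rho> \<sigma>"
    proof (induction rule: generate_ring.induct)
      case one then show ?case using first_orders(1) by (simp add: ev_one)
    next
      case (incl h)
      have "ev h \<in> first_order_ring \<rho> \<sigma>"
      proof (cases "h \<in> base_image BB ?M")
        case True
        then obtain b where "b \<in> base_ring" "h = \<iota> b \<odot>\<^bsub>?M\<^esub> \<one>\<^bsub>?M\<^esub>" by (auto simp: base_image_def)
        then show ?thesis using Bfo ev_sm[of b "\<one>\<^bsub>?M\<^esub>"] by (simp add: ev_one)
      next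
        case False
        then obtain j c where jc: "j \<in> {1..n}" "\<forall>a. c a \<in> base_ring" "h = i BB AA j (\<iota> (\<Sum>a<n. c a * tx_power a))"
          using incl by (auto simp: order_ring_def)
        have "\<pi> j \<in> {1..n}" using \<pi> jc(1) by blast
        then show ?thesis unfolding jc(3) ev_i[OF jc(1,2)] using jc(2) by (intro first_order_ring_conjugate[OF ctx]) auto
      qed
      then show ?case using incl Hc by blast
    qed (auto simp: ev_minus ev_add ev_mult first_orders)
    then show ?thesis ..
  qed
  from this[OF r(1)] have "2 * t * (?u * ?v) \<in> first_order_ring \<rho> \<sigma>" by (simp only: evr)
  then show False using first_order_ring_obstruction[OF ctx] by blast
qed

end

section \<open>Permutations and specialization of polynomials\<close>

type_synonym mono = "nat \<Rightarrow>\<^sub>0 nat"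
type_synonym ipoly = "mono \<Rightarrow>\<^sub>0 int"

text \<open>Integral polynomials form the free abelian group on the monomials, and a multiplicative
  map on the monomials extends to a ring homomorphism.\<close>

lemma frag_extend_mult:
  fixes h :: "'a::comm_monoid_add \<Rightarrow> 'a \<Rightarrow>\<^sub>0 int"
  assumes h: "\<And>m m'. h (m + m') = h m * h m'"
  shows "frag_extend h (p * q) = frag_extend h p * frag_extend h q"
  using subset_UNIV[of "Poly_Mapping.keys p"]
proof (induction p rule: frag_induction)
  case (one m)
  show ?case
    using subset_UNIV[of "Poly_Mapping.keys q"]
  proof (induction q rule: frag_induction)
    case (one m')
    then show ?case by (simp add: mult_single h)
  qed (simp_all add: right_diff_distrib frag_extend_diff)
qed (simp_all add: left_diff_distrib frag_extend_diff)

text \<open>The variable \<open>j\<close> is replaced by the variable \<open>\<sigma> j\<close>; the exponents are therefore precomposed with the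
  inverse of \<open>\<sigma>\<close>.\<close>

definition permute_mono :: "(nat \<Rightarrow> nat) \<Rightarrow> mono \<Rightarrow> mono"
  where "permute_mono \<sigma> m = Poly_Mapping.map_key (inv_into UNIV \<sigma>) m"

context
  fixes \<sigma> :: "nat \<Rightarrow> nat"
  assumes \<sigma>: "bij \<sigma>"
begin

lemma inj_inv_perm: "inj (inv_into UNIV \<sigma>)"
  using bij_imp_bij_inv[OF \<sigma>] by (rule bij_is_inj)

lemma permute_mono_add: "permute_mono \<sigma> (m + m') = permute_mono \<sigma> m + permute_mono \<sigma> m'"
  unfolding permute_mono_def by (rule map_key_plus[OF inj_inv_perm])

lemma permute_mono_zero: "permute_mono \<sigma> 0 = 0"
  unfolding permute_mono_def by (rule map_key_zero[OF inj_inv_perm])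

lemma permute_mono_single: "permute_mono \<sigma> (Poly_Mapping.single j v) = Poly_Mapping.single (\<sigma> j) v"
  using map_key_single[OF inj_inv_perm, of "\<sigma> j" v] inv_f_f[OF bij_is_inj[OF \<sigma>], of j]
  by (simp add: permute_mono_def)

lemma lookup_permute_mono: "Poly_Mapping.lookup (permute_mono \<sigma> m) (\<sigma> j) = Poly_Mapping.lookup m j"
  using inv_f_f[OF bij_is_inj[OF \<sigma>], of j]
  by (simp add: permute_mono_def map_key.rep_eq[OF inj_inv_perm])

lemma permute_mono_comp:
  assumes \<tau>: "bij \<tau>" shows "permute_mono (\<sigma> \<circ> \<tau>) m = permute_mono \<sigma> (permute_mono \<tau> m)"
proof -
  have "inv_into UNIV (\<sigma> \<circ> \<tau>) = inv_into UNIV \<tau> \<circ> inv_into UNIV \<sigma>"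
    by (rule o_inv_distrib[OF \<sigma> \<tau>])
  moreover have "inj (inv_into UNIV \<tau>)" using bij_imp_bij_inv[OF \<tau>] by (rule bij_is_inj)
  ultimately show ?thesis
    unfolding permute_mono_def using map_key_compose[OF inj_inv_perm, of "inv_into UNIV \<tau>" m] by simp
qed

end

definition permute :: "(nat \<Rightarrow> nat) \<Rightarrow> ipoly \<Rightarrow> ipoly"
  where "permute \<sigma> = frag_extend (\<lambda>m. frag_of (permute_mono \<sigma> m))"

lemma permute_hom:
  "permute \<sigma> (p - q) = permute \<sigma> p - permute \<sigma> q" "permute \<sigma> (p + q) = permute \<sigma> p + permute \<sigma> q"
  "permute \<sigma> 0 = 0" "permute \<sigma> (frag_of m) = frag_of (permute_mono \<sigma> m)"
  by (simp_all add: permute_def frag_extend_diff frag_extend_add)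

lemma permute_mult: "bij \<sigma> \<Longrightarrow> permute \<sigma> (p * q) = permute \<sigma> p * permute \<sigma> q"
  unfolding permute_def by (rule frag_extend_mult) (simp add: permute_mono_add mult_single)

lemma one_ipoly: "1 = frag_of (0 :: mono)" by (simp add: single_one)

lemma permute_one: "bij \<sigma> \<Longrightarrow> permute \<sigma> 1 = 1"
  by (simp only: one_ipoly permute_hom permute_mono_zero)

lemma permute_comp: "bij \<sigma> \<Longrightarrow> bij \<tau> \<Longrightarrow> permute (\<sigma> \<circ> \<tau>) p = permute \<sigma> (permute \<tau> p)"
  using subset_UNIV[of "Poly_Mapping.keys p"]
  by (induction p rule: frag_induction) (simp_all add: permute_hom permute_mono_comp)

lemma permute_id: "permute id p = p"
proof -
  have "permute_mono id m = m" for m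
    unfolding permute_mono_def using map_key_id[of m] by (simp add: id_def)
  then show ?thesis
    unfolding permute_def using frag_expansion[of p] by simp
qed

lemma permute_inverse:
  assumes "bij \<sigma>" shows "permute (inv_into UNIV \<sigma>) (permute \<sigma> p) = p"
proof -
  have "inv_into UNIV \<sigma> \<circ> \<sigma> = id" using bij_is_inj[OF assms] by simp
  then show ?thesis using permute_comp[OF bij_imp_bij_inv[OF assms] assms, of p] permute_id by metis
qed

lemma permute_eq_zero: "bij \<sigma> \<Longrightarrow> permute \<sigma> p = 0 \<longleftrightarrow> p = 0"
  using permute_inverse[of \<sigma> p] permute_hom(3) by metis

text \<open>The specialization of the variable \<open>0\<close> to zero.\<close>

definition kill :: "ipoly \<Rightarrow> ipoly"
  where "kill = frag_extend (\<lambda>m. if Poly_Mapping.lookup m 0 = 0 then frag_of m else 0)"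

lemma kill_hom:
  "kill (p - q) = kill p - kill q" "kill (p + q) = kill p + kill q" "kill 0 = 0"
  "kill (frag_of m) = (if Poly_Mapping.lookup m 0 = 0 then frag_of m else 0)"
  by (simp_all add: kill_def frag_extend_diff frag_extend_add)

lemma kill_mult: "kill (p * q) = kill p * kill q"
  unfolding kill_def by (rule frag_extend_mult) (simp add: lookup_add mult_single)

lemma kill_kill: "kill (kill p) = kill p"
  using subset_UNIV[of "Poly_Mapping.keys p"]
  by (induction p rule: frag_induction) (simp_all add: kill_hom)

lemma kill_permute:
  assumes "bij \<sigma>" "\<sigma> 0 = 0" shows "kill (permute \<sigma> p) = permute \<sigma> (kill p)"
  using subset_UNIV[of "Poly_Mapping.keys p"]
proof (induction p rule: frag_induction)
  case (one m)
  show ?case using lookup_permute_mono[OF assms(1), of m 0] assms(2) by (simp add: kill_hom permute_hom)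
qed (simp_all add: kill_hom permute_hom)

abbreviation var_poly :: "nat \<Rightarrow> ipoly" where "var_poly j \<equiv> frag_of (Poly_Mapping.single j 1)"

text \<open>The monomials that are killed are divisible by the variable \<open>0\<close>.\<close>

lemma kill_remainder: "\<exists>q. p = kill p + var_poly 0 * q"
  using subset_UNIV[of "Poly_Mapping.keys p"]
proof (induction p rule: frag_induction)
  case (one m)
  show ?case
  proof (cases "Poly_Mapping.lookup m 0")
    case 0
    then show ?thesis by (intro exI[of _ 0]) (simp add: kill_hom)
  next
    case (Suc k)
    have "m = Poly_Mapping.single 0 1 + (m - Poly_Mapping.single 0 1)"
      using Suc by (intro poly_mapping_eqI) (auto simp: lookup_add lookup_minus lookup_single when_def)
    then show ?thesis
      using Suc by (intro exI[of _ "frag_of (m - Poly_Mapping.single 0 1)"]) (simp add: kill_hom mult_single)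
  qed
next
  case (diff a b)
  then obtain q r where q: "a = kill a + var_poly 0 * q" and r: "b = kill b + var_poly 0 * r" by blast
  have "a - b = (kill a + var_poly 0 * q) - (kill b + var_poly 0 * r)"
    by (rule arg_cong2[where f = minus, OF q r])
  also have "\<dots> = kill (a - b) + var_poly 0 * (q - r)"
    by (simp only: kill_hom right_diff_distrib add_diff_add)
  finally show ?case by blast
qed (simp add: kill_hom)

lemma in_subring_of_vars:
  assumes zero: "0 \<in> E" and one: "1 \<in> E" and diff: "\<And>a b. a \<in> E \<Longrightarrow> b \<in> E \<Longrightarrow> a - b \<in> E"
    and mult: "\<And>a b. a \<in> E \<Longrightarrow> b \<in> E \<Longrightarrow> a * b \<in> E" and vars: "\<And>j. var_poly j \<in> E"
  shows "p \<in> E"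
proof -
  have pow: "frag_of (Poly_Mapping.single j v) \<in> E" for j v :: nat
  proof (induction v)
    case (Suc v)
    have "frag_of (Poly_Mapping.single j (Suc v)) = var_poly j * frag_of (Poly_Mapping.single j v)"
      by (simp add: mult_single single_add[symmetric])
    then show ?case using mult[OF vars Suc] by simp
  qed (use one in \<open>simp add: single_one\<close>)
  have mono: "frag_of m \<in> E" for m :: mono
  proof (induction m rule: update_induct)
    case const
    then show ?case using one by (simp add: single_one)
  next
    case (update m j v)
    have "Poly_Mapping.update j v m = Poly_Mapping.single j v + m"
      using update(1) by (intro poly_mapping_eqI) (auto simp: lookup_update lookup_add lookup_single when_def in_keys_iff)
    then have "frag_of (Poly_Mapping.update j v m) = frag_of (Poly_Mapping.single j v) * frag_of m"
      by (simp add: mult_single)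
    then show ?case using mult[OF pow update(3)] by simp
  qed
  show ?thesis
    using subset_UNIV[of "Poly_Mapping.keys p"]
    by (induction p rule: frag_induction) (auto intro: zero diff mono)
qed


section \<open>Its field of fractions\<close>

abbreviation emb :: "ipoly \<Rightarrow> ipoly fract" where "emb p \<equiv> Fract p 1"

lemma emb_eq: "emb p = emb q \<longleftrightarrow> p = q" by (simp add: eq_fract)

lemma emb_hom: "emb (p + q) = emb p + emb q" "emb (p * q) = emb p * emb q" "emb (p - q) = emb p - emb q"
  "emb (- p) = - emb p" "emb 1 = 1" "emb 0 = 0"
  by (simp_all add: One_fract_def Zero_fract_def)

definition permute_fract :: "(nat \<Rightarrow> nat) \<Rightarrow> ipoly fract \<Rightarrow> ipoly fract"
  where "permute_fract \<sigma> u = (SOME v. \<exists>a b. b \<noteq> 0 \<and> u = Fract a b \<and> v = Fract (permute \<sigma> a) (permute \<sigma> b))"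

lemma permute_fract:
  assumes \<sigma>: "bij \<sigma>" and b: "b \<noteq> 0"
  shows "permute_fract \<sigma> (Fract a b) = Fract (permute \<sigma> a) (permute \<sigma> b)"
  unfolding permute_fract_def
proof (rule some_equality)
  fix v assume "\<exists>c d. d \<noteq> 0 \<and> Fract a b = Fract c d \<and> v = Fract (permute \<sigma> c) (permute \<sigma> d)"
  then obtain c d where cd: "d \<noteq> 0" "Fract a b = Fract c d" "v = Fract (permute \<sigma> c) (permute \<sigma> d)" by blast
  then have "a * d = c * b" using b by (simp add: eq_fract)
  then have "permute \<sigma> a * permute \<sigma> d = permute \<sigma> c * permute \<sigma> b"
    using permute_mult[OF \<sigma>] by metis
  then show "v = Fract (permute \<sigma> a) (permute \<sigma> b)"
    using b cd by (simp add: eq_fract permute_eq_zero[OF \<sigma>])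
qed (use b in blast)

lemma permute_emb: "bij \<sigma> \<Longrightarrow> permute_fract \<sigma> (emb p) = emb (permute \<sigma> p)"
  by (simp add: permute_fract permute_one)

text \<open>A fraction whose denominator is divisible by the variable \<open>0\<close> cannot be specialized; on polynomials
  the function is the specialization.\<close>

definition kill_fract :: "ipoly fract \<Rightarrow> ipoly fract"
  where "kill_fract u = emb (kill (inv_into UNIV emb u))"

lemma kill_emb [simp]: "kill_fract (emb p) = emb (kill p)"
proof -
  have "inj emb" by (rule injI) (simp only: emb_eq)
  then have "inv_into UNIV emb (emb p) = p" by (rule inv_into_f_f[OF _ UNIV_I])
  then show ?thesis by (simp only: kill_fract_def)
qed

text \<open>The variable \<open>0\<close> is \<open>t\<close>.  The variables above \<open>n\<close> are invariant and so belong to the first kind of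
  generators of the polynomials.\<close>

lemma perm_field_fract:
  assumes n: "n \<ge> 4"
  shows "perm_field n permute_fract (\<lambda>j. emb (var_poly j)) (range emb) (emb (var_poly 0)) kill_fract"
proof
  have bij: "bij \<sigma>" if "\<sigma> permutes {1..n}" for \<sigma> using that by (rule permutes_bij)
  have zero: "\<sigma> 0 = 0" if "\<sigma> permutes {1..n}" for \<sigma> using permutes_not_in[OF that, of 0] by simp
  show "n \<ge> 4" by (rule n)
  fix \<sigma> assume \<sigma>: "\<sigma> permutes {1..n}"
  note b = bij[OF \<sigma>]
  have pz: "d \<noteq> 0 \<Longrightarrow> permute \<sigma> d \<noteq> 0" for d using permute_eq_zero[OF b] by simp
  show "permute_fract \<sigma> (u + v) = permute_fract \<sigma> u + permute_fract \<sigma> v" for u v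
    by (cases u; cases v) (simp add: permute_fract[OF b] permute_hom permute_mult[OF b] pz)
  show "permute_fract \<sigma> (u * v) = permute_fract \<sigma> u * permute_fract \<sigma> v" for u v
    by (cases u; cases v) (simp add: permute_fract[OF b] permute_mult[OF b] pz)
  show "permute_fract \<sigma> 1 = 1"
    using permute_emb[OF b, of 1] by (simp only: emb_hom permute_one[OF b])
  show "permute_fract (\<sigma> \<circ> \<tau>) u = permute_fract \<sigma> (permute_fract \<tau> u)" if "\<tau> permutes {1..n}" for \<tau> u
    using permute_eq_zero[OF bij[OF that]]
    by (cases u) (simp add: permute_fract[OF b] permute_fract[OF bij[OF that]] permute_fract[OF bij_comp[OF bij[OF that] b]] permute_comp[OF b bij[OF that]])
  show "permute_fract \<sigma> (emb (var_poly j)) = emb (var_poly (\<sigma> j))" for j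
    by (simp add: permute_emb[OF b] permute_hom permute_mono_single[OF b])
  show "permute_fract \<sigma> u \<in> range emb" if "u \<in> range emb" for u using that permute_emb[OF b] by auto
  show "permute_fract \<sigma> (emb (var_poly 0)) = emb (var_poly 0)"
    by (simp add: permute_emb[OF b] permute_hom permute_mono_single[OF b] zero[OF \<sigma>])
  show "kill_fract (permute_fract \<sigma> u) = permute_fract \<sigma> (kill_fract u)" if "u \<in> range emb" for u
    using that by (auto simp: permute_emb[OF b] kill_permute[OF b zero[OF \<sigma>]])
next
  show "permute_fract id u = u" for u
    by (cases u) (simp add: permute_fract permute_id)
  show "inj_on (\<lambda>j. emb (var_poly j)) {1..n}"
  proof (rule inj_onI)
    fix j k assume "emb (var_poly j) = emb (var_poly k)"
    then have "Poly_Mapping.single j (1::nat) = Poly_Mapping.single k 1" by (simp only: emb_eq frag_of_eq)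
    then show "j = k" by (metis lookup_single_eq lookup_single_not_eq zero_neq_one)
  qed
  show "is_subring (range emb)"
    unfolding is_subring_def by (auto simp: emb_hom[symmetric] simp del: add_fract mult_fract minus_fract)
  show "emb (var_poly 0) \<noteq> 0" by (simp add: Zero_fract_def eq_fract)
  show "kill_fract 1 = 1"
  proof -
    have "kill 1 = 1" by (simp only: one_ipoly kill_hom) simp
    then show ?thesis using kill_emb[of 1] by (simp only: emb_hom)
  qed
  show "kill_fract (emb (var_poly 0)) = 0" by (simp add: kill_hom Zero_fract_def)
  show "kill_fract (emb (var_poly j)) = emb (var_poly j)" if "j \<in> {1..n}" for j
    using that by (simp add: kill_hom lookup_single)
  show "\<exists>p\<in>range emb. \<exists>q\<in>range emb. q \<noteq> 0 \<and> u = p / q" for u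
    by (cases u) (auto simp: Zero_fract_def eq_fract intro!: bexI[of _ "emb _"])
  show "(2 :: ipoly fract) \<noteq> 0"
  proof -
    have "(2 :: ipoly) \<noteq> 0" by simp
    moreover have "(2 :: ipoly fract) = emb 2" using Fract_of_nat_eq[of 2, where 'a = ipoly] by simp
    ultimately show ?thesis using emb_eq[of 2 0] by (simp only: emb_hom) simp
  qed
  fix u v assume "u \<in> range emb" "v \<in> range emb"
  then show "kill_fract (u + v) = kill_fract u + kill_fract v" "kill_fract (u * v) = kill_fract u * kill_fract v"
    by (auto simp: kill_hom kill_mult emb_hom[symmetric] simp del: add_fract mult_fract)
next
  fix u assume u: "u \<in> range emb"
  show "kill_fract u \<in> range emb" "kill_fract (kill_fract u) = kill_fract u" using u by (auto simp: kill_kill)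
  from u obtain p where p: "u = emb p" by blast
  obtain q where "p = kill p + var_poly 0 * q" using kill_remainder by blast
  then have "emb p = kill_fract (emb p) + emb (var_poly 0) * emb q" by (simp only: kill_emb emb_hom[symmetric])
  then show "\<exists>b\<in>range emb. u = kill_fract u + emb (var_poly 0) * b" unfolding p by blast
next
  fix E assume E: "is_subring E"
    and inv: "\<And>a. a \<in> range emb \<Longrightarrow> \<forall>\<sigma>. \<sigma> permutes {1..n} \<longrightarrow> permute_fract \<sigma> a = a \<Longrightarrow> a \<in> E"
    and xs: "\<And>j. j \<in> {1..n} \<Longrightarrow> emb (var_poly j) \<in> E"
  note Ec = is_subringD[OF E]
  have "emb p \<in> E" for p
  proof -
    have "p \<in> {p. emb p \<in> E}"
    proof (rule in_subring_of_vars)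
      show "var_poly j \<in> {p. emb p \<in> E}" for j
      proof (cases "j \<in> {1..n}")
        case False
        have "permute_fract \<sigma> (emb (var_poly j)) = emb (var_poly j)" if "\<sigma> permutes {1..n}" for \<sigma>
          using permutes_not_in[OF that False] permutes_bij[OF that]
          by (simp add: permute_emb permute_hom permute_mono_single)
        then show ?thesis using inv[of "emb (var_poly j)"] by blast
      qed (use xs in simp)
    qed (use Ec in \<open>simp_all only: mem_Collect_eq emb_hom\<close>)
    then show ?thesis by simp
  qed
  then show "range emb \<subseteq> E" by blast
qed auto


section \<open>Countability\<close>

text \<open>A finitely supported function is determined by the finite part of its graph over the support.\<close>

lemma countable_poly_mapping:
  assumes "countable (UNIV :: 'a set)" "countable (UNIV :: 'b::zero set)"
  shows "countable (UNIV :: ('a \<Rightarrow>\<^sub>0 'b) set)"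
proof -
  let ?g = "\<lambda>p :: 'a \<Rightarrow>\<^sub>0 'b. (\<lambda>k. (k, Poly_Mapping.lookup p k)) ` Poly_Mapping.keys p"
  have "inj ?g"
  proof (rule injI)
    fix p q :: "'a \<Rightarrow>\<^sub>0 'b" assume eq: "?g p = ?g q"
    have g: "(k, v) \<in> ?g r \<longleftrightarrow> Poly_Mapping.lookup r k = v \<and> v \<noteq> 0" for r k v
      by (auto simp: in_keys_iff)
    show "p = q"
    proof (rule poly_mapping_eqI)
      fix k
      show "Poly_Mapping.lookup p k = Poly_Mapping.lookup q k"
        using g[of k _ p] g[of k _ q] eq by metis
    qed
  qed
  moreover have "countable {A :: ('a \<times> 'b) set. finite A \<and> A \<subseteq> UNIV \<times> UNIV}"
    by (intro countable_Collect_finite_subset countable_SIGMA assms)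
  then have "countable (range ?g)" by (rule countable_subset[rotated]) auto
  ultimately show ?thesis by (rule countable_image_inj_on[rotated])
qed

lemma countable_fract: "countable (UNIV :: ipoly fract set)"
proof -
  have "countable (UNIV :: mono set)" by (rule countable_poly_mapping) simp_all
  then have c: "countable (UNIV :: ipoly set)" by (rule countable_poly_mapping) simp
  have "u \<in> (\<lambda>(a, b). Fract a b) ` (UNIV \<times> UNIV)" for u :: "ipoly fract"
    by (cases u) (auto intro: rev_image_eqI)
  then have "(UNIV :: ipoly fract set) = (\<lambda>(a, b). Fract a b) ` (UNIV \<times> UNIV)" by blast
  moreover have "countable ((\<lambda>(a, b). Fract a b) ` ((UNIV :: ipoly set) \<times> UNIV))"
    using c by (intro countable_image countable_SIGMA)
  ultimately show ?thesis by simp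
qed

section \<open>Nonexistence of closures\<close>

theorem theorem20:
  fixes n :: nat
  assumes "n \<ge> 4" and "infinite (UNIV :: 'u set)"
  shows "\<not> (\<exists>(G :: ('u, 'g) closure_obj) (i :: ('u, 'g) closure_emb) (F :: ('u, 'g) closure_mor).
            closure_assignment n G i \<and>
            generated_by_images n G i \<and>
            functorial n G i F \<and>
            respects_base_change n G i F \<and>
            extends_galois_closure n G i)"
proof
  assume "\<exists>(G :: ('u, 'g) closure_obj) (i :: ('u, 'g) closure_emb) (F :: ('u, 'g) closure_mor).
            closure_assignment n G i \<and> generated_by_images n G i \<and> functorial n G i F \<and>
            respects_base_change n G i F \<and> extends_galois_closure n G i"
  then obtain G :: "('u, 'g) closure_obj" and i F where G: "closure_assignment n G i"
    "generated_by_images n G i" "functorial n G i F" "respects_base_change n G i F" "extends_galois_closure n G i"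
    by blast
  obtain f :: "nat \<Rightarrow> 'u" where f: "inj f"
    using infinite_countable_subset[OF assms(2)] by blast
  have "inj (f \<circ> to_nat_on (UNIV :: ipoly fract set))"
    using f inj_on_to_nat_on[OF countable_fract] by (intro inj_compose)
  then interpret galois_copy n permute_fract "\<lambda>j. emb (var_poly j)" "range emb" "emb (var_poly 0)" kill_fract
      "f \<circ> to_nat_on (UNIV :: ipoly fract set)"
    by (intro galois_copy.intro perm_field_fract assms(1) carrier_copy.intro)
  show False by (rule no_closure[OF G])
qed


end
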